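(* Let $\rho_k\to\rho\ge0$ and $\tau_k\to\tau\ge0$ be sequences of nonnegative numbers, each of which is either constant or convergent to $0$. Then, possibly up to the extraction of a subsequence in the case $(\rho,\tau)=(0,0)$, one has $$(\varepsilon,z)_{\rho_k,\tau_k}\to(\varepsilon,z)_{\rho,\tau}\quad\text{pointwise in }[0,T],$$ where $(\varepsilon,z)_{\rho,\tau}$ denotes the incremental solution if $\tau>0$ and an energetic solution if $\tau=0$ (see context). For $(\rho,\tau)=(0,0)$ this means that the limit of the subsequence is some energetic solution for $\rho=0$.
   Context: $\mathbb R^{3\times3}_{\rm sym}$ is the space of symmetric $3\times3$ matrices with $a:b=\mathrm{tr}(ab)$ and norm $|\cdot|$; $\mathbb R^{3\times3}_{\rm dev}$ is its trace-free subspace. $\mathbb C:\mathbb R^{3\times3}_{\rm sym}\to\mathbb R^{3\times3}_{\rm sym}$ is linear, symmetric, positive definite, and leaves $\mathbb R^{3\times3}_{\rm dev}$ and $\mathbb R 1_2$ invariant. $c_1,c_2,c_3>0$. $F_0(a)=c_1|a|+c_2|a|^2+I(a)$ on $\mathbb R^{3\times3}_{\rm dev}$, with $I(a)=0$ if $|a|\le c_3$, $+\infty$ otherwise. For $\rho>0$, $F_\rho(a)=c_1(\sqrt{\rho^2+|a|^2}-\rho)+c_2|a|^2+\varphi(|a|)/\rho$ with a fixed $\varphi\in C^{2,1}(\mathbb R)$, convex, non-decreasing, $\varphi'\in L^\infty(\mathbb R)$, $\varphi(r)=0$ iff $r\le c_3$. $W_\rho(\varepsilon,z)=\frac12\mathbb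 C(\varepsilon-z):(\varepsilon-z)+F_\rho(z)$. $D:\mathbb R^{3\times3}_{\rm dev}\to[0,\infty)$ is lower semicontinuous, positively 1-homogeneous, satisfies $D(b+c)\le D(b)+D(c)$ and $D(a)\ge c_D|a|$ for some $c_D>0$. $\mathrm{Diss}_D(z,[s,t])=\sup\sum_iD(z(t_i)-z(t_{i-1}))$ over all finite partitions of $[s,t]$. Data independent of the parameters: $\sigma\in W^{1,1}(0,T;\mathbb R^{3\times3}_{\rm sym})$ and $(\varepsilon_0,z_0)\in\mathbb R^{3\times3}_{\rm sym}\times\mathbb R^{3\times3}_{\rm dev}$. Put $S_\rho(t)=\{(\varepsilon,z): W_\rho(\varepsilon,z)-\sigma(t):\varepsilon\le W_\rho(\bar\varepsilon,\bar z)-\sigma(t):\bar\varepsilon+D(\bar z-z)\ \forall(\bar\varepsilon,\bar z)\}$. If $\tau=0$ it is assumed that $(\varepsilon_0,z_0)\in S_{\rho_k}(0)$ for all $k$ and $(\varepsilon_0,z_0)\in S_\rho(0)$. Solutions: for $\tau>0$, given a partition $0=t_0<\dots<t_N=T$ of diameter $\tau$ (the same partition for all indices with the same $\tau$), $(\varepsilon,z)_{\rho,\tau}$ is the right-continuous piecewise constant interpolant (value $(\varepsilon^i,z^i)$ on $[t_i,t_{i+1})$ and $(\varepsilon^N,z^N)$ at $T$) of the unique $(\varepsilon^i,z^i)$ with $(\varepsilon^0,z^0)=(\varepsilon_0,z_0)$ and $(\varepsilon^i,z^i)$ minimizing $W_\rho(\varepsilon,z)-\sigma(t_i):\varepsilon+D(z-z^{i-1})$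 over $\mathbb R^{3\times3}_{\rm sym}\times\mathbb R^{3\times3}_{\rm dev}$, $i=1,\dots,N$. For $\tau=0$, $(\varepsilon,z)_{\rho,0}$ is an energetic solution: a map on $[0,T]$ with value $(\varepsilon_0,z_0)$ at $0$, $\dot\sigma:\varepsilon$ integrable, and for all $t$: $(\varepsilon(t),z(t))\in S_\rho(t)$ and $W_\rho(\varepsilon(t),z(t))-\sigma(t):\varepsilon(t)+\mathrm{Diss}_D(z,[0,t])=W_\rho(\varepsilon_0,z_0)-\sigma(0):\varepsilon_0-\int_0^t\dot\sigma:\varepsilon\,ds$. *)

theory Defs
  imports "HOL-Analysis.Analysis"
begin

section \<open>Matrices\<close>

type_synonym mat3 = "real^3^3"

definition Sym3 :: "(mat3) set" where
  "Sym3 = {a. transpose a = a}"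

definition Dev3 :: "(mat3) set" where
  "Dev3 = {a \<in> Sym3. trace a = 0}"

text \<open>On \<^term>\<open>Sym3\<close> the contraction \<open>a : b = tr (ab)\<close> is the library inner product of
  \<^typ>\<open>mat3\<close>, and the associated norm is the library norm.\<close>

lemma inner_eq_trace:
  fixes a b :: "mat3"
  assumes "a \<in> Sym3"
  shows "a \<bullet> b = trace (a ** b)"
proof -
  have sym: "a $ i $ j = a $ j $ i" for i j
    using assms unfolding Sym3_def transpose_def by (auto simp: vec_eq_iff)
  have "a \<bullet> b = (\<Sum>i\<in>UNIV. \<Sum>j\<in>UNIV. a $ i $ j * b $ i $ j)"
    by (simp add: inner_vec_def)
  also have "\<dots> = (\<Sum>j\<in>UNIV. \<Sum>i\<in>UNIV. a $ i $ j * b $ i $ j)"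
    by (rule sum.swap)
  also have "\<dots> = (\<Sum>j\<in>UNIV. \<Sum>i\<in>UNIV. a $ j $ i * b $ i $ j)"
    using sym by (intro sum.cong refl) metis
  also have "\<dots> = trace (a ** b)"
    by (simp add: trace_def matrix_matrix_mult_def)
  finally show ?thesis .
qed

text \<open>Only the values of \<open>C\<close> on \<^term>\<open>Sym3\<close> matter.\<close>

definition elastic_tensor :: "(mat3 \<Rightarrow> mat3) \<Rightarrow> bool" where
  "elastic_tensor C \<longleftrightarrow>
     C ` Sym3 \<subseteq> Sym3 \<and>
     (\<forall>a\<in>Sym3. \<forall>b\<in>Sym3. C (a + b) = C a + C b) \<and>
     (\<forall>r. \<forall>a\<in>Sym3. C (r *\<^sub>R a) = r *\<^sub>R C a) \<and>
     (\<forall>a\<in>Sym3. \<forall>b\<in>Sym3. C a \<bullet> b = a \<bullet> C b) \<and>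
     (\<forall>a\<in>Sym3. a \<noteq> 0 \<longrightarrow> C a \<bullet> a > 0) \<and>
     C ` Dev3 \<subseteq> Dev3 \<and>
     C ` span {mat 1} \<subseteq> span {mat 1}"


section \<open>Energy and dissipation\<close>

text \<open>\<open>C\<^sup>2\<^sup>,\<^sup>1(\<real>)\<close> is read locally: twice differentiable, with locally Lipschitz (hence continuous)
  second derivative.\<close>

definition C21 :: "(real \<Rightarrow> real) \<Rightarrow> bool" where
  "C21 \<phi> \<longleftrightarrow>
     (\<forall>x. \<phi> field_differentiable (at x)) \<and>
     (\<forall>x. deriv \<phi> field_differentiable (at x)) \<and>
     (\<forall>R. \<exists>L. L-lipschitz_on {-R..R} (deriv (deriv \<phi>)))"

text \<open>Since \<open>deriv \<phi>\<close> is continuous, its essential boundedness is boundedness.\<close>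

definition penalty_fun :: "real \<Rightarrow> (real \<Rightarrow> real) \<Rightarrow> bool" where
  "penalty_fun c3 \<phi> \<longleftrightarrow>
     C21 \<phi> \<and> convex_on UNIV \<phi> \<and> mono \<phi> \<and> bounded (range (deriv \<phi>)) \<and>
     (\<forall>r. \<phi> r = 0 \<longleftrightarrow> r \<le> c3)"

definition hardening ::
  "real \<Rightarrow> real \<Rightarrow> real \<Rightarrow> (real \<Rightarrow> real) \<Rightarrow> real \<Rightarrow> mat3 \<Rightarrow> ereal" where
  "hardening c1 c2 c3 \<phi> \<rho> a =
     (if \<rho> = 0 then ereal (c1 * norm a + c2 * (norm a)\<^sup>2) + (if norm a \<le> c3 then 0 else \<infinity>)
      else ereal (c1 * (sqrt (\<rho>\<^sup>2 + (norm a)\<^sup>2) - \<rho>) + c2 * (norm a)\<^sup>2 + \<phi> (norm a) / \<rho>))"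

definition stored_energy ::
  "(mat3 \<Rightarrow> mat3) \<Rightarrow> real \<Rightarrow> real \<Rightarrow> real \<Rightarrow> (real \<Rightarrow> real)
    \<Rightarrow> real \<Rightarrow> mat3 \<Rightarrow> mat3 \<Rightarrow> ereal" where
  "stored_energy C c1 c2 c3 \<phi> \<rho> \<epsilon> z =
     ereal (1 / 2 * (C (\<epsilon> - z) \<bullet> (\<epsilon> - z))) + hardening c1 c2 c3 \<phi> \<rho> z"

definition lower_semicontinuous_on :: "'a::topological_space set \<Rightarrow> ('a \<Rightarrow> real) \<Rightarrow> bool" where
  "lower_semicontinuous_on S f \<longleftrightarrow>
     (\<forall>x\<in>S. \<forall>c. c < f x \<longrightarrow> (\<forall>\<^sub>F y in at x within S. c < f y))"

definition dissipation_potential :: "(mat3 \<Rightarrow> real) \<Rightarrow> bool" where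
  "dissipation_potential D \<longleftrightarrow>
     (\<forall>a\<in>Dev3. 0 \<le> D a) \<and>
     lower_semicontinuous_on Dev3 D \<and>
     (\<forall>r\<ge>0. \<forall>a\<in>Dev3. D (r *\<^sub>R a) = r * D a) \<and>
     (\<forall>b\<in>Dev3. \<forall>c\<in>Dev3. D (b + c) \<le> D b + D c) \<and>
     (\<exists>cD>0. \<forall>a\<in>Dev3. cD * norm a \<le> D a)"

text \<open>The partition \<open>a = p 0 < \<dots> < p n = b\<close>; if \<open>a = b\<close>, this forces \<open>n = 0\<close>.\<close>

definition partition_on_interval :: "real \<Rightarrow> real \<Rightarrow> nat \<Rightarrow> (nat \<Rightarrow> real) \<Rightarrow> bool" where
  "partition_on_interval a b n p \<longleftrightarrow> p 0 = a \<and> p n = b \<and> (\<forall>i<n. p i < p (Suc i))"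

definition total_dissipation ::
  "(mat3 \<Rightarrow> real) \<Rightarrow> (real \<Rightarrow> mat3) \<Rightarrow> real \<Rightarrow> real \<Rightarrow> ereal" where
  "total_dissipation D z s t =
     (SUP (n, p) \<in> {(n, p). partition_on_interval s t n p}.
        ereal (\<Sum>i<n. D (z (p (Suc i)) - z (p i))))"


section \<open>Loading\<close>

text \<open>\<open>\<sigma> \<in> W\<^sup>1\<^sup>,\<^sup>1(0,T;X)\<close>, identified with its continuous representative on \<open>[0,T]\<close>, with weak
  derivative represented by \<open>\<sigma>'\<close>. Test functions are \<open>C\<^sup>1\<close> with compact support in \<open>(0,T)\<close>.\<close>

definition W11_with_derivative ::
  "real \<Rightarrow> 'a::euclidean_space set \<Rightarrow> (real \<Rightarrow> 'a) \<Rightarrow> (real \<Rightarrow> 'a) \<Rightarrow> bool" where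
  "W11_with_derivative T X \<sigma> \<sigma>' \<longleftrightarrow>
     (\<forall>t\<in>{0..T}. \<sigma> t \<in> X \<and> \<sigma>' t \<in> X) \<and>
     continuous_on {0..T} \<sigma> \<and>
     \<sigma>' absolutely_integrable_on {0..T} \<and>
     (\<forall>\<eta> :: real \<Rightarrow> real.
        \<eta> C1_differentiable_on UNIV \<and> (\<exists>K. compact K \<and> K \<subseteq> {0<..<T} \<and> (\<forall>t. t \<notin> K \<longrightarrow> \<eta> t = 0))
        \<longrightarrow> integral {0..T} (\<lambda>t. deriv \<eta> t *\<^sub>R \<sigma> t) = - integral {0..T} (\<lambda>t. \<eta> t *\<^sub>R \<sigma>' t))"


section \<open>Solutions\<close>

text \<open>Below \<open>W\<close> is the stored energy for a fixed value of \<open>\<rho>\<close>. The argument \<open>s\<close> of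
  \<open>stable_states\<close> is the current stress \<open>\<sigma> t\<close>.\<close>

definition stable_states ::
  "(mat3 \<Rightarrow> mat3 \<Rightarrow> ereal) \<Rightarrow> (mat3 \<Rightarrow> real) \<Rightarrow> mat3 \<Rightarrow> (mat3 \<times> mat3) set" where
  "stable_states W D s =
     {(\<epsilon>, z). \<epsilon> \<in> Sym3 \<and> z \<in> Dev3 \<and>
        (\<forall>\<epsilon>'\<in>Sym3. \<forall>z'\<in>Dev3.
           W \<epsilon> z - ereal (s \<bullet> \<epsilon>) \<le> W \<epsilon>' z' - ereal (s \<bullet> \<epsilon>') + ereal (D (z' - z)))}"

definition energetic_solution ::
  "(mat3 \<Rightarrow> mat3 \<Rightarrow> ereal) \<Rightarrow> (mat3 \<Rightarrow> real) \<Rightarrow> real \<Rightarrow> (real \<Rightarrow> mat3) \<Rightarrow> (real \<Rightarrow> mat3)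
    \<Rightarrow> mat3 \<Rightarrow> mat3 \<Rightarrow> (real \<Rightarrow> mat3) \<Rightarrow> (real \<Rightarrow> mat3) \<Rightarrow> bool" where
  "energetic_solution W D T \<sigma> \<sigma>' \<epsilon>0 z0 \<epsilon> z \<longleftrightarrow>
     \<epsilon> 0 = \<epsilon>0 \<and> z 0 = z0 \<and>
     (\<lambda>s. \<sigma>' s \<bullet> \<epsilon> s) absolutely_integrable_on {0..T} \<and>
     (\<forall>t\<in>{0..T}.
        (\<epsilon> t, z t) \<in> stable_states W D (\<sigma> t) \<and>
        W (\<epsilon> t) (z t) - ereal (\<sigma> t \<bullet> \<epsilon> t) + total_dissipation D z 0 t =
        W \<epsilon>0 z0 - ereal (\<sigma> 0 \<bullet> \<epsilon>0) - ereal (integral {0..t} (\<lambda>s. \<sigma>' s \<bullet> \<epsilon> s)))"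

definition incremental_solution ::
  "(mat3 \<Rightarrow> mat3 \<Rightarrow> ereal) \<Rightarrow> (mat3 \<Rightarrow> real) \<Rightarrow> (real \<Rightarrow> mat3)
    \<Rightarrow> mat3 \<Rightarrow> mat3 \<Rightarrow> nat \<Rightarrow> (nat \<Rightarrow> real)
    \<Rightarrow> (real \<Rightarrow> mat3) \<Rightarrow> (real \<Rightarrow> mat3) \<Rightarrow> bool" where
  "incremental_solution W D \<sigma> \<epsilon>0 z0 n p \<epsilon> z \<longleftrightarrow>
     (\<exists>e \<zeta>. e 0 = \<epsilon>0 \<and> \<zeta> 0 = z0 \<and>
        (\<forall>i<n. is_arg_min
           (\<lambda>(\<epsilon>', z'). W \<epsilon>' z' - ereal (\<sigma> (p (Suc i)) \<bullet> \<epsilon>') + ereal (D (z' - \<zeta> i)))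
           (\<lambda>(\<epsilon>', z'). \<epsilon>' \<in> Sym3 \<and> z' \<in> Dev3)
           (e (Suc i), \<zeta> (Suc i))) \<and>
        (\<forall>i<n. \<forall>t\<in>{p i..<p (Suc i)}. \<epsilon> t = e i \<and> z t = \<zeta> i) \<and>
        \<epsilon> (p n) = e n \<and> z (p n) = \<zeta> n)"

definition partition_of_diameter :: "real \<Rightarrow> real \<Rightarrow> nat \<Rightarrow> (nat \<Rightarrow> real) \<Rightarrow> bool" where
  "partition_of_diameter T \<tau> n p \<longleftrightarrow>
     partition_on_interval 0 T n p \<and> Max ((\<lambda>i. p (Suc i) - p i) ` {..<n}) = \<tau>"

text \<open>\<open>solution W D T \<sigma> \<sigma>' \<epsilon>0 z0 N p \<rho> \<tau> \<epsilon> z\<close>: the pair \<open>(\<epsilon>, z)\<close> qualifies as \<open>(\<epsilon>, z)\<^bsub>\<rho>,\<tau>\<^esub>\<close>, where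
  \<open>W \<rho>\<close> is the stored energy, and the partition of step \<open>\<tau> > 0\<close> has \<open>N \<tau>\<close> steps and nodes \<open>p \<tau> i\<close>;
  it thus depends on \<open>\<tau>\<close> alone.\<close>

definition solution ::
  "(real \<Rightarrow> mat3 \<Rightarrow> mat3 \<Rightarrow> ereal) \<Rightarrow> (mat3 \<Rightarrow> real) \<Rightarrow> real
    \<Rightarrow> (real \<Rightarrow> mat3) \<Rightarrow> (real \<Rightarrow> mat3) \<Rightarrow> mat3 \<Rightarrow> mat3
    \<Rightarrow> (real \<Rightarrow> nat) \<Rightarrow> (real \<Rightarrow> nat \<Rightarrow> real) \<Rightarrow> real \<Rightarrow> real
    \<Rightarrow> (real \<Rightarrow> mat3) \<Rightarrow> (real \<Rightarrow> mat3) \<Rightarrow> bool" where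
  "solution W D T \<sigma> \<sigma>' \<epsilon>0 z0 N p \<rho> \<tau> \<epsilon> z \<longleftrightarrow>
     (if \<tau> > 0 then incremental_solution (W \<rho>) D \<sigma> \<epsilon>0 z0 (N \<tau>) (p \<tau>) \<epsilon> z
      else energetic_solution (W \<rho>) D T \<sigma> \<sigma>' \<epsilon>0 z0 \<epsilon> z)"

definition constant_or_null :: "(nat \<Rightarrow> real) \<Rightarrow> bool" where
  "constant_or_null x \<longleftrightarrow> (\<exists>c. \<forall>k. x k = c) \<or> x \<longlonglongrightarrow> 0"

definition pointwise_limit_on ::
  "real set \<Rightarrow> (nat \<Rightarrow> real \<Rightarrow> 'a::topological_space) \<Rightarrow> (real \<Rightarrow> 'a) \<Rightarrow> bool" where
  "pointwise_limit_on S f g \<longleftrightarrow> (\<forall>t\<in>S. (\<lambda>k. f k t) \<longlonglongrightarrow> g t)"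

end

theory Submission
  imports Defs "HOL-Complex_Analysis.Great_Picard"
begin

text \<open>Stability forces \<open>\<epsilon> = z + C\<^sup>-\<^sup>1 \<sigma>\<close>, so the problem reduces to the plastic strain \<open>z\<close> with
  energy \<open>F\<^sub>\<rho>(z) - \<sigma> : z\<close> and dissipation \<open>D\<close>. Both kinds of solutions satisfy stability and a
  two-point energy inequality, in the incremental case with the time rounded down to the last node.
  Since \<open>F\<^sub>\<rho> - c\<^sub>2 |z|\<^sup>2\<close> is convex uniformly in \<open>\<rho>\<close>, these two properties alone bound the increments of
  \<open>z\<close> by those of the arc length \<open>\<integral> |\<sigma>'|\<close>. This gives equicontinuity, hence a convergent subsequence, and
  the limit is again stable and satisfies the inequality because \<open>F\<^sub>\<rho>\<close> converges in the sense of
  \<open>\<Gamma>\<close>-convergence; the reverse energy inequality follows from stability along fine partitions. For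
  \<open>\<rho> > 0\<close> energetic solutions are unique by a discrete Gronwall argument for
  \<open>(DF\<^sub>\<rho>(z\<^sub>1) - DF\<^sub>\<rho>(z\<^sub>2)) : (z\<^sub>1 - z\<^sub>2)\<close>, so the whole sequence converges. For \<open>\<tau> > 0\<close> the minimizers of
  each step converge by induction over the steps.\<close>

section \<open>The weak derivative of the loading\<close>

text \<open>No time derivative of a solution is ever taken. Work integrals are evaluated by freezing
  the state at one time; as \<open>z\<close> is Lipschitz in the arc length, the error is quadratic
  in its increment and disappears along fine partitions. For this the bound on the increments must
  be linear in the arc length, while comparing two times directly gives only a square root; a
  supremum over the intermediate times repairs it. The bound also takes the place of Helly's
  selection theorem, since limits at rational times then determine all others. For uniqueness the
  obstacle is that \<open>|z|\<close> is not smooth at the origin. The energies with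
  \<open>\<rho> > 0\<close> are therefore written as functions of \<open>s = |z|^2 / 2\<close>: the
  root \<open>sqrt (\<rho>^2 + 2 * s)\<close> is harmless, and the penalty vanishes for
  \<open>|z| <= c3\<close>. Instead of Hessians, only the difference inequalities that they would
  give are recorded. A finite sublinear \<open>D\<close> on a finite-dimensional space satisfies
  \<open>D a <= L * |a|\<close>, and limits inside \<open>D\<close> are taken through this
  bound.\<close>

definition smooth_step :: "real \<Rightarrow> real" where
  "smooth_step x = 2 * (max 0 x)\<^sup>2 - 4 * (max 0 (x - 1/2))\<^sup>2 + 2 * (max 0 (x - 1))\<^sup>2"

text \<open>The derivative of \<open>smooth_step\<close>: the hat on \<open>[0, 1]\<close> with
  height 2 and mass 1. Hence \<open>tent ((x - u) / h) / h\<close> is a one-sided mollifier carried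
  by \<open>[u, u + h]\<close>.\<close>

definition tent :: "real \<Rightarrow> real" where
  "tent x = 4 * max 0 x - 8 * max 0 (x - 1/2) + 4 * max 0 (x - 1)"

lemma smooth_step_eq_0: "x \<le> 0 \<Longrightarrow> smooth_step x = 0"
  and smooth_step_eq_1: "x \<ge> 1 \<Longrightarrow> smooth_step x = 1"
  by (auto simp: smooth_step_def max_def power2_eq_square algebra_simps)

lemma tent_eq_0: "x \<le> 0 \<or> x \<ge> 1 \<Longrightarrow> tent x = 0"
  by (auto simp: tent_def max_def)

lemma tent_nonneg: "tent x \<ge> 0"
  by (auto simp: tent_def max_def)

lemma continuous_tent: "continuous_on S tent"
  unfolding tent_def by (intro continuous_intros)

lemma max_square_has_derivative:
  "((\<lambda>x::real. (max 0 x)\<^sup>2) has_real_derivative 2 * max 0 x) (at x)"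
proof -
  consider "x < 0" | "x = 0" | "x > 0" by linarith
  then show ?thesis
  proof cases
    case 1
    have "((\<lambda>x::real. 0) has_real_derivative 0) (at x)" by simp
    then have "((\<lambda>x::real. (max 0 x)\<^sup>2) has_real_derivative 0) (at x)"
      by (rule has_field_derivative_transform_within_open[where S="{..<0}"]) (use 1 in auto)
    then show ?thesis using 1 by simp
  next
    case 2
    have "((\<lambda>h. (max 0 h)\<^sup>2 / h) \<longlongrightarrow> 0) (at (0::real))"
    proof (rule tendsto_0_le[where K=1 and f="\<lambda>h. h"])
      show "\<forall>\<^sub>F h in at (0::real). norm ((max 0 h)\<^sup>2 / h) \<le> norm h * 1"
        by (rule always_eventually) (auto simp: max_def power2_eq_square)
    qed (rule tendsto_ident_at)
    then show ?thesis using 2 by (simp add: DERIV_def)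
  next
    case 3
    have "((\<lambda>x::real. x\<^sup>2) has_real_derivative 2 * x) (at x)"
      by (auto intro!: derivative_eq_intros)
    then have "((\<lambda>x::real. (max 0 x)\<^sup>2) has_real_derivative 2 * x) (at x)"
      by (rule has_field_derivative_transform_within_open[where S="{0<..}"]) (use 3 in auto)
    then show ?thesis using 3 by simp
  qed
qed

lemma smooth_step_has_derivative:
  "(smooth_step has_real_derivative tent x) (at x)"
proof -
  have *: "((\<lambda>x::real. (max 0 (x - a))\<^sup>2) has_real_derivative 2 * max 0 (x - a)) (at x)" for a x
  proof -
    have "((\<lambda>x. x - a) has_real_derivative 1) (at x)"
      by (auto intro!: derivative_eq_intros)
    from DERIV_chain2[OF max_square_has_derivative this] show ?thesis by simp
  qed
  show ?thesis
    unfolding smooth_step_def[abs_def] tent_def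
    using DERIV_add[OF DERIV_diff[OF DERIV_cmult[OF max_square_has_derivative] DERIV_cmult[OF *]] DERIV_cmult[OF *],
        of 2 4 "1/2" 2 1 x]
    by simp
qed

lemma smooth_step_bounds: "0 \<le> smooth_step x" "smooth_step x \<le> 1"
proof -
  have mono: "smooth_step a \<le> smooth_step b" if "a \<le> b" for a b
    by (rule DERIV_nonneg_imp_nondecreasing[OF that]) (metis smooth_step_has_derivative tent_nonneg)
  show "0 \<le> smooth_step x"
    using mono[of "min x 0" x] by (simp add: smooth_step_eq_0)
  show "smooth_step x \<le> 1"
    using mono[of x "max x 1"] by (simp add: smooth_step_eq_1)
qed

lemma smooth_step_scaled_derivative:
  "((\<lambda>x. smooth_step ((x - u) / h)) has_real_derivative tent ((x - u) / h) / h) (at x)"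
proof -
  have "((\<lambda>x. (x - u) / h) has_real_derivative 1 / h) (at x)"
    using DERIV_cdivide[OF DERIV_diff[OF DERIV_ident DERIV_const]] by simp
  from DERIV_chain2[OF smooth_step_has_derivative this] show ?thesis by simp
qed

text \<open>The kernel lies to the right of \<open>u\<close>, so it has mass 1 on
  \<open>{0..T}\<close> as soon as \<open>h n < T - u\<close>; the error is then an average of
  \<open>f x - f u\<close> over points within distance \<open>h n\<close> of
  \<open>u\<close>.\<close>

lemma tent_mollifier_limit:
  fixes f :: "real \<Rightarrow> 'a::euclidean_space"
  assumes f: "continuous_on {0..T} f" and u: "0 < u" "u < T"
    and h: "\<And>n. h n > 0" "h \<longlonglongrightarrow> 0"
  shows "(\<lambda>n. integral {0..T} (\<lambda>x. (tent ((x - u) / h n) / h n) *\<^sub>R f x)) \<longlonglongrightarrow> f u"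
proof (rule LIMSEQ_I)
  fix e :: real assume e: "e > 0"
  obtain d where d: "d > 0" "\<And>x. x \<in> {0..T} \<Longrightarrow> dist x u < d \<Longrightarrow> dist (f x) (f u) < e/2"
    using f u e unfolding continuous_on_iff by (metis atLeastAtMost_iff half_gt_zero less_imp_le)
  have "\<forall>\<^sub>F n in sequentially. h n < min d (T - u)"
    using h u d by (intro order_tendstoD) auto
  then obtain n0 where n0: "\<And>n. n \<ge> n0 \<Longrightarrow> h n < min d (T - u)"
    unfolding eventually_sequentially by blast
  show "\<exists>n0. \<forall>n\<ge>n0. norm (integral {0..T} (\<lambda>x. (tent ((x - u) / h n) / h n) *\<^sub>R f x) - f u) < e"
  proof (intro exI allI impI)
    fix n assume "n \<ge> n0"
    then have hn: "h n < d" "h n < T - u" using n0 by fastforce+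
    define b where "b x = tent ((x - u) / h n) / h n" for x
    have "(b has_integral smooth_step ((T - u) / h n) - smooth_step ((0 - u) / h n)) {0..T}"
      unfolding b_def using u h(1)[of n]
      by (intro fundamental_theorem_of_calculus)
         (auto intro!: has_field_derivative_at_within smooth_step_scaled_derivative
           simp flip: has_real_derivative_iff_has_vector_derivative)
    also have "smooth_step ((T - u) / h n) - smooth_step ((0 - u) / h n) = 1"
      using hn u h(1)[of n] by (subst smooth_step_eq_1, simp, subst smooth_step_eq_0) (auto simp: divide_le_0_iff)
    finally have b1: "(b has_integral 1) {0..T}" .
    have cb: "continuous_on {0..T} b" unfolding b_def
      using h(1)[of n]
      by (intro continuous_intros continuous_on_compose2[OF continuous_tent[of UNIV]]) auto
    have i1: "(\<lambda>x. b x *\<^sub>R f x) integrable_on {0..T}"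
      by (intro integrable_continuous_interval continuous_intros cb f)
    have i2: "((\<lambda>x. b x *\<^sub>R f u) has_integral (1 *\<^sub>R f u)) {0..T}"
      by (rule has_integral_scaleR_left[OF b1])
    have "norm (integral {0..T} (\<lambda>x. b x *\<^sub>R f x) - f u)
      = norm (integral {0..T} (\<lambda>x. b x *\<^sub>R f x - b x *\<^sub>R f u))"
      using i1 i2 by (subst integral_diff) (auto simp: integrable_on_def dest: integral_unique)
    also have "\<dots> \<le> integral {0..T} (\<lambda>x. b x * (e/2))"
    proof (rule integral_norm_bound_integral)
      show "(\<lambda>x. b x *\<^sub>R f x - b x *\<^sub>R f u) integrable_on {0..T}"
        using i1 i2 by (intro integrable_diff) auto
      show "(\<lambda>x. b x * (e/2)) integrable_on {0..T}"
        using b1 by (intro integrable_on_mult_left) auto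
      fix x assume x: "x \<in> {0..T}"
      show "norm (b x *\<^sub>R f x - b x *\<^sub>R f u) \<le> b x * (e/2)"
      proof (cases "0 < (x - u) / h n \<and> (x - u) / h n < 1")
        case True
        then have "0 < x - u" "x - u < h n"
          using h(1)[of n] by (simp_all add: zero_less_divide_iff divide_less_eq_1_pos)
        then have "dist x u < d" using hn by (simp add: dist_real_def)
        then have "norm (f x - f u) \<le> e/2" using d x by (force simp: dist_norm)
        then show ?thesis
          unfolding scaleR_diff_right[symmetric] norm_scaleR using h(1)[of n] tent_nonneg
          by (intro mult_mono) (auto simp: b_def)
      next
        case False
        then have "tent ((x - u) / h n) = 0" by (intro tent_eq_0) linarith
        then show ?thesis by (simp add: b_def)
      qed
    qed
    also have "\<dots> = e/2" using b1 by (simp add: integral_unique)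
    finally show "norm (integral {0..T} (\<lambda>x. (tent ((x - u) / h n) / h n) *\<^sub>R f x) - f u) < e"
      using e by (simp add: b_def)
  qed
qed

text \<open>The weak derivative is tested with a \<open>C1\<close> bump that rises on
  \<open>[s, s + h n]\<close> and falls on \<open>[t, t + h n]\<close>. Its derivative is a
  difference of two mollifiers, and the bump itself tends to the indicator of \<open>(s, t]\<close>:
  continuity of \<open>\<sigma>\<close> settles one side, dominated convergence the other.\<close>

lemma W11_increment_interior:
  fixes \<sigma> :: "real \<Rightarrow> 'a::euclidean_space"
  assumes W: "W11_with_derivative T X \<sigma> \<sigma>'" and st: "0 < s" "s \<le> t" "t < T"
  shows "integral {s..t} \<sigma>' = \<sigma> t - \<sigma> s"
proof -
  have cont: "continuous_on {0..T} \<sigma>" and abs: "\<sigma>' absolutely_integrable_on {0..T}"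
    and weak: "\<And>\<eta> :: real \<Rightarrow> real. \<lbrakk>\<eta> C1_differentiable_on UNIV;
        \<exists>K. compact K \<and> K \<subseteq> {0<..<T} \<and> (\<forall>t. t \<notin> K \<longrightarrow> \<eta> t = 0)\<rbrakk>
        \<Longrightarrow> integral {0..T} (\<lambda>t. deriv \<eta> t *\<^sub>R \<sigma> t) = - integral {0..T} (\<lambda>t. \<eta> t *\<^sub>R \<sigma>' t)"
    using W unfolding W11_with_derivative_def by auto
  \<comment> \<open>The denominator \<open>n + 2\<close> makes \<open>h n\<close> strictly smaller
    than \<open>T - t\<close>, so the support \<open>{s..t + h n}\<close> stays inside
    \<open>{0<..<T}\<close>.\<close>
  define h :: "nat \<Rightarrow> real" where "h n = (T - t) / real (n + 2)" for n
  have h0: "h n > 0" for n using st by (simp add: h_def)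
  have hlim: "h \<longlonglongrightarrow> 0"
    using tendsto_mult_right_zero[OF LIMSEQ_Suc[OF LIMSEQ_inverse_real_of_nat], of "T - t"]
    by (simp add: h_def[abs_def] divide_inverse add.commute)
  define \<eta> where "\<eta> n x = smooth_step ((x - s) / h n) - smooth_step ((x - t) / h n)" for n x
  have deta: "(\<eta> n has_real_derivative tent ((x - s) / h n) / h n - tent ((x - t) / h n) / h n) (at x)" for n x
    unfolding \<eta>_def using h0 by (intro derivative_intros smooth_step_scaled_derivative)
  have ceta: "continuous_on S (\<eta> n)" for n S
    using deta by (meson DERIV_continuous continuous_at_imp_continuous_on)
  have L1: "(\<lambda>n. integral {0..T} (\<lambda>x. deriv (\<eta> n) x *\<^sub>R \<sigma> x)) \<longlonglongrightarrow> \<sigma> s - \<sigma> t"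
  proof -
    have "integral {0..T} (\<lambda>x. deriv (\<eta> n) x *\<^sub>R \<sigma> x)
      = integral {0..T} (\<lambda>x. (tent ((x - s) / h n) / h n) *\<^sub>R \<sigma> x)
        - integral {0..T} (\<lambda>x. (tent ((x - t) / h n) / h n) *\<^sub>R \<sigma> x)" for n
    proof (subst integral_diff[symmetric])
      show "(\<lambda>x. (tent ((x - u) / h n) / h n) *\<^sub>R \<sigma> x) integrable_on {0..T}"
          "(\<lambda>x. (tent ((x - u) / h n) / h n) *\<^sub>R \<sigma> x) integrable_on {0..T}" for u
        using h0[of n]
        by (auto intro!: integrable_continuous_interval continuous_intros cont
           continuous_on_compose2[OF continuous_tent[of UNIV]])
    qed (auto simp: DERIV_imp_deriv[OF deta] scaleR_diff_left)
    then show ?thesis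
      using st h0 hlim cont by (auto intro!: tendsto_diff tent_mollifier_limit)
  qed
  have L2: "(\<lambda>n. integral {0..T} (\<lambda>x. \<eta> n x *\<^sub>R \<sigma>' x))
      \<longlonglongrightarrow> integral {0..T} (\<lambda>x. if x \<in> {s<..t} then \<sigma>' x else 0)"
  proof (rule dominated_convergence(2))
    show "(\<lambda>x. \<eta> n x *\<^sub>R \<sigma>' x) integrable_on {0..T}" for n
    proof -
      have "(\<lambda>x. \<eta> n x *\<^sub>R \<sigma>' x) absolutely_integrable_on {0..T}"
      proof (rule absolutely_integrable_bounded_measurable_product[where h=scaleR, OF _ _ _ _ abs])
        show "bilinear (scaleR :: real \<Rightarrow> 'a \<Rightarrow> 'a)"
          using bilinear_conv_bounded_bilinear bounded_bilinear_scaleR by blast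
        show "\<eta> n \<in> borel_measurable (lebesgue_on {0..T})"
          by (rule continuous_imp_measurable_on_sets_lebesgue[OF ceta]) simp
        show "bounded (\<eta> n ` {0..T})"
          by (rule compact_imp_bounded[OF compact_continuous_image[OF ceta]]) simp
      qed simp
      then show ?thesis by (simp add: absolutely_integrable_on_def)
    qed
    show "(\<lambda>x. norm (\<sigma>' x)) integrable_on {0..T}"
      using abs by (simp add: absolutely_integrable_on_def)
    show "norm (\<eta> n x *\<^sub>R \<sigma>' x) \<le> norm (\<sigma>' x)" for n x
    proof -
      have "\<bar>\<eta> n x\<bar> \<le> 1"
        using smooth_step_bounds[of "(x - s) / h n"] smooth_step_bounds[of "(x - t) / h n"]
        by (auto simp: \<eta>_def)
      then show ?thesis by (simp add: mult_left_le_one_le)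
    qed
    fix x assume "x \<in> {0..T}"
    \<comment> \<open>The rise happens to the right of \<open>u\<close>, so the step is still 0 at
      \<open>x = u\<close>; hence the half-open interval in the limit.\<close>
    have ev: "\<forall>\<^sub>F n in sequentially. smooth_step ((x - u) / h n) = (if x \<le> u then 0 else 1)" for u
    proof (cases "x \<le> u")
      case True then show ?thesis using h0 by (auto simp: smooth_step_eq_0 divide_le_0_iff less_imp_le)
    next
      case False
      then have "\<forall>\<^sub>F n in sequentially. h n < x - u" using hlim by (intro order_tendstoD) auto
      then show ?thesis
        by eventually_elim (use False h0 in \<open>auto intro!: smooth_step_eq_1 simp: less_imp_le\<close>)
    qed
    have "\<forall>\<^sub>F n in sequentially. \<eta> n x *\<^sub>R \<sigma>' x = (if x \<in> {s<..t} then \<sigma>' x else 0)"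
      using ev[of s] ev[of t] by eventually_elim (use st in \<open>auto simp: \<eta>_def\<close>)
    then show "(\<lambda>n. \<eta> n x *\<^sub>R \<sigma>' x) \<longlonglongrightarrow> (if x \<in> {s<..t} then \<sigma>' x else 0)"
      by (rule tendsto_eventually)
  qed
  have "integral {0..T} (\<lambda>x. if x \<in> {s<..t} then \<sigma>' x else 0) = integral {s<..t} \<sigma>'"
    using st by (subst integral_restrict_Int) (auto intro: arg_cong2[where f=integral])
  also have "\<dots> = integral {s..t} \<sigma>'"
    by (rule integral_subset_negligible) (auto intro: negligible_subset[of "{s}"])
  finally have L2': "(\<lambda>n. integral {0..T} (\<lambda>x. \<eta> n x *\<^sub>R \<sigma>' x)) \<longlonglongrightarrow> integral {s..t} \<sigma>'"
    using L2 by simp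
  have "integral {0..T} (\<lambda>x. deriv (\<eta> n) x *\<^sub>R \<sigma> x) = - integral {0..T} (\<lambda>x. \<eta> n x *\<^sub>R \<sigma>' x)" for n
  proof (rule weak)
    have vd: "vector_derivative (\<eta> n) (at x) = tent ((x - s) / h n) / h n - tent ((x - t) / h n) / h n" for x
      using deta[of n x] by (simp add: has_real_derivative_iff_has_vector_derivative vector_derivative_at)
    show "\<eta> n C1_differentiable_on UNIV"
      unfolding C1_differentiable_on_eq
    proof
      show "\<forall>x\<in>UNIV. \<eta> n differentiable at x"
        using deta real_differentiable_def by blast
      show "continuous_on UNIV (\<lambda>x. vector_derivative (\<eta> n) (at x))"
        unfolding vd using h0[of n]
        by (auto intro!: continuous_intros continuous_on_compose2[OF continuous_tent[of UNIV]])
    qed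
    have "(T - t) * 1 < (T - t) * real (n + 2)" using st by (intro mult_strict_left_mono) auto
    then have "h n < T - t" unfolding h_def by (subst pos_divide_less_eq) auto
    then have hn: "t + h n < T" by simp
    have "\<eta> n x = 0" if "x \<notin> {s..t + h n}" for x
    proof (cases "x < s")
      case True then show ?thesis using st h0[of n] by (simp add: \<eta>_def smooth_step_eq_0 divide_le_0_iff)
    next
      case False
      then have "(x - s) / h n \<ge> 1" "(x - t) / h n \<ge> 1" using that st h0[of n] by auto
      then show ?thesis by (simp add: \<eta>_def smooth_step_eq_1)
    qed
    then show "\<exists>K. compact K \<and> K \<subseteq> {0<..<T} \<and> (\<forall>t. t \<notin> K \<longrightarrow> \<eta> n t = 0)"
      using st hn by (intro exI[of _ "{s..t + h n}"]) auto
  qed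
  then have "(\<lambda>n. integral {0..T} (\<lambda>x. deriv (\<eta> n) x *\<^sub>R \<sigma> x)) \<longlonglongrightarrow> - integral {s..t} \<sigma>'"
    using tendsto_minus[OF L2'] by simp
  from LIMSEQ_unique[OF L1 this] show ?thesis
    using minus_diff_eq[of "\<sigma> s" "\<sigma> t"] by simp
qed

text \<open>The interior identity makes \<open>g\<close> constant on the open interval; continuity
  of \<open>\<sigma>\<close> and of the indefinite integral carries this to the endpoints.\<close>

lemma W11_increment:
  fixes \<sigma> :: "real \<Rightarrow> 'a::euclidean_space"
  assumes W: "W11_with_derivative T X \<sigma> \<sigma>'" and T: "0 < T" and st: "0 \<le> s" "s \<le> t" "t \<le> T"
  shows "(\<sigma>' has_integral \<sigma> t - \<sigma> s) {s..t}"
proof -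
  have cont: "continuous_on {0..T} \<sigma>" and abs: "\<sigma>' absolutely_integrable_on {0..T}"
    using W unfolding W11_with_derivative_def by auto
  have int: "\<sigma>' integrable_on {0..T}" using abs by (simp add: absolutely_integrable_on_def)
  define g where "g u = integral {0..u} \<sigma>' - \<sigma> u" for u
  have cg: "continuous_on {0..T} g" unfolding g_def
    by (intro continuous_intros indefinite_integral_continuous_1 int cont)
  have add: "integral {0..a} \<sigma>' + integral {a..b} \<sigma>' = integral {0..b} \<sigma>'" if "0 \<le> a" "a \<le> b" "b \<le> T" for a b
    using that
    by (intro Henstock_Kurzweil_Integration.integral_combine integrable_subinterval_real[OF int]) auto
  have const: "g u = g (T/2)" if "u \<in> {0<..<T}" for u
  proof -
    have "g b = g a" if "0 < a" "a \<le> b" "b < T" for a b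
    proof -
      have "g b - g a = (integral {0..b} \<sigma>' - integral {0..a} \<sigma>') - (\<sigma> b - \<sigma> a)"
        by (simp add: g_def)
      also have "integral {0..b} \<sigma>' - integral {0..a} \<sigma>' = integral {a..b} \<sigma>'"
        using add[of a b] that by (simp add: diff_eq_eq add.commute)
      finally show ?thesis using W11_increment_interior[OF W that] by simp
    qed
    from this[of u "T/2"] this[of "T/2" u] show ?thesis using that T by (cases "u \<le> T/2") auto
  qed
  have "g u = g (T/2)" if "u \<in> {0..T}" for u
  proof (rule continuous_constant_on_closure[of "{0<..<T}" g])
    show "continuous_on (closure {0<..<T}) g" using cg T by simp
    show "u \<in> closure {0<..<T}" using that T by simp
  qed (rule const)
  from this[of s] this[of t] have eq: "g t - g s = 0" using st by (metis atLeastAtMost_iff diff_self order_trans)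
  have I: "integral {0..t} \<sigma>' - integral {0..s} \<sigma>' = integral {s..t} \<sigma>'"
    using add[OF st] by (metis add_diff_cancel_left')
  have "\<sigma> t - \<sigma> s = integral {0..t} \<sigma>' - integral {0..s} \<sigma>' - (g t - g s)"
    by (simp add: g_def)
  then have "integral {s..t} \<sigma>' = \<sigma> t - \<sigma> s"
    unfolding eq I by simp
  moreover have "\<sigma>' integrable_on {s..t}" 
    using st by (intro integrable_subinterval_real[OF int]) auto
  ultimately show ?thesis using has_integral_iff by blast
qed

section \<open>Arc length of the loading\<close>

lemma partition_on_interval_mono:
  assumes "partition_on_interval a b n p" "i \<le> j" "j \<le> n"
  shows "p i \<le> p j"
  using assms(2,3)
proof (induction j rule: dec_induct)
  case (step k)
  then have "p k < p (Suc k)" using assms(1) by (auto simp: partition_on_interval_def)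
  with step show ?case by simp
qed simp

lemma partition_on_interval_range:
  assumes "partition_on_interval a b n p" "i \<le> n"
  shows "a \<le> p i" "p i \<le> b"
  using partition_on_interval_mono[OF assms(1), of 0 i] partition_on_interval_mono[OF assms(1), of i n] assms
  by (auto simp: partition_on_interval_def)

text \<open>From here on the weak formulation is represented by what it yields: an absolutely
  integrable function whose integrals are the increments of \<open>\<sigma>\<close>.\<close>

locale loading =
  fixes T :: real and \<sigma> \<sigma>' :: "real \<Rightarrow> 'a::euclidean_space"
  assumes T_pos: "0 < T"
    and abs_int: "\<sigma>' absolutely_integrable_on {0..T}"
    and increment: "\<lbrakk>0 \<le> s; s \<le> t; t \<le> T\<rbrakk> \<Longrightarrow> (\<sigma>' has_integral \<sigma> t - \<sigma> s) {s..t}"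
begin

definition arc :: "real \<Rightarrow> real" where
  "arc t = integral {0..t} (\<lambda>r. norm (\<sigma>' r))"

lemma norm_int_T: "(\<lambda>r. norm (\<sigma>' r)) integrable_on {0..T}"
  using abs_int by (simp add: absolutely_integrable_on_def)

lemma norm_int: "\<lbrakk>0 \<le> s; t \<le> T\<rbrakk> \<Longrightarrow> (\<lambda>r. norm (\<sigma>' r)) integrable_on {s..t}"
  by (rule integrable_subinterval_real[OF norm_int_T]) auto

lemma arc_diff:
  assumes "0 \<le> s" "s \<le> t" "t \<le> T"
  shows "integral {s..t} (\<lambda>r. norm (\<sigma>' r)) = arc t - arc s"
  using Henstock_Kurzweil_Integration.integral_combine[OF assms(1,2) norm_int[of 0 t]] assms
  by (auto simp: arc_def)

lemma arc_mono: "\<lbrakk>0 \<le> s; s \<le> t; t \<le> T\<rbrakk> \<Longrightarrow> arc s \<le> arc t"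
  using arc_diff[of s t] integral_nonneg[OF norm_int[of s t]] by auto

lemma arc_0 [simp]: "arc 0 = 0"
  by (simp add: arc_def)

lemma arc_nonneg: "\<lbrakk>0 \<le> t; t \<le> T\<rbrakk> \<Longrightarrow> 0 \<le> arc t"
  using arc_mono[of 0 t] by simp

lemma continuous_arc: "continuous_on {0..T} arc"
  unfolding arc_def by (rule indefinite_integral_continuous_1[OF norm_int_T])

lemma loading_diff_le:
  assumes "0 \<le> s" "s \<le> t" "t \<le> T"
  shows "norm (\<sigma> t - \<sigma> s) \<le> arc t - arc s"
proof -
  have "norm (integral {s..t} \<sigma>') \<le> integral {s..t} (\<lambda>r. norm (\<sigma>' r))"
    using increment[OF assms] assms
    by (intro integral_norm_bound_integral norm_int) (auto simp: integrable_on_def)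
  then show ?thesis
    using increment[OF assms] arc_diff[OF assms] by (simp add: integral_unique)
qed

lemma loading_bounded: "\<lbrakk>0 \<le> t; t \<le> T\<rbrakk> \<Longrightarrow> norm (\<sigma> t) \<le> norm (\<sigma> 0) + arc T"
  using loading_diff_le[of 0 t] arc_mono[of t T] norm_triangle_ineq2[of "\<sigma> t" "\<sigma> 0"] by simp

lemma continuous_loading: "continuous_on {0..T} \<sigma>"
proof -
  have "\<sigma>' integrable_on {0..T}" using abs_int by (simp add: absolutely_integrable_on_def)
  from indefinite_integral_continuous_1[OF this]
  have "continuous_on {0..T} (\<lambda>t. \<sigma> 0 + integral {0..t} \<sigma>')"
    by (intro continuous_intros)
  then show ?thesis
    by (rule continuous_on_eq) (use integral_unique[OF increment[of 0]] in auto)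
qed

text \<open>Work against a constant \<open>v\<close> is exactly
  \<open>(\<sigma> t - \<sigma> s) \<bullet> v\<close>, so only the deviation of \<open>g\<close>
  from \<open>v\<close> is integrated against \<open>|\<sigma>'|\<close>. If \<open>g\<close> is
  Lipschitz in the arc length, \<open>B\<close> is itself of the order of the arc increment, which
  makes the error quadratic.\<close>

lemma frozen_integral_error:
  assumes st: "0 \<le> s" "s \<le> t" "t \<le> T"
    and int: "(\<lambda>r. \<sigma>' r \<bullet> g r) integrable_on {s..t}"
    and B: "\<And>r. r \<in> {s..t} \<Longrightarrow> norm (g r - v) \<le> B"
  shows "\<bar>integral {s..t} (\<lambda>r. \<sigma>' r \<bullet> g r) - (\<sigma> t - \<sigma> s) \<bullet> v\<bar> \<le> B * (arc t - arc s)"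
proof -
  have v: "((\<lambda>r. \<sigma>' r \<bullet> v) has_integral (\<sigma> t - \<sigma> s) \<bullet> v) {s..t}"
    using has_integral_linear[OF increment[OF st] bounded_linear_inner_left[of v]] by (simp add: o_def)
  have d: "(\<lambda>r. \<sigma>' r \<bullet> g r - \<sigma>' r \<bullet> v) integrable_on {s..t}"
    by (rule integrable_diff[OF int]) (use v in blast)
  have "norm (integral {s..t} (\<lambda>r. \<sigma>' r \<bullet> g r - \<sigma>' r \<bullet> v)) \<le> integral {s..t} (\<lambda>r. B * norm (\<sigma>' r))"
  proof (rule integral_norm_bound_integral[OF d])
    show "(\<lambda>r. B * norm (\<sigma>' r)) integrable_on {s..t}"
      by (intro integrable_on_mult_right norm_int st)
    fix r assume r: "r \<in> {s..t}"
    have "\<bar>\<sigma>' r \<bullet> (g r - v)\<bar> \<le> norm (\<sigma>' r) * norm (g r - v)" by (rule Cauchy_Schwarz_ineq2)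
    also have "\<dots> \<le> norm (\<sigma>' r) * B" by (intro mult_left_mono B r) auto
    finally show "norm (\<sigma>' r \<bullet> g r - \<sigma>' r \<bullet> v) \<le> B * norm (\<sigma>' r)"
      by (simp add: inner_diff_right mult.commute)
  qed
  moreover have "integral {s..t} (\<lambda>r. \<sigma>' r \<bullet> g r - \<sigma>' r \<bullet> v)
      = integral {s..t} (\<lambda>r. \<sigma>' r \<bullet> g r) - (\<sigma> t - \<sigma> s) \<bullet> v"
    using v by (subst integral_diff[OF int]) (auto simp: integral_unique integrable_on_def)
  ultimately show ?thesis using arc_diff[OF st] by simp
qed

section \<open>Fine partitions and sums of quadratic errors\<close>

lemma fine_partition:
  assumes t: "0 \<le> t" "t \<le> T" and d: "0 < d"
  obtains n p where "partition_on_interval 0 t n p" "\<And>i. i < n \<Longrightarrow> arc (p (Suc i)) - arc (p i) \<le> d"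
proof (cases "t = 0")
  case True
  show ?thesis by (rule that[of 0 "\<lambda>_. 0"]) (auto simp: partition_on_interval_def True)
next
  case False
  have "uniformly_continuous_on {0..T} arc"
    by (rule compact_uniformly_continuous[OF continuous_arc]) simp
  then obtain e where e: "e > 0" "\<And>x y. \<lbrakk>x \<in> {0..T}; y \<in> {0..T}; dist y x < e\<rbrakk> \<Longrightarrow> dist (arc y) (arc x) < d"
    using d unfolding uniformly_continuous_on_def by metis
  obtain n :: nat where n: "t / e < real n" using reals_Archimedean2 by blast
  have n0: "0 < real n" using n t e by (meson divide_nonneg_pos le_less_trans)
  define p where "p i = real i * t / real n" for i
  have step: "p (Suc i) - p i = t / real n" for i
    by (simp add: p_def add_divide_distrib distrib_right)
  have tn: "0 < t / real n" "t / real n < e"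
    using n n0 t False e by (auto simp: field_simps)
  have part: "partition_on_interval 0 t n p"
    unfolding partition_on_interval_def using n0 step tn by (auto simp: p_def) (metis diff_gt_0_iff_gt)
  show ?thesis
  proof (rule that[OF part])
    fix i assume "i < n"
    then have "p i \<in> {0..T}" "p (Suc i) \<in> {0..T}"
      using partition_on_interval_range[OF part, of i] partition_on_interval_range[OF part, of "Suc i"] t by auto
    moreover have "dist (p (Suc i)) (p i) < e" using step[of i] tn by (simp add: dist_real_def)
    ultimately show "arc (p (Suc i)) - arc (p i) \<le> d"
      using e(2)[of "p i" "p (Suc i)"] by (simp add: dist_real_def)
  qed
qed

text \<open>The quadratic error terms are negligible because \<open>arc\<close> is continuous: along fine partitions
  the sum of the squared increments tends to zero.\<close>

lemma gronwall_quadratic: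
  fixes \<gamma> :: "real \<Rightarrow> real"
  assumes C: "0 \<le> C" and init: "\<gamma> 0 \<le> 0" and nonneg: "\<And>t. t \<in> {0..T} \<Longrightarrow> 0 \<le> \<gamma> t"
    and step: "\<And>s t. \<lbrakk>0 \<le> s; s \<le> t; t \<le> T\<rbrakk> \<Longrightarrow>
      \<gamma> t \<le> \<gamma> s + C * \<gamma> s * (arc t - arc s) + C * (arc t - arc s)\<^sup>2"
    and t: "t \<in> {0..T}"
  shows "\<gamma> t = 0"
proof -
  have main: "\<gamma> t \<le> C * d * (arc t * exp (C * arc t))" if d: "d > 0" for d
  proof -
    obtain n p where p: "partition_on_interval 0 t n p"
      and fine: "\<And>i. i < n \<Longrightarrow> arc (p (Suc i)) - arc (p i) \<le> d"
      using fine_partition[of t d] t d by auto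
    have rng: "0 \<le> p i" "p i \<le> T" if "i \<le> n" for i
      using partition_on_interval_range[OF p that] t by auto
    \<comment> \<open>Each quadratic error is at most \<open>d\<close> times the arc increment, so
      these errors add up to \<open>C * d * arc\<close>, while the linear terms compound to the
      exponential.\<close>
    have "\<gamma> (p i) \<le> C * d * (arc (p i) * exp (C * arc (p i)))" if "i \<le> n" for i
      using that
    proof (induction i)
      case 0
      then show ?case using p init by (simp add: partition_on_interval_def)
    next
      case (Suc i)
      let ?a = "arc (p i)" and ?b = "arc (p (Suc i))"
      have le: "p i \<le> p (Suc i)" using p Suc.prems by (auto simp: partition_on_interval_def less_imp_le)
      have ab: "0 \<le> ?a" "?a \<le> ?b" "?b - ?a \<le> d"
        using arc_nonneg[of "p i"] arc_mono[OF _ le] rng[of i] rng[of "Suc i"] Suc.prems fine[of i] by auto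
      have e1: "1 + C * (?b - ?a) \<le> exp (C * (?b - ?a))" by (rule exp_ge_add_one_self)
      have e2: "exp (C * ?a) * exp (C * (?b - ?a)) = exp (C * ?b)"
        by (simp add: exp_add[symmetric] algebra_simps)
      have "\<gamma> (p (Suc i)) \<le> \<gamma> (p i) * (1 + C * (?b - ?a)) + C * (?b - ?a)\<^sup>2"
        using step[OF _ le] rng[of i] rng[of "Suc i"] Suc.prems by (simp add: algebra_simps)
      also have "\<dots> \<le> (C * d * (?a * exp (C * ?a))) * exp (C * (?b - ?a)) + C * d * (?b - ?a)"
      proof (rule add_mono)
        have "\<gamma> (p i) * (1 + C * (?b - ?a)) \<le> (C * d * (?a * exp (C * ?a))) * (1 + C * (?b - ?a))"
          using Suc ab C by (intro mult_right_mono) auto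
        also have "\<dots> \<le> (C * d * (?a * exp (C * ?a))) * exp (C * (?b - ?a))"
          using ab C d by (intro mult_left_mono e1) auto
        finally show "\<gamma> (p i) * (1 + C * (?b - ?a)) \<le> (C * d * (?a * exp (C * ?a))) * exp (C * (?b - ?a))" .
        have "(?b - ?a) * (?b - ?a) \<le> d * (?b - ?a)" using ab by (intro mult_right_mono) auto
        then show "C * (?b - ?a)\<^sup>2 \<le> C * d * (?b - ?a)"
          using C by (simp add: power2_eq_square mult_left_mono mult.assoc)
      qed
      also have "(C * d * (?a * exp (C * ?a))) * exp (C * (?b - ?a)) = C * d * (?a * exp (C * ?b))"
        using e2 by (simp add: mult.assoc)
      also have "C * d * (?b - ?a) \<le> C * d * ((?b - ?a) * exp (C * ?b))"
      proof -
        have "0 \<le> C * ?b" using C ab by simp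
        then have "1 \<le> exp (C * ?b)" by simp
        then have "(?b - ?a) * 1 \<le> (?b - ?a) * exp (C * ?b)" using ab by (intro mult_left_mono) auto
        then show ?thesis using C d by (intro mult_left_mono) auto
      qed
      also have "C * d * (?a * exp (C * ?b)) + C * d * ((?b - ?a) * exp (C * ?b)) = C * d * (?b * exp (C * ?b))"
        by (simp add: algebra_simps)
      finally show ?case by simp
    qed
    from this[of n] show ?thesis using p by (simp add: partition_on_interval_def)
  qed
  have "\<gamma> t \<le> 0"
  proof (rule field_le_epsilon)
    fix e :: real assume e: "e > 0"
    \<comment> \<open>The mesh \<open>e / (?K + 1)\<close> is well defined also when
      \<open>?K = 0\<close>.\<close>
    let ?K = "C * (arc t * exp (C * arc t))"
    have K: "0 \<le> ?K" using C arc_nonneg[of t] t by simp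
    have "\<gamma> t \<le> C * (e / (?K + 1)) * (arc t * exp (C * arc t))"
      using e K by (intro main divide_pos_pos) auto
    also have "\<dots> = e * (?K / (?K + 1))" by simp
    also have "\<dots> \<le> e * 1" using e K by (intro mult_left_mono) (auto simp: divide_le_eq_1)
    finally show "\<gamma> t \<le> 0 + e" by simp
  qed
  then show ?thesis using nonneg[OF t] by simp
qed

lemma constant_if_quadratic_increments:
  fixes h :: "real \<Rightarrow> real"
  assumes "0 \<le> C"
    and "\<And>s t. \<lbrakk>0 \<le> s; s \<le> t; t \<le> T\<rbrakk> \<Longrightarrow> \<bar>h t - h s\<bar> \<le> C * (arc t - arc s)\<^sup>2"
    and "t \<in> {0..T}"
  shows "h t = h 0"
proof -
  have "\<bar>h t - h 0\<bar> = 0"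
  proof (rule gronwall_quadratic[where C=C and \<gamma>="\<lambda>t. \<bar>h t - h 0\<bar>"])
    fix s t assume st: "0 \<le> s" "s \<le> t" "t \<le> T"
    have "\<bar>h t - h 0\<bar> \<le> \<bar>h s - h 0\<bar> + \<bar>h t - h s\<bar>" by linarith
    moreover have "0 \<le> C * \<bar>h s - h 0\<bar> * (arc t - arc s)" using assms(1) arc_mono[OF st] by simp
    ultimately show "\<bar>h t - h 0\<bar> \<le> \<bar>h s - h 0\<bar> + C * \<bar>h s - h 0\<bar> * (arc t - arc s) + C * (arc t - arc s)\<^sup>2"
      using assms(2)[OF st] by linarith
  qed (use assms in auto)
  then show ?thesis by simp
qed

lemma integral_product_bounded:
  assumes g: "continuous_on {0..T} g"
  shows "(\<lambda>r. \<sigma>' r \<bullet> g r) absolutely_integrable_on {0..T}"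
proof -
  have "(\<lambda>r. g r \<bullet> \<sigma>' r) absolutely_integrable_on {0..T}"
  proof (rule absolutely_integrable_bounded_measurable_product[where h="(\<bullet>)", OF _ _ _ _ abs_int])
    show "bilinear ((\<bullet>) :: 'a \<Rightarrow> 'a \<Rightarrow> real)"
      using bilinear_conv_bounded_bilinear bounded_bilinear_inner by blast
    show "g \<in> borel_measurable (lebesgue_on {0..T})"
      by (rule continuous_imp_measurable_on_sets_lebesgue[OF g]) simp
    show "bounded (g ` {0..T})"
      by (rule compact_imp_bounded[OF compact_continuous_image[OF g]]) simp
  qed simp
  then show ?thesis by (simp add: inner_commute)
qed

lemma integral_split:
  fixes g :: "real \<Rightarrow> real"
  assumes "g integrable_on {0..T}" "0 \<le> a" "a \<le> b" "b \<le> T"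
  shows "integral {0..b} g = integral {0..a} g + integral {a..b} g"
  by (rule Henstock_Kurzweil_Integration.integral_combine[symmetric])
     (use assms in \<open>auto intro!: integrable_subinterval_real[OF assms(1)]\<close>)

text \<open>A chain rule for \<open>\<sigma> \<bullet> A \<sigma> / 2\<close> without
  differentiation: freezing \<open>A \<sigma>\<close> at the mean of its endpoint values gives the
  exact increment by symmetry, and the remainder is quadratic in the arc length. Symmetry is asked
  only between values of the loading, since for the compliance it will be available on
  \<open>Sym3\<close>.\<close>

lemma integral_quadratic:
  fixes A :: "'a \<Rightarrow> 'a"
  assumes A: "bounded_linear A" and sym: "\<And>s t. \<lbrakk>s \<in> {0..T}; t \<in> {0..T}\<rbrakk> \<Longrightarrow> A (\<sigma> s) \<bullet> \<sigma> t = \<sigma> s \<bullet> A (\<sigma> t)"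
    and t: "t \<in> {0..T}"
  shows "integral {0..t} (\<lambda>r. \<sigma>' r \<bullet> A (\<sigma> r)) = (\<sigma> t \<bullet> A (\<sigma> t) - \<sigma> 0 \<bullet> A (\<sigma> 0)) / 2"
proof -
  interpret A: bounded_linear A by (rule A)
  obtain K where K: "K \<ge> 0" "\<And>x. norm (A x) \<le> norm x * K" using A.nonneg_bounded by blast
  have "continuous_on {0..T} (\<lambda>r. A (\<sigma> r))"
    by (rule A.continuous_on[OF continuous_loading])
  from integral_product_bounded[OF this]
  have int: "(\<lambda>r. \<sigma>' r \<bullet> A (\<sigma> r)) integrable_on {0..T}" by (simp add: absolutely_integrable_on_def)
  define h where "h u = integral {0..u} (\<lambda>r. \<sigma>' r \<bullet> A (\<sigma> r)) - \<sigma> u \<bullet> A (\<sigma> u) / 2" for u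
  have "h t = h 0"
  proof (rule constant_if_quadratic_increments[OF K(1) _ t])
    fix s t assume st: "0 \<le> s" "s \<le> t" "t \<le> T"
    let ?v = "(1/2) *\<^sub>R (A (\<sigma> s) + A (\<sigma> t))"
    have "A (\<sigma> s) \<bullet> \<sigma> t = \<sigma> s \<bullet> A (\<sigma> t)" using sym st by auto
    then have "(\<sigma> t - \<sigma> s) \<bullet> ?v = (\<sigma> t \<bullet> A (\<sigma> t) - \<sigma> s \<bullet> A (\<sigma> s)) / 2"
      by (simp add: inner_simps inner_commute[of "A (\<sigma> s)"] inner_commute[of "A (\<sigma> t)"] field_simps)
    then have eq: "h t - h s = integral {s..t} (\<lambda>r. \<sigma>' r \<bullet> A (\<sigma> r)) - (\<sigma> t - \<sigma> s) \<bullet> ?v"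
      using integral_split[OF int st] by (simp add: h_def field_simps)
    have B: "norm (A (\<sigma> r) - ?v) \<le> K * (arc t - arc s)" if "r \<in> {s..t}" for r
    proof -
      have "A (\<sigma> r) - ?v = (1/2) *\<^sub>R A ((\<sigma> r - \<sigma> s) - (\<sigma> t - \<sigma> r))"
      proof -
        have "A (\<sigma> r) = (1/2) *\<^sub>R (A (\<sigma> r) + A (\<sigma> r))" by (simp flip: scaleR_2)
        then have "A (\<sigma> r) - ?v = (1/2) *\<^sub>R (A (\<sigma> r) + A (\<sigma> r)) - ?v" by simp
        also have "\<dots> = (1/2) *\<^sub>R A ((\<sigma> r - \<sigma> s) - (\<sigma> t - \<sigma> r))"
          unfolding A.diff scaleR_diff_right[symmetric] by (simp add: algebra_simps)
        finally show ?thesis .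
      qed
      then have "norm (A (\<sigma> r) - ?v) \<le> 1/2 * (norm ((\<sigma> r - \<sigma> s) - (\<sigma> t - \<sigma> r)) * K)"
        using K(2)[of "(\<sigma> r - \<sigma> s) - (\<sigma> t - \<sigma> r)"] by simp
      also have "\<dots> \<le> 1/2 * ((arc t - arc s) * K)"
      proof (intro mult_left_mono mult_right_mono)
        have "norm ((\<sigma> r - \<sigma> s) - (\<sigma> t - \<sigma> r)) \<le> norm (\<sigma> r - \<sigma> s) + norm (\<sigma> t - \<sigma> r)"
          by (rule norm_triangle_ineq4)
        also have "\<dots> \<le> (arc r - arc s) + (arc t - arc r)"
          using that st by (intro add_mono loading_diff_le) auto
        finally show "norm ((\<sigma> r - \<sigma> s) - (\<sigma> t - \<sigma> r)) \<le> arc t - arc s" by simp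
      qed (use K in auto)
      also have "\<dots> \<le> K * (arc t - arc s)"
        using mult_nonneg_nonneg[OF K(1), of "arc t - arc s"] arc_mono[OF st] by (simp add: mult.commute)
      finally show ?thesis .
    qed
    have "\<bar>integral {s..t} (\<lambda>r. \<sigma>' r \<bullet> A (\<sigma> r)) - (\<sigma> t - \<sigma> s) \<bullet> ?v\<bar> \<le> K * (arc t - arc s) * (arc t - arc s)"
      by (rule frozen_integral_error[OF st _ B])
         (use st in \<open>auto intro!: integrable_subinterval_real[OF int]\<close>)
    then show "\<bar>h t - h s\<bar> \<le> K * (arc t - arc s)\<^sup>2" unfolding eq by (simp add: power2_eq_square)
  qed
  then show ?thesis by (simp add: h_def field_simps)
qed

end

section \<open>Rate-independent evolutions\<close>

text \<open>\<open>V\<close> will be the space of deviatoric matrices, and \<open>c\<close> the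
  hardening constant \<open>c2\<close>, which is a convexity modulus common to all energies.\<close>

locale rate_independent = loading T \<sigma> \<sigma>'
  for T :: real and \<sigma> \<sigma>' :: "real \<Rightarrow> 'a::euclidean_space" +
  fixes V :: "'a set" and D :: "'a \<Rightarrow> real" and L c :: real
  assumes V: "subspace V"
    and D_nonneg: "a \<in> V \<Longrightarrow> 0 \<le> D a"
    and D_scale: "\<lbrakk>0 \<le> r; a \<in> V\<rbrakk> \<Longrightarrow> D (r *\<^sub>R a) = r * D a"
    and D_triangle: "\<lbrakk>a \<in> V; b \<in> V\<rbrakk> \<Longrightarrow> D (a + b) \<le> D a + D b"
    and D_le: "a \<in> V \<Longrightarrow> D a \<le> L * norm a"
    and L_nonneg: "0 \<le> L"
    and c_pos: "0 < c"
begin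

text \<open>\<open>K\<close> is the effective domain, so an energy with infinite values is
  represented by a real function on \<open>K\<close>. The last clause is uniform convexity with the
  fixed modulus \<open>c\<close>.\<close>

definition admissible_energy :: "'a set \<Rightarrow> ('a \<Rightarrow> real) \<Rightarrow> bool" where
  "admissible_energy K f \<longleftrightarrow> K \<subseteq> V \<and> 0 \<in> K \<and> f 0 = 0 \<and> (\<forall>x\<in>K. 0 \<le> f x) \<and>
     convex_on K (\<lambda>x. f x - c * (norm x)\<^sup>2)"

definition stable :: "'a set \<Rightarrow> ('a \<Rightarrow> real) \<Rightarrow> 'a \<Rightarrow> 'a \<Rightarrow> bool" where
  "stable K f s z \<longleftrightarrow> z \<in> K \<and> (\<forall>z'\<in>K. f z - s \<bullet> z \<le> f z' - s \<bullet> z' + D (z' - z))"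

text \<open>The two-point form of the energy balance. For \<open>\<theta> = id\<close> these are the energetic solutions; for
  the incremental solutions \<open>\<theta> t\<close> is the last node not exceeding \<open>t\<close>.\<close>

definition evolution :: "'a set \<Rightarrow> ('a \<Rightarrow> real) \<Rightarrow> (real \<Rightarrow> real) \<Rightarrow> (real \<Rightarrow> 'a) \<Rightarrow> bool" where
  "evolution K f \<theta> z \<longleftrightarrow>
     (\<forall>t\<in>{0..T}. 0 \<le> \<theta> t \<and> \<theta> t \<le> t \<and> \<theta> (\<theta> t) = \<theta> t) \<and> mono_on {0..T} \<theta> \<and>
     (\<forall>t\<in>{0..T}. stable K f (\<sigma> (\<theta> t)) (z t)) \<and>
     (\<lambda>r. \<sigma>' r \<bullet> z r) integrable_on {0..T} \<and>
     (\<forall>s t. 0 \<le> s \<longrightarrow> s \<le> t \<longrightarrow> t \<le> T \<longrightarrow>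
        f (z t) - \<sigma> (\<theta> t) \<bullet> z t + D (z t - z s) + integral {\<theta> s..\<theta> t} (\<lambda>r. \<sigma>' r \<bullet> z r)
          \<le> f (z s) - \<sigma> (\<theta> s) \<bullet> z s)"

text \<open>Stability tested with the zero state gives \<open>c * |z| <= |\<sigma>| + L\<close>, and
  the loading never exceeds \<open>|\<sigma> 0| + arc T\<close>.\<close>

definition state_bound :: real where
  "state_bound = (norm (\<sigma> 0) + arc T + L) / c"

text \<open>Recovery sequences are constant. The lower bound is required along all subsequences,
  under an energy bound: this is what forces the limit into \<open>K\<close> when the domains
  \<open>Ks k\<close> are larger. The clause with \<open>e\<close> spells out the liminf
  inequality.\<close>

definition gamma_converges :: "(nat \<Rightarrow> 'a set) \<Rightarrow> (nat \<Rightarrow> 'a \<Rightarrow> real) \<Rightarrow> 'a set \<Rightarrow> ('a \<Rightarrow> real) \<Rightarrow> bool" where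
  "gamma_converges Ks fs K f \<longleftrightarrow>
     (\<forall>x\<in>K. (\<forall>k. x \<in> Ks k) \<and> (\<lambda>k. fs k x) \<longlonglongrightarrow> f x) \<and>
     (\<forall>r xs x B. strict_mono (r :: nat \<Rightarrow> nat) \<longrightarrow> (\<forall>k. xs k \<in> Ks (r k) \<and> fs (r k) (xs k) \<le> B) \<longrightarrow> xs \<longlonglongrightarrow> x \<longrightarrow>
        x \<in> K \<and> (\<forall>e>0. \<forall>\<^sub>F k in sequentially. f x - e \<le> fs (r k) (xs k)))"

section \<open>Uniform convexity and a priori bounds\<close>

lemma D_0 [simp]: "D 0 = 0"
  using D_scale[of 0 0] subspace_0[OF V] by simp

lemma D_perturb:
  assumes "a \<in> V" "b \<in> V"
  shows "D a \<le> D b + L * norm (a - b)"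
  using D_triangle[of b "a - b"] D_le[of "a - b"] subspace_diff[OF V] assms by fastforce

text \<open>Minimality is tested at \<open>(1 - h) z + h z'\<close>: uniform convexity gains
  \<open>h * (1 - h) * c * |z' - z|^2\<close>, and \<open>D\<close> is convex by homogeneity and
  subadditivity. Division by \<open>h\<close> and \<open>h \<rightarrow> 0\<close> leave the full
  square. The base point \<open>z0\<close> is free so that the lemma covers the incremental steps
  and, with \<open>z0 = z\<close>, stability.\<close>

lemma quadratic_growth:
  assumes f: "admissible_energy K f" and z: "z \<in> K" "z' \<in> K" and z0: "z0 \<in> V"
    and min: "\<And>y. y \<in> K \<Longrightarrow> f z - s \<bullet> z + D (z - z0) \<le> f y - s \<bullet> y + D (y - z0)"
  shows "f z - s \<bullet> z + D (z - z0) + c * (norm (z' - z))\<^sup>2 \<le> f z' - s \<bullet> z' + D (z' - z0)"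
proof -
  let ?X = "f z' - s \<bullet> z' + D (z' - z0) - (f z - s \<bullet> z + D (z - z0))"
  let ?N = "c * (norm (z' - z))\<^sup>2"
  have conv: "convex_on K (\<lambda>x. f x - c * (norm x)\<^sup>2)" and KV: "K \<subseteq> V"
    using f by (auto simp: admissible_energy_def)
  have "(1 - h) * ?N \<le> ?X" if h: "0 < h" "h < 1" for h :: real
  proof -
    define y where "y = (1 - h) *\<^sub>R z + h *\<^sub>R z'"
    have y: "y \<in> K"
      using convex_on_imp_convex[OF conv] z h by (auto simp: y_def convex_alt)
    have nn: "(norm y)\<^sup>2 = (1 - h) * (norm z)\<^sup>2 + h * (norm z')\<^sup>2 - h * (1 - h) * (norm (z' - z))\<^sup>2"
      by (simp add: y_def power2_norm_eq_inner inner_simps inner_commute algebra_simps)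
    have "f y - c * (norm y)\<^sup>2 \<le> (1 - h) * (f z - c * (norm z)\<^sup>2) + h * (f z' - c * (norm z')\<^sup>2)"
      using convex_onD[OF conv, of h z z'] z h by (simp add: y_def)
    then have fy: "f y \<le> (1 - h) * f z + h * f z' - h * (1 - h) * ?N"
      unfolding nn by (simp add: algebra_simps)
    have yz: "y - z0 = (1 - h) *\<^sub>R (z - z0) + h *\<^sub>R (z' - z0)"
      by (simp add: y_def algebra_simps)
    have mem: "z - z0 \<in> V" "z' - z0 \<in> V" using z z0 KV subspace_diff[OF V] by blast+
    have Dy: "D (y - z0) \<le> (1 - h) * D (z - z0) + h * D (z' - z0)"
      unfolding yz using D_triangle[of "(1 - h) *\<^sub>R (z - z0)" "h *\<^sub>R (z' - z0)"] mem h
      by (simp add: subspace_scale[OF V] D_scale)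
    have sy: "s \<bullet> y = (1 - h) * (s \<bullet> z) + h * (s \<bullet> z')" by (simp add: y_def inner_simps)
    have "h * ((1 - h) * ?N) \<le> h * ?X"
      using min[OF y] fy Dy unfolding sy by (simp add: algebra_simps)
    then show ?thesis using h by simp
  qed
  then have "\<forall>\<^sub>F h in at_right 0. (1 - h) * ?N \<le> ?X"
    unfolding eventually_at_right_field by (intro exI[of _ 1]) auto
  moreover have "((\<lambda>h. (1 - h) * ?N) \<longlongrightarrow> (1 - 0) * ?N) (at_right 0)"
    by (intro tendsto_intros)
  ultimately have "?N \<le> ?X"
    using tendsto_upperbound[of "\<lambda>h. (1 - h) * ?N" "(1 - 0) * ?N" "at_right 0" ?X] by simp
  then show ?thesis by simp
qed

lemma stable_quadratic_growth:
  assumes f: "admissible_energy K f" and z: "stable K f s z" "z' \<in> K"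
  shows "f z - s \<bullet> z + c * (norm (z' - z))\<^sup>2 \<le> f z' - s \<bullet> z' + D (z' - z)"
proof -
  have "z \<in> V" using f z by (auto simp: admissible_energy_def stable_def)
  then show ?thesis
    using quadratic_growth[OF f, of z z' z s] z by (auto simp: stable_def)
qed

lemma stable_bounds:
  assumes f: "admissible_energy K f" and z: "stable K f s z"
  shows "norm z \<le> (norm s + L) / c" "f z \<le> (norm s + L) * norm z"
proof -
  have zK: "z \<in> K" "0 \<in> K" "z \<in> V" "f 0 = 0" "0 \<le> f z"
    using f z by (auto simp: admissible_energy_def stable_def)
  have "s \<bullet> z \<le> norm s * norm z" by (rule norm_cauchy_schwarz)
  moreover have "D (- z) \<le> L * norm z" using D_le[of "- z"] zK subspace_neg[OF V] by simp
  ultimately have main: "f z + c * (norm z)\<^sup>2 \<le> (norm s + L) * norm z"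
    using stable_quadratic_growth[OF f z zK(2)] zK by (simp add: algebra_simps)
  then have *: "c * norm z * norm z \<le> (norm s + L) * norm z"
    using zK by (simp add: power2_eq_square mult.assoc)
  have "c * norm z \<le> norm s + L"
  proof (cases "norm z = 0")
    case True then show ?thesis using L_nonneg by simp
  next
    case False
    then show ?thesis using * by (simp add: mult_le_cancel_right)
  qed
  then show "norm z \<le> (norm s + L) / c" using c_pos by (simp add: field_simps)
  have "0 \<le> c * (norm z)\<^sup>2" using c_pos by simp
  then show "f z \<le> (norm s + L) * norm z" using main by linarith
qed

lemma state_bound_nonneg: "0 \<le> state_bound"
  using L_nonneg c_pos arc_nonneg[of T] T_pos by (simp add: state_bound_def)

lemma
  assumes f: "admissible_energy K f" and s: "s \<in> {0..T}" and z: "stable K f (\<sigma> s) z"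
  shows stable_state_bound: "norm z \<le> state_bound"
    and stable_energy_bound: "f z \<le> c * state_bound * state_bound"
proof -
  have s': "norm (\<sigma> s) \<le> norm (\<sigma> 0) + arc T" using s loading_bounded[of s] by simp
  have "norm z \<le> (norm (\<sigma> s) + L) / c" by (rule stable_bounds(1)[OF f z])
  also have "\<dots> \<le> state_bound" unfolding state_bound_def using s' c_pos by (intro divide_right_mono) auto
  finally show n: "norm z \<le> state_bound" .
  have "f z \<le> (norm (\<sigma> s) + L) * norm z" by (rule stable_bounds(2)[OF f z])
  also have "\<dots> \<le> (c * state_bound) * state_bound"
    using n s' c_pos L_nonneg arc_nonneg[of T] T_pos by (intro mult_mono) (auto simp: state_bound_def)
  finally show "f z \<le> c * state_bound * state_bound" .
qed

section \<open>Modulus of continuity in time\<close>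

lemma evolutionD:
  assumes "evolution K f \<theta> z"
  shows "t \<in> {0..T} \<Longrightarrow> 0 \<le> \<theta> t" "t \<in> {0..T} \<Longrightarrow> \<theta> t \<le> t" "t \<in> {0..T} \<Longrightarrow> \<theta> (\<theta> t) = \<theta> t"
    "\<lbrakk>0 \<le> s; s \<le> t; t \<le> T\<rbrakk> \<Longrightarrow> \<theta> s \<le> \<theta> t"
    "t \<in> {0..T} \<Longrightarrow> stable K f (\<sigma> (\<theta> t)) (z t)"
    "(\<lambda>r. \<sigma>' r \<bullet> z r) integrable_on {0..T}"
    "\<lbrakk>0 \<le> s; s \<le> t; t \<le> T\<rbrakk> \<Longrightarrow> f (z t) - \<sigma> (\<theta> t) \<bullet> z t + D (z t - z s) + integral {\<theta> s..\<theta> t} (\<lambda>r. \<sigma>' r \<bullet> z r)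
          \<le> f (z s) - \<sigma> (\<theta> s) \<bullet> z s"
  using assms by (auto simp: evolution_def mono_on_def)

lemma evolution_bounded:
  assumes f: "admissible_energy K f" and z: "evolution K f \<theta> z" and t: "t \<in> {0..T}"
  shows "norm (z t) \<le> state_bound" "f (z t) \<le> c * state_bound * state_bound" "z t \<in> K" "z t \<in> V"
  using stable_state_bound[OF f _ evolutionD(5)[OF z t]] stable_energy_bound[OF f _ evolutionD(5)[OF z t]]
    evolutionD(1,2,5)[OF z t] t f
  by (auto simp: stable_def admissible_energy_def)

text \<open>Stability at \<open>r\<close> with quadratic growth, added to the energy inequality from
  \<open>r\<close> to \<open>t\<close>, cancels energies and dissipation. What remains is the error
  of freezing the work at \<open>z t\<close>, so \<open>c * |z t - z r|^2 <= B * \<mu>\<close> with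
  \<open>B\<close> the largest distance of earlier states from \<open>z t\<close>. The supremum over
  \<open>r\<close> gives \<open>c * B^2 <= B * \<mu>\<close>, and one factor \<open>B\<close>
  cancels.\<close>

lemma evolution_continuity:
  assumes f: "admissible_energy K f" and z: "evolution K f \<theta> z" and st: "0 \<le> s" "s \<le> t" "t \<le> T"
  shows "norm (z t - z s) \<le> (arc (\<theta> t) - arc (\<theta> s)) / c"
proof -
  note th = evolutionD(1-4)[OF z] and int = evolutionD(6)[OF z]
  define \<mu> where "\<mu> = arc (\<theta> t) - arc (\<theta> s)"
  have ths: "0 \<le> \<theta> s" "\<theta> s \<le> s" "\<theta> s \<le> \<theta> t" "\<theta> t \<le> t" using th[of s] th(4)[OF st] th(2)[of t] st by auto
  have mu0: "0 \<le> \<mu>" using arc_mono[of "\<theta> s" "\<theta> t"] ths st by (simp add: \<mu>_def)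
  \<comment> \<open>The range starts at \<open>\<theta> s\<close> and not at \<open>s\<close>,
    because the work in the energy inequality is integrated from the node \<open>\<theta> s\<close>.
    Idempotence and monotonicity of \<open>\<theta>\<close> give
    \<open>\<theta> s <= \<theta> r\<close> for every \<open>r\<close> in it.\<close>
  define B where "B = (SUP u\<in>{\<theta> s..t}. norm (z t - z u))"
  have bdd: "bdd_above ((\<lambda>u. norm (z t - z u)) ` {\<theta> s..t})"
  proof (rule bdd_aboveI2)
    fix u assume "u \<in> {\<theta> s..t}"
    then show "norm (z t - z u) \<le> state_bound + state_bound"
      using evolution_bounded(1)[OF f z, of t] evolution_bounded(1)[OF f z, of u] st ths
      by (intro norm_triangle_le_diff add_mono) auto
  qed
  have le_B: "norm (z t - z u) \<le> B" if "u \<in> {\<theta> s..t}" for u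
    unfolding B_def by (rule cSUP_upper[OF that bdd])
  have B0: "0 \<le> B" using order_trans[OF norm_ge_zero le_B[of t]] ths st by auto
  have sq: "c * (norm (z t - z r))\<^sup>2 \<le> B * \<mu>" if r: "r \<in> {\<theta> s..t}" for r
  proof -
    have rT: "0 \<le> r" "r \<le> t" using r ths by auto
    have thr: "\<theta> s \<le> \<theta> r" "\<theta> r \<le> \<theta> t" "0 \<le> \<theta> r" "\<theta> r \<le> r" "\<theta> t \<le> T"
      using th(3)[of s] th(4)[of "\<theta> s" r] th(4)[of r t] th(1,2)[of r] r st rT ths by auto
    have "\<bar>integral {\<theta> r..\<theta> t} (\<lambda>r. \<sigma>' r \<bullet> z r) - (\<sigma> (\<theta> t) - \<sigma> (\<theta> r)) \<bullet> z t\<bar> \<le> B * (arc (\<theta> t) - arc (\<theta> r))"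
    proof (rule frozen_integral_error)
      show "(\<lambda>r. \<sigma>' r \<bullet> z r) integrable_on {\<theta> r..\<theta> t}"
        by (rule integrable_subinterval_real[OF int]) (use thr in auto)
      fix u assume "u \<in> {\<theta> r..\<theta> t}"
      then show "norm (z u - z t) \<le> B" using le_B[of u] thr ths by (simp add: norm_minus_commute)
    qed (use thr in auto)
    moreover have "B * (arc (\<theta> t) - arc (\<theta> r)) \<le> B * \<mu>"
      using arc_mono[of "\<theta> s" "\<theta> r"] thr ths rT st B0 by (intro mult_left_mono) (auto simp: \<mu>_def)
    moreover have "f (z r) - \<sigma> (\<theta> r) \<bullet> z r + c * (norm (z t - z r))\<^sup>2 \<le> f (z t) - \<sigma> (\<theta> r) \<bullet> z t + D (z t - z r)"
      using rT st by (intro stable_quadratic_growth[OF f] evolutionD(5)[OF z] evolution_bounded(3)[OF f z]) auto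
    moreover have "f (z t) - \<sigma> (\<theta> t) \<bullet> z t + D (z t - z r) + integral {\<theta> r..\<theta> t} (\<lambda>r. \<sigma>' r \<bullet> z r)
        \<le> f (z r) - \<sigma> (\<theta> r) \<bullet> z r"
      using rT st by (intro evolutionD(7)[OF z]) auto
    ultimately show ?thesis by (simp add: inner_diff_left)
  qed
  have "norm (z t - z r) \<le> sqrt (B * \<mu> / c)" if "r \<in> {\<theta> s..t}" for r
    using sq[OF that] c_pos by (intro real_le_rsqrt) (simp add: field_simps)
  then have "B \<le> sqrt (B * \<mu> / c)" unfolding B_def using ths st by (intro cSUP_least) auto
  then have "B\<^sup>2 \<le> B * \<mu> / c"
    using B0 mu0 c_pos by (metis divide_nonneg_pos mult_nonneg_nonneg power_mono real_sqrt_pow2)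
  then have "B * B \<le> B * (\<mu> / c)" by (simp add: power2_eq_square)
  then have "B \<le> \<mu> / c"
  proof (cases "B = 0")
    case True
    then show ?thesis using mu0 c_pos by simp
  next
    case False
    then have "0 < B" using B0 by simp
    then show ?thesis using mult_left_le_imp_le[OF \<open>B * B \<le> B * (\<mu> / c)\<close>] by simp
  qed
  then show ?thesis using le_B[of s] ths st by (auto simp: \<mu>_def)
qed

end

section \<open>Compactness\<close>

context rate_independent begin

text \<open>A diagonal argument treats the rational times. At any other time the sequence is Cauchy,
  since increments are controlled by the arc length at the times \<open>\<theta>s k\<close>, which
  converges to the continuous \<open>arc\<close>; equicontinuity is thus only asymptotic in
  \<open>k\<close>.\<close>

lemma evolution_compactness:
  assumes f: "\<And>k. admissible_energy (Ks k) (fs k)"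
    and z: "\<And>k. evolution (Ks k) (fs k) (\<theta>s k) (zs k)"
    and th: "\<And>t. t \<in> {0..T} \<Longrightarrow> (\<lambda>k. \<theta>s k t) \<longlonglongrightarrow> t"
  obtains r z where "strict_mono (r :: nat \<Rightarrow> nat)" "\<And>t. t \<in> {0..T} \<Longrightarrow> (\<lambda>k. zs (r k) t) \<longlonglongrightarrow> z t"
proof -
  have cnt: "countable ({0..T} \<inter> \<rat>)" using countable_rat by (rule countable_Int2)
  obtain r where r: "strict_mono (r :: nat \<Rightarrow> nat)"
    and conv: "\<And>q. q \<in> {0..T} \<inter> \<rat> \<Longrightarrow> \<exists>l. (\<lambda>k. zs (r k) q) \<longlonglongrightarrow> l"
    using function_convergent_subsequence[OF cnt, of zs state_bound] evolution_bounded(1)[OF f z] by blast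
  have arc_th: "(\<lambda>k. arc (\<theta>s (r k) t)) \<longlonglongrightarrow> arc t" if t: "t \<in> {0..T}" for t
  proof (rule continuous_on_tendsto_compose[OF continuous_arc])
    show "(\<lambda>k. \<theta>s (r k) t) \<longlonglongrightarrow> t"
      using LIMSEQ_subseq_LIMSEQ[OF th[OF t] r] by (simp add: o_def)
    have "\<theta>s (r k) t \<in> {0..T}" for k using evolutionD(1,2)[OF z[of "r k"] t] t by simp
    then show "\<forall>\<^sub>F k in sequentially. \<theta>s (r k) t \<in> {0..T}" by simp
  qed (use t in auto)
  have "Cauchy (\<lambda>k. zs (r k) t)" if t: "t \<in> {0..T}" for t
  proof (rule CauchyI)
    fix e :: real assume e: "e > 0"
    \<comment> \<open>At \<open>t = 0\<close> there is no smaller time to approximate from, but 0 is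
      rational itself.\<close>
    obtain q where q: "q \<in> {0..T} \<inter> \<rat>" "q \<le> t" "(arc t - arc q) / c < e / 3"
    proof (cases "t = 0")
      case True
      then show ?thesis using that[of 0] t e by simp
    next
      case False
      have ec: "0 < e / 3 * c" using e c_pos by simp
      obtain d where d: "d > 0" "\<And>x. x \<in> {0..T} \<Longrightarrow> dist x t < d \<Longrightarrow> dist (arc x) (arc t) < e / 3 * c"
        using continuous_arc t ec unfolding continuous_on_iff by blast
      obtain q where q: "q \<in> \<rat>" "max 0 (t - d) < q" "q < t"
        using Rats_dense_in_real[of "max 0 (t - d)" t] t False d by auto
      then have "dist (arc q) (arc t) < e / 3 * c" using t by (intro d(2)) (auto simp: dist_real_def)
      then have "arc t - arc q < e / 3 * c" by (simp only: dist_real_def abs_less_iff) simp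
      then have "(arc t - arc q) / c < e / 3" using c_pos by (subst pos_divide_less_eq)
      then show ?thesis using q t by (intro that[of q]) auto
    qed
    have "(\<lambda>k. (arc (\<theta>s (r k) t) - arc (\<theta>s (r k) q)) / c) \<longlonglongrightarrow> (arc t - arc q) / c"
      using q t c_pos by (intro tendsto_intros arc_th) auto
    then have "\<forall>\<^sub>F k in sequentially. (arc (\<theta>s (r k) t) - arc (\<theta>s (r k) q)) / c < e / 3"
      using q(3) by (rule order_tendstoD)
    then have near: "\<forall>\<^sub>F k in sequentially. norm (zs (r k) t - zs (r k) q) < e / 3"
    proof eventually_elim
      case (elim k)
      show ?case 
        by (rule le_less_trans[OF evolution_continuity[OF f z] elim]) (use q t in auto)
    qed
    obtain n1 where n1: "\<And>k. k \<ge> n1 \<Longrightarrow> norm (zs (r k) t - zs (r k) q) < e / 3"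
      using near unfolding eventually_sequentially by blast
    have "Cauchy (\<lambda>k. zs (r k) q)" using conv[OF q(1)] by (auto intro: LIMSEQ_imp_Cauchy)
    then obtain n2 where n2: "\<And>k l. k \<ge> n2 \<Longrightarrow> l \<ge> n2 \<Longrightarrow> norm (zs (r k) q - zs (r l) q) < e / 3"
      using CauchyD[of "\<lambda>k. zs (r k) q" "e / 3"] e by auto
    show "\<exists>M. \<forall>k\<ge>M. \<forall>l\<ge>M. norm (zs (r k) t - zs (r l) t) < e"
    proof (intro exI allI impI)
      fix k l assume kl: "max n1 n2 \<le> k" "max n1 n2 \<le> l"
      have "zs (r k) t - zs (r l) t = (zs (r k) t - zs (r k) q) + (zs (r k) q - zs (r l) q) - (zs (r l) t - zs (r l) q)"
        by simp
      also have "norm \<dots> \<le> norm (zs (r k) t - zs (r k) q) + norm (zs (r k) q - zs (r l) q) + norm (zs (r l) t - zs (r l) q)"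
        by (meson add_right_mono norm_triangle_ineq norm_triangle_ineq4 order_trans)
      also have "\<dots> < e / 3 + e / 3 + e / 3"
        using kl by (intro add_strict_mono n1 n2) auto
      finally show "norm (zs (r k) t - zs (r l) t) < e" by simp
    qed
  qed
  then have "\<exists>l. (\<lambda>k. zs (r k) t) \<longlonglongrightarrow> l" if "t \<in> {0..T}" for t
    using that by (auto simp: Cauchy_convergent_iff convergent_def)
  then obtain z where "\<And>t. t \<in> {0..T} \<Longrightarrow> (\<lambda>k. zs (r k) t) \<longlonglongrightarrow> z t" by metis
  with r show ?thesis by (rule that)
qed

text \<open>Each state is tested with a fixed \<open>y\<close> of the limit domain, which is its own
  recovery sequence, while the liminf inequality handles the left-hand side. The choice
  \<open>y = x\<close> bounds the energies from above, so they converge to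
  \<open>f x\<close>.\<close>

lemma stable_limit:
  assumes G: "gamma_converges Ks fs K f" and r: "strict_mono (r :: nat \<Rightarrow> nat)" and KV: "K \<subseteq> V" "\<And>k. Ks k \<subseteq> V"
    and st: "\<And>k. stable (Ks (r k)) (fs (r k)) (ss k) (xs k)" and B: "\<And>k. fs (r k) (xs k) \<le> B"
    and lim: "ss \<longlonglongrightarrow> s" "xs \<longlonglongrightarrow> x"
  shows "stable K f s x" "(\<lambda>k. fs (r k) (xs k)) \<longlonglongrightarrow> f x"
proof -
  have xsK: "xs k \<in> Ks (r k)" for k using st by (simp add: stable_def)
  have x: "x \<in> K" and lower: "\<And>e. e > 0 \<Longrightarrow> \<forall>\<^sub>F k in sequentially. f x - e \<le> fs (r k) (xs k)"
    using G r xsK B lim(2) unfolding gamma_converges_def by blast+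
  have upper: "fs (r k) (xs k) \<le> fs (r k) y + ss k \<bullet> (xs k - y) + D (y - x) + L * norm (x - xs k)"
    if y: "y \<in> K" for k y
  proof -
    have "y \<in> Ks (r k)" using G y by (auto simp: gamma_converges_def)
    then have "fs (r k) (xs k) \<le> fs (r k) y + ss k \<bullet> (xs k - y) + D (y - xs k)"
      using st[of k] by (fastforce simp: stable_def inner_diff_right)
    also have "D (y - xs k) \<le> D (y - x) + L * norm ((y - xs k) - (y - x))"
      using x y xsK[of k] KV subspace_diff[OF V] by (intro D_perturb) blast+
    finally show ?thesis by simp
  qed
  have upper_lim: "(\<lambda>k. fs (r k) y + ss k \<bullet> (xs k - y) + D (y - x) + L * norm (x - xs k))
      \<longlonglongrightarrow> f y + s \<bullet> (x - y) + D (y - x) + L * norm (x - x)" if y: "y \<in> K" for y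
  proof -
    have "(\<lambda>k. fs k y) \<longlonglongrightarrow> f y" using G y by (simp add: gamma_converges_def)
    then have "(\<lambda>k. fs (r k) y) \<longlonglongrightarrow> f y" using LIMSEQ_subseq_LIMSEQ[OF _ r] by (force simp: o_def)
    then show ?thesis using lim by (intro tendsto_intros)
  qed
  show "stable K f s x"
    unfolding stable_def
  proof (intro conjI ballI x)
    fix y assume y: "y \<in> K"
    have "f x \<le> f y + s \<bullet> (x - y) + D (y - x)"
    proof (rule field_le_epsilon)
      fix e :: real assume "e > 0"
      from lower[OF this]
      have "\<forall>\<^sub>F k in sequentially. f x - e \<le> fs (r k) y + ss k \<bullet> (xs k - y) + D (y - x) + L * norm (x - xs k)"
        by eventually_elim (use upper[OF y] in \<open>force intro: order_trans\<close>)
      from tendsto_lowerbound[OF upper_lim[OF y] this]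
      show "f x \<le> f y + s \<bullet> (x - y) + D (y - x) + e" by simp
    qed
    then show "f x - s \<bullet> x \<le> f y - s \<bullet> y + D (y - x)" by (simp add: inner_diff_right)
  qed
  show "(\<lambda>k. fs (r k) (xs k)) \<longlonglongrightarrow> f x"
  proof (rule LIMSEQ_I)
    fix e :: real assume e: "e > 0"
    have "(\<lambda>k. fs (r k) x + ss k \<bullet> (xs k - x) + D (x - x) + L * norm (x - xs k)) \<longlonglongrightarrow> f x"
      using upper_lim[OF x] by simp
    then have "\<forall>\<^sub>F k in sequentially. fs (r k) x + ss k \<bullet> (xs k - x) + D (x - x) + L * norm (x - xs k) < f x + e"
      using e by (intro order_tendstoD) auto
    moreover have "\<forall>\<^sub>F k in sequentially. f x - e / 2 \<le> fs (r k) (xs k)"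
      using e by (intro lower) auto
    ultimately have "\<forall>\<^sub>F k in sequentially. norm (fs (r k) (xs k) - f x) < e"
    proof eventually_elim
      case (elim k)
      then show ?case using upper[OF x, of k] e by (simp add: abs_less_iff)
    qed
    then show "\<exists>n. \<forall>k\<ge>n. norm (fs (r k) (xs k) - f x) < e" by (simp add: eventually_sequentially)
  qed
qed

text \<open>The energies converge at every time by \<open>stable_limit\<close>, so they may stand on
  both sides of the two-point inequality in the limit. The work converges by dominated convergence,
  with the a priori bound on the states times \<open>|\<sigma>'|\<close> as majorant.\<close>

lemma evolution_limit:
  assumes f: "\<And>k. admissible_energy (Ks k) (fs k)" "admissible_energy K f"
    and G: "gamma_converges Ks fs K f" and r: "strict_mono (r :: nat \<Rightarrow> nat)"
    and z: "\<And>k. evolution (Ks k) (fs k) (\<theta>s k) (zs k)"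
    and th: "\<And>t. t \<in> {0..T} \<Longrightarrow> (\<lambda>k. \<theta>s k t) \<longlonglongrightarrow> t"
    and lim: "\<And>t. t \<in> {0..T} \<Longrightarrow> (\<lambda>k. zs (r k) t) \<longlonglongrightarrow> z t"
  shows "evolution K f (\<lambda>t. t) z"
proof -
  define R where "R = state_bound"
  have KV: "K \<subseteq> V" "\<And>k. Ks k \<subseteq> V" using f by (auto simp: admissible_energy_def)
  have thr: "(\<lambda>k. \<theta>s (r k) t) \<longlonglongrightarrow> t" if "t \<in> {0..T}" for t
    using LIMSEQ_subseq_LIMSEQ[OF th[OF that] r] by (simp add: o_def)
  have thT: "\<theta>s (r k) t \<in> {0..T}" "\<theta>s (r k) t \<le> t" if "t \<in> {0..T}" for k t
    using evolutionD(1,2)[OF z[of "r k"] that] that by auto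
  have sig: "(\<lambda>k. \<sigma> (\<theta>s (r k) t)) \<longlonglongrightarrow> \<sigma> t" if t: "t \<in> {0..T}" for t
    by (rule continuous_on_tendsto_compose[OF continuous_loading thr[OF t] t]) (use thT[OF t] in simp)
  have arcl: "(\<lambda>k. arc (\<theta>s (r k) t)) \<longlonglongrightarrow> arc t" if t: "t \<in> {0..T}" for t
    by (rule continuous_on_tendsto_compose[OF continuous_arc thr[OF t] t]) (use thT[OF t] in simp)
  have bound: "norm (zs k t) \<le> R" if "t \<in> {0..T}" for k t
    unfolding R_def by (rule evolution_bounded(1)[OF f(1) z that])
  have st: "stable K f (\<sigma> t) (z t)" and en: "(\<lambda>k. fs (r k) (zs (r k) t)) \<longlonglongrightarrow> f (z t)" if t: "t \<in> {0..T}" for t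
    using stable_limit[OF G r KV evolutionD(5)[OF z t] evolution_bounded(2)[OF f(1) z t] sig[OF t] lim[OF t]] by auto
  have zV: "z t \<in> V" "zs k t \<in> V" if t: "t \<in> {0..T}" for t k
    using st[OF t] KV evolution_bounded(4)[OF f(1) z t] by (auto simp: stable_def)
  have ik: "(\<lambda>x. \<sigma>' x \<bullet> zs k x) integrable_on {0..T}" for k by (rule evolutionD(6)[OF z])
  have dom: "norm (\<sigma>' x \<bullet> zs k x) \<le> R * norm (\<sigma>' x)" if "x \<in> {0..T}" for k x
  proof -
    have "norm (\<sigma>' x \<bullet> zs k x) \<le> norm (\<sigma>' x) * norm (zs k x)" by (simp add: Cauchy_Schwarz_ineq2)
    also have "\<dots> \<le> norm (\<sigma>' x) * R" by (intro mult_left_mono bound that) auto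
    finally show ?thesis by (simp add: mult.commute)
  qed
  have h: "(\<lambda>x. R * norm (\<sigma>' x)) integrable_on {0..t}" if "t \<le> T" for t
    using norm_int[of 0 t] that by (intro integrable_on_mult_right) auto
  have int: "(\<lambda>x. \<sigma>' x \<bullet> z x) integrable_on {0..T}"
    by (rule dominated_convergence(1)[where f="\<lambda>k x. \<sigma>' x \<bullet> zs (r k) x" and h="\<lambda>x. R * norm (\<sigma>' x)"])
       (use ik h[of T] dom in \<open>auto intro!: tendsto_intros lim\<close>)
  have J: "(\<lambda>k. integral {0..\<theta>s (r k) t} (\<lambda>x. \<sigma>' x \<bullet> zs (r k) x)) \<longlonglongrightarrow> integral {0..t} (\<lambda>x. \<sigma>' x \<bullet> z x)"
    if t: "t \<in> {0..T}" for t
  proof -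
    have A: "(\<lambda>k. integral {0..t} (\<lambda>x. \<sigma>' x \<bullet> zs (r k) x)) \<longlonglongrightarrow> integral {0..t} (\<lambda>x. \<sigma>' x \<bullet> z x)"
    proof (rule dominated_convergence(2)[where h="\<lambda>x. R * norm (\<sigma>' x)"])
      show "(\<lambda>x. \<sigma>' x \<bullet> zs (r k) x) integrable_on {0..t}" for k
        by (rule integrable_subinterval_real[OF ik]) (use t in auto)
    qed (use t h[of t] dom in \<open>auto intro!: tendsto_intros lim\<close>)
    have "(\<lambda>k. integral {0..t} (\<lambda>x. \<sigma>' x \<bullet> zs (r k) x) - integral {0..\<theta>s (r k) t} (\<lambda>x. \<sigma>' x \<bullet> zs (r k) x)) \<longlonglongrightarrow> 0"
    proof (rule tendsto_0_le[where K=1 and f="\<lambda>k. R * (arc t - arc (\<theta>s (r k) t))"])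
      have "(\<lambda>k. R * (arc t - arc (\<theta>s (r k) t))) \<longlonglongrightarrow> R * (arc t - arc t)"
        by (intro tendsto_intros arcl t)
      then show "(\<lambda>k. R * (arc t - arc (\<theta>s (r k) t))) \<longlonglongrightarrow> 0" by simp
      show "\<forall>\<^sub>F k in sequentially. norm (integral {0..t} (\<lambda>x. \<sigma>' x \<bullet> zs (r k) x) - integral {0..\<theta>s (r k) t} (\<lambda>x. \<sigma>' x \<bullet> zs (r k) x))
          \<le> norm (R * (arc t - arc (\<theta>s (r k) t))) * 1"
      proof (rule always_eventually, rule allI)
        fix k
        have le: "0 \<le> \<theta>s (r k) t" "\<theta>s (r k) t \<le> t" "t \<le> T" using thT[OF t, of k] t by auto
        \<comment> \<open>Freezing at \<open>v = 0\<close> bounds the work between the last node and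
          \<open>t\<close> by the state bound times the arc length.\<close>
        have "\<bar>integral {\<theta>s (r k) t..t} (\<lambda>x. \<sigma>' x \<bullet> zs (r k) x) - (\<sigma> t - \<sigma> (\<theta>s (r k) t)) \<bullet> 0\<bar>
            \<le> R * (arc t - arc (\<theta>s (r k) t))"
          by (rule frozen_integral_error[OF le])
             (use le bound in \<open>auto intro!: integrable_subinterval_real[OF ik]\<close>)
        then show "norm (integral {0..t} (\<lambda>x. \<sigma>' x \<bullet> zs (r k) x) - integral {0..\<theta>s (r k) t} (\<lambda>x. \<sigma>' x \<bullet> zs (r k) x))
          \<le> norm (R * (arc t - arc (\<theta>s (r k) t))) * 1"
          using integral_split[OF ik le, of "r k"] by simp
      qed
    qed
    from tendsto_diff[OF A this] show ?thesis by simp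
  qed
  have two: "f (z t) - \<sigma> t \<bullet> z t + D (z t - z s) + integral {s..t} (\<lambda>r. \<sigma>' r \<bullet> z r) \<le> f (z s) - \<sigma> s \<bullet> z s"
    if st': "0 \<le> s" "s \<le> t" "t \<le> T" for s t
  proof -
    have s: "s \<in> {0..T}" and t: "t \<in> {0..T}" using st' by auto
    let ?J = "\<lambda>k t. integral {0..\<theta>s (r k) t} (\<lambda>x. \<sigma>' x \<bullet> zs (r k) x)"
    let ?l = "\<lambda>k. fs (r k) (zs (r k) t) - \<sigma> (\<theta>s (r k) t) \<bullet> zs (r k) t
        + (D (z t - z s) - L * norm ((z t - z s) - (zs (r k) t - zs (r k) s))) + (?J k t - ?J k s)"
    let ?u = "\<lambda>k. fs (r k) (zs (r k) s) - \<sigma> (\<theta>s (r k) s) \<bullet> zs (r k) s"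
    have "?l \<longlonglongrightarrow> f (z t) - \<sigma> t \<bullet> z t + (D (z t - z s) - L * norm ((z t - z s) - (z t - z s)))
       + (integral {0..t} (\<lambda>r. \<sigma>' r \<bullet> z r) - integral {0..s} (\<lambda>r. \<sigma>' r \<bullet> z r))"
      by (intro tendsto_intros en sig J lim s t)
    moreover have "?u \<longlonglongrightarrow> f (z s) - \<sigma> s \<bullet> z s"
      by (intro tendsto_intros en sig lim s)
    moreover have "\<exists>n. \<forall>k\<ge>n. ?l k \<le> ?u k"
    proof (intro exI allI impI)
      fix k
      have "D (z t - z s) \<le> D (zs (r k) t - zs (r k) s) + L * norm ((z t - z s) - (zs (r k) t - zs (r k) s))"
        by (intro D_perturb subspace_diff[OF V] zV s t)
      moreover have "?J k t = ?J k s + integral {\<theta>s (r k) s..\<theta>s (r k) t} (\<lambda>x. \<sigma>' x \<bullet> zs (r k) x)"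
        by (rule integral_split[OF ik]) (use thT[OF s, of k] thT[OF t, of k] evolutionD(4)[OF z st', of "r k"] in auto)
      ultimately show "?l k \<le> ?u k" using evolutionD(7)[OF z[of "r k"] st'] by simp
    qed
    ultimately have "f (z t) - \<sigma> t \<bullet> z t + (D (z t - z s) - L * norm ((z t - z s) - (z t - z s)))
       + (integral {0..t} (\<lambda>r. \<sigma>' r \<bullet> z r) - integral {0..s} (\<lambda>r. \<sigma>' r \<bullet> z r)) \<le> f (z s) - \<sigma> s \<bullet> z s"
      by (rule LIMSEQ_le)
    then show ?thesis using integral_split[OF int st'] by simp
  qed
  show ?thesis unfolding evolution_def
    using st int two by (auto simp: mono_on_def)
qed

end

section \<open>Energy balance and uniqueness\<close>

text \<open>Increments of \<open>q\<close> telescope, which gives the upper bound for every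
  partition. From below the defect is \<open>C\<close> times a sum of squared arc increments, at
  most \<open>C * \<delta> * arc t\<close> on a partition whose arc increments do not exceed
  \<open>\<delta>\<close>.\<close>

lemma (in loading) SUP_partition_eq:
  fixes d :: "real \<Rightarrow> real \<Rightarrow> real"
  assumes t: "t \<in> {0..T}" and q0: "q 0 = 0" and C: "0 \<le> C"
    and upper: "\<And>a b. \<lbrakk>0 \<le> a; a \<le> b; b \<le> t\<rbrakk> \<Longrightarrow> d a b \<le> q b - q a"
    and lower: "\<And>a b. \<lbrakk>0 \<le> a; a \<le> b; b \<le> t\<rbrakk> \<Longrightarrow> q b - q a \<le> d a b + C * (arc b - arc a)\<^sup>2"
  shows "(SUP (n, p) \<in> {(n, p). partition_on_interval 0 t n p}. ereal (\<Sum>i<n. d (p i) (p (Suc i)))) = ereal (q t)"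
    (is "?S = _")
proof (rule antisym)
  have pt: "0 \<le> p i" "p i \<le> p (Suc i)" "p (Suc i) \<le> t" if "partition_on_interval 0 t n p" "i < n" for n p i
    using partition_on_interval_range[OF that(1), of i] partition_on_interval_range[OF that(1), of "Suc i"] that
    by (auto simp: partition_on_interval_def less_imp_le)
  have tele: "(\<Sum>i<n. q (p (Suc i)) - q (p i)) = q t" if "partition_on_interval 0 t n p" for n p
    using sum_lessThan_telescope[of "\<lambda>i. q (p i)" n] that q0 by (simp add: partition_on_interval_def)
  show "?S \<le> ereal (q t)"
  proof (rule SUP_least, clarify)
    fix n p assume p: "partition_on_interval 0 t n p"
    have "(\<Sum>i<n. d (p i) (p (Suc i))) \<le> (\<Sum>i<n. q (p (Suc i)) - q (p i))"
      by (intro sum_mono upper pt[OF p]) auto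
    then show "ereal (\<Sum>i<n. d (p i) (p (Suc i))) \<le> ereal (q t)" using tele[OF p] by simp
  qed
  show "ereal (q t) \<le> ?S"
  proof (rule ereal_le_epsilon2)
    fix e :: real assume e: "0 < e"
    define \<delta> where "\<delta> = e / (C * arc t + 1)"
    have at: "0 \<le> arc t" using arc_nonneg[of t] t by simp
    have \<delta>: "0 < \<delta>" using e C at unfolding \<delta>_def by (intro divide_pos_pos add_nonneg_pos) auto
    have "C * (\<delta> * arc t) = e * (C * arc t / (C * arc t + 1))" by (simp add: \<delta>_def)
    also have "\<dots> \<le> e * 1"
      using e mult_nonneg_nonneg[OF C at] by (intro mult_left_mono) (auto simp: divide_le_eq_1)
    finally have C\<delta>: "C * (\<delta> * arc t) \<le> e" by simp
    obtain n p where p: "partition_on_interval 0 t n p"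
      and fine: "\<And>i. i < n \<Longrightarrow> arc (p (Suc i)) - arc (p i) \<le> \<delta>"
      using fine_partition[of t \<delta>] t \<delta> by auto
    have "q t = (\<Sum>i<n. q (p (Suc i)) - q (p i))" using tele[OF p] by simp
    also have "\<dots> \<le> (\<Sum>i<n. d (p i) (p (Suc i)) + C * (\<delta> * (arc (p (Suc i)) - arc (p i))))"
    proof (rule sum_mono)
      fix i assume "i \<in> {..<n}"
      then have i: "i < n" by simp
      have "arc (p i) \<le> arc (p (Suc i))" using pt[OF p i] t by (intro arc_mono) auto
      then have "(arc (p (Suc i)) - arc (p i))\<^sup>2 \<le> \<delta> * (arc (p (Suc i)) - arc (p i))"
        using fine[OF i] unfolding power2_eq_square by (intro mult_right_mono) auto
      from mult_left_mono[OF this C]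
      show "q (p (Suc i)) - q (p i) \<le> d (p i) (p (Suc i)) + C * (\<delta> * (arc (p (Suc i)) - arc (p i)))"
        using lower[OF pt[OF p i]] by linarith
    qed
    also have "\<dots> = (\<Sum>i<n. d (p i) (p (Suc i))) + C * (\<delta> * (\<Sum>i<n. arc (p (Suc i)) - arc (p i)))"
      by (simp add: sum.distrib sum_distrib_left)
    also have "(\<Sum>i<n. arc (p (Suc i)) - arc (p i)) = arc t"
      using sum_lessThan_telescope[of "\<lambda>i. arc (p i)" n] p by (simp add: partition_on_interval_def)
    also have "(\<Sum>i<n. d (p i) (p (Suc i))) + C * (\<delta> * arc t) \<le> (\<Sum>i<n. d (p i) (p (Suc i))) + e"
      using C\<delta> by simp
    finally have "ereal (q t) \<le> ereal (\<Sum>i<n. d (p i) (p (Suc i))) + ereal e" by simp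
    also have "\<dots> \<le> ?S + ereal e"
      using p by (intro add_right_mono SUP_upper2[of "(n, p)"]) auto
    finally show "ereal (q t) \<le> ?S + ereal e" .
  qed
qed

text \<open>\<open>G\<close> is the gradient of \<open>f\<close>, and the last clause expresses the symmetry and the Lipschitz continuity
  of the second derivative without mentioning it.\<close>

definition expansion_bound :: "real \<Rightarrow> 'a::real_inner set \<Rightarrow> ('a \<Rightarrow> real) \<Rightarrow> ('a \<Rightarrow> 'a) \<Rightarrow> bool" where
  "expansion_bound M S f G \<longleftrightarrow> 0 \<le> M \<and> (\<forall>x\<in>S. \<forall>y\<in>S.
     \<bar>f y - f x - G x \<bullet> (y - x)\<bar> \<le> M * (norm (y - x))\<^sup>2 \<and>
     norm (G y - G x) \<le> M * norm (y - x) \<and>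
     (\<forall>w\<in>S. \<bar>(G y - G x) \<bullet> (w - x) - (G w - G x) \<bullet> (y - x)\<bar>
        \<le> M * ((norm (y - x))\<^sup>2 * norm (w - x) + norm (y - x) * (norm (w - x))\<^sup>2)))"

definition symmetric_expansion_on :: "'a::real_inner set \<Rightarrow> ('a \<Rightarrow> real) \<Rightarrow> ('a \<Rightarrow> 'a) \<Rightarrow> bool" where
  "symmetric_expansion_on S f G \<longleftrightarrow> (\<exists>M. expansion_bound M S f G)"

lemma expansion_boundD:
  assumes "expansion_bound M S f G"
  shows "0 \<le> M" "\<lbrakk>x \<in> S; y \<in> S\<rbrakk> \<Longrightarrow> \<bar>f y - f x - G x \<bullet> (y - x)\<bar> \<le> M * (norm (y - x))\<^sup>2"
    "\<lbrakk>x \<in> S; y \<in> S\<rbrakk> \<Longrightarrow> norm (G y - G x) \<le> M * norm (y - x)"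
    "\<lbrakk>x \<in> S; y \<in> S; w \<in> S\<rbrakk> \<Longrightarrow> \<bar>(G y - G x) \<bullet> (w - x) - (G w - G x) \<bullet> (y - x)\<bar>
       \<le> M * ((norm (y - x))\<^sup>2 * norm (w - x) + norm (y - x) * (norm (w - x))\<^sup>2)"
  using assms unfolding expansion_bound_def by blast+

lemma symmetric_expansion_on_subset:
  "\<lbrakk>symmetric_expansion_on S f G; S' \<subseteq> S\<rbrakk> \<Longrightarrow> symmetric_expansion_on S' f G"
  unfolding symmetric_expansion_on_def expansion_bound_def by blast

context rate_independent begin

text \<open>Stability at \<open>s\<close> tested with the later state \<open>z t\<close> reverses
  the energy inequality, except that the work appears as
  \<open>(\<sigma> t - \<sigma> s) \<bullet> z t\<close>. As \<open>z\<close> is Lipschitz in the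
  arc length, replacing it by the integral costs a quadratic error.\<close>

lemma evolution_reverse_estimate:
  assumes f: "admissible_energy K f" and z: "evolution K f (\<lambda>t. t) z" and st: "0 \<le> s" "s \<le> t" "t \<le> T"
  shows "\<bar>integral {s..t} (\<lambda>r. \<sigma>' r \<bullet> z r) - (\<sigma> t - \<sigma> s) \<bullet> z t\<bar> \<le> 1 / c * (arc t - arc s)\<^sup>2"
    and "f (z s) - \<sigma> s \<bullet> z s - (f (z t) - \<sigma> t \<bullet> z t) - integral {s..t} (\<lambda>r. \<sigma>' r \<bullet> z r)
      \<le> D (z t - z s) + 1 / c * (arc t - arc s)\<^sup>2"
proof -
  have "\<bar>integral {s..t} (\<lambda>r. \<sigma>' r \<bullet> z r) - (\<sigma> t - \<sigma> s) \<bullet> z t\<bar> \<le> ((arc t - arc s) / c) * (arc t - arc s)"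
  proof (rule frozen_integral_error[OF st])
    show "(\<lambda>r. \<sigma>' r \<bullet> z r) integrable_on {s..t}"
      by (rule integrable_subinterval_real[OF evolutionD(6)[OF z]]) (use st in auto)
    fix r assume r: "r \<in> {s..t}"
    then have "norm (z t - z r) \<le> (arc t - arc r) / c"
      using evolution_continuity[OF f z, of r t] st by auto
    also have "\<dots> \<le> (arc t - arc s) / c"
      using arc_mono[of s r] r st c_pos by (intro divide_right_mono) auto
    finally show "norm (z r - z t) \<le> (arc t - arc s) / c" by (simp add: norm_minus_commute)
  qed
  then show 1: "\<bar>integral {s..t} (\<lambda>r. \<sigma>' r \<bullet> z r) - (\<sigma> t - \<sigma> s) \<bullet> z t\<bar> \<le> 1 / c * (arc t - arc s)\<^sup>2"
    by (simp add: power2_eq_square)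
  have "z t \<in> K" using evolution_bounded(3)[OF f z] st by auto
  then have "f (z s) - \<sigma> s \<bullet> z s \<le> f (z t) - \<sigma> s \<bullet> z t + D (z t - z s)"
    using evolutionD(5)[OF z, of s] st by (auto simp: stable_def)
  with 1 show "f (z s) - \<sigma> s \<bullet> z s - (f (z t) - \<sigma> t \<bullet> z t) - integral {s..t} (\<lambda>r. \<sigma>' r \<bullet> z r)
      \<le> D (z t - z s) + 1 / c * (arc t - arc s)\<^sup>2"
    by (simp add: inner_diff_left)
qed

text \<open>Upgrades the energy inequality to a balance: on each interval the released energy
  dominates the dissipation by the two-point inequality and exceeds it at most by a quadratic
  error.\<close>

lemma evolution_dissipation:
  assumes f: "admissible_energy K f" and z: "evolution K f (\<lambda>t. t) z" and t: "t \<in> {0..T}"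
  shows "(SUP (n, p) \<in> {(n, p). partition_on_interval 0 t n p}. ereal (\<Sum>i<n. D (z (p (Suc i)) - z (p i))))
    = ereal (f (z 0) - \<sigma> 0 \<bullet> z 0 - (f (z t) - \<sigma> t \<bullet> z t) - integral {0..t} (\<lambda>r. \<sigma>' r \<bullet> z r))"
proof (rule SUP_partition_eq[OF t, where C="1/c" and d="\<lambda>a b. D (z b - z a)" and
    q="\<lambda>t. f (z 0) - \<sigma> 0 \<bullet> z 0 - (f (z t) - \<sigma> t \<bullet> z t) - integral {0..t} (\<lambda>r. \<sigma>' r \<bullet> z r)"])
  fix a b assume ab: "0 \<le> a" "a \<le> b" "b \<le> t"
  then have abT: "b \<le> T" using t by simp
  have split: "integral {0..b} (\<lambda>r. \<sigma>' r \<bullet> z r) = integral {0..a} (\<lambda>r. \<sigma>' r \<bullet> z r) + integral {a..b} (\<lambda>r. \<sigma>' r \<bullet> z r)"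
    by (rule integral_split[OF evolutionD(6)[OF z] ab(1,2) abT])
  show "D (z b - z a) \<le> f (z 0) - \<sigma> 0 \<bullet> z 0 - (f (z b) - \<sigma> b \<bullet> z b) - integral {0..b} (\<lambda>r. \<sigma>' r \<bullet> z r)
      - (f (z 0) - \<sigma> 0 \<bullet> z 0 - (f (z a) - \<sigma> a \<bullet> z a) - integral {0..a} (\<lambda>r. \<sigma>' r \<bullet> z r))"
    using evolutionD(7)[OF z ab(1,2) abT] split by simp
  show "f (z 0) - \<sigma> 0 \<bullet> z 0 - (f (z b) - \<sigma> b \<bullet> z b) - integral {0..b} (\<lambda>r. \<sigma>' r \<bullet> z r)
      - (f (z 0) - \<sigma> 0 \<bullet> z 0 - (f (z a) - \<sigma> a \<bullet> z a) - integral {0..a} (\<lambda>r. \<sigma>' r \<bullet> z r))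
      \<le> D (z b - z a) + 1 / c * (arc b - arc a)\<^sup>2"
    using evolution_reverse_estimate(2)[OF f z ab(1,2) abT] split by simp
qed (use c_pos in auto)

section \<open>Uniqueness for smooth energies\<close>

definition smooth_energy :: "('a \<Rightarrow> real) \<Rightarrow> ('a \<Rightarrow> 'a) \<Rightarrow> bool" where
  "smooth_energy f G \<longleftrightarrow>
     (\<forall>x\<in>V. \<forall>y\<in>V. f x + G x \<bullet> (y - x) + c * (norm (y - x))\<^sup>2 \<le> f y) \<and>
     (\<forall>R. symmetric_expansion_on (V \<inter> cball 0 R) f G)"

text \<open>The one-sided first variation of stability: the test state is
  \<open>z + h *\<^sub>R v\<close>, homogeneity makes the dissipation linear in \<open>h\<close>,
  and after division by \<open>h\<close> the remainder vanishes in the limit.\<close>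

lemma stable_gradient:
  assumes G: "smooth_energy f G" and z: "stable V f s z" and v: "v \<in> V"
  shows "0 \<le> (G z - s) \<bullet> v + D v"
proof -
  define R where "R = norm z + norm v"
  have zV: "z \<in> V" using z by (simp add: stable_def)
  obtain M where "expansion_bound M (V \<inter> cball 0 R) f G"
    using G unfolding smooth_energy_def symmetric_expansion_on_def by blast
  note M = expansion_boundD(2)[OF this]
  have "0 \<le> (G z - s) \<bullet> v + D v + h * (M * (norm v)\<^sup>2)" if h: "0 < h" "h < 1" for h :: real
  proof -
    have hv: "norm (h *\<^sub>R v) \<le> norm v" using h by (simp add: mult_left_le_one_le)
    have in1: "z \<in> V \<inter> cball 0 R" using zV by (simp add: R_def)
    have "norm (z + h *\<^sub>R v) \<le> R" using hv norm_triangle_ineq[of z "h *\<^sub>R v"] by (simp add: R_def)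
    then have in2: "z + h *\<^sub>R v \<in> V \<inter> cball 0 R"
      using zV v by (simp add: subspace_add[OF V] subspace_scale[OF V])
    have "f z - s \<bullet> z \<le> f (z + h *\<^sub>R v) - s \<bullet> (z + h *\<^sub>R v) + D (h *\<^sub>R v)"
      using z in2 unfolding stable_def by fastforce
    also have "D (h *\<^sub>R v) = h * D v" using h v by (intro D_scale) auto
    also have "f (z + h *\<^sub>R v) \<le> f z + G z \<bullet> (h *\<^sub>R v) + M * (norm (h *\<^sub>R v))\<^sup>2"
      using M[OF in1 in2] by (simp add: abs_le_iff)
    finally have "0 \<le> h * ((G z - s) \<bullet> v + D v + h * (M * (norm v)\<^sup>2))"
      using h by (simp add: inner_simps power_mult_distrib algebra_simps power2_eq_square)
    then show ?thesis using h by (simp add: zero_le_mult_iff)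
  qed
  then have "\<forall>\<^sub>F h in at_right 0. 0 \<le> (G z - s) \<bullet> v + D v + h * (M * (norm v)\<^sup>2)"
    unfolding eventually_at_right_field by (intro exI[of _ 1]) auto
  moreover have "((\<lambda>h. (G z - s) \<bullet> v + D v + h * (M * (norm v)\<^sup>2)) \<longlongrightarrow> (G z - s) \<bullet> v + D v + 0 * (M * (norm v)\<^sup>2)) (at_right 0)"
    by (intro tendsto_intros)
  ultimately show ?thesis
    using tendsto_lowerbound[of "\<lambda>h. (G z - s) \<bullet> v + D v + h * (M * (norm v)\<^sup>2)"
       "(G z - s) \<bullet> v + D v + 0 * (M * (norm v)\<^sup>2)" "at_right 0" 0] by simp
qed

text \<open>The loading cancels in \<open>\<gamma> = (G z\<^sub>1 - G z\<^sub>2) \<bullet> (z\<^sub>1 - z\<^sub>2)\<close>, whose increments are therefore bounded by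
  \<open>\<gamma>\<close> times the arc length, up to quadratic errors.\<close>

lemma evolution_unique:
  assumes f: "admissible_energy V f" and G: "smooth_energy f G"
    and z: "evolution V f (\<lambda>t. t) z\<^sub>1" "evolution V f (\<lambda>t. t) z\<^sub>2" and init: "z\<^sub>1 0 = z\<^sub>2 0"
    and t: "t \<in> {0..T}"
  shows "z\<^sub>1 t = z\<^sub>2 t"
proof -
  define R where "R = state_bound"
  have R0: "0 \<le> R" using state_bound_nonneg by (simp add: R_def)
  obtain M where "expansion_bound M (V \<inter> cball 0 R) f G"
    using G unfolding smooth_energy_def symmetric_expansion_on_def by blast
  note M0 = expansion_boundD(1)[OF this] and M = expansion_boundD(3,4)[OF this]
  have conv: "f x + G x \<bullet> (y - x) + c * (norm (y - x))\<^sup>2 \<le> f y" if "x \<in> V" "y \<in> V" for x y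
    using G that unfolding smooth_energy_def by blast
  have zin: "z\<^sub>1 u \<in> V \<inter> cball 0 R" "z\<^sub>2 u \<in> V \<inter> cball 0 R" if "u \<in> {0..T}" for u
    using evolution_bounded(1,4)[OF f z(1) that] evolution_bounded(1,4)[OF f z(2) that] by (auto simp: R_def)
  define \<gamma> where "\<gamma> u = (G (z\<^sub>1 u) - G (z\<^sub>2 u)) \<bullet> (z\<^sub>1 u - z\<^sub>2 u)" for u
  \<comment> \<open>Adding the convexity inequality in both directions removes the energies.\<close>
  have \<gamma>: "2 * c * (norm (z\<^sub>1 u - z\<^sub>2 u))\<^sup>2 \<le> \<gamma> u" if "u \<in> {0..T}" for u
    using conv[of "z\<^sub>1 u" "z\<^sub>2 u"] conv[of "z\<^sub>2 u" "z\<^sub>1 u"] zin[OF that]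
    by (simp add: \<gamma>_def inner_simps norm_minus_commute)
  have \<gamma>0: "0 \<le> \<gamma> u" if "u \<in> {0..T}" for u
    using \<gamma>[OF that] c_pos by (smt (verit) mult_nonneg_nonneg zero_le_power2)
  \<comment> \<open>Here \<open>4 / c\<close> collects two errors of size \<open>2 / c\<close> (in
    \<open>A\<close> and inside \<open>B\<close>), \<open>4 * M * R / c\<^sup>2\<close> the symmetry
    defects with \<open>norm a <= 2 * R\<close>, and \<open>4 * M / c\<^sup>2\<close> the product of
    increments in \<open>E\<close>. The last summand multiplies
    \<open>2 * c * (norm a)\<^sup>2\<close>, which is at most \<open>\<gamma> s\<close>.\<close>
  define C where "C = 4 / c + 4 * M / c\<^sup>2 + 4 * M * R / c\<^sup>2 + M / c\<^sup>2"
  have "0 \<le> 4 / c" "0 \<le> 4 * M / c\<^sup>2" "0 \<le> 4 * M * R / c\<^sup>2" "0 \<le> M / c\<^sup>2"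
    using c_pos M0 R0 by auto
  then have C0: "0 \<le> C" and CM: "M / c\<^sup>2 \<le> C" and CN: "4 / c + 4 * M / c\<^sup>2 + 4 * M * R / c\<^sup>2 \<le> C"
    unfolding C_def by linarith+
  have "\<gamma> t = 0"
  proof (rule gronwall_quadratic[OF C0 _ \<gamma>0 _ t])
    show "\<gamma> 0 \<le> 0" using init by (simp add: \<gamma>_def)
    fix s t assume st: "0 \<le> s" "s \<le> t" "t \<le> T"
    then have sT: "s \<in> {0..T}" and tT: "t \<in> {0..T}" by auto
    define \<mu> where "\<mu> = arc t - arc s"
    have \<mu>0: "0 \<le> \<mu>" using arc_mono[OF st] by (simp add: \<mu>_def)
    define \<Delta>1 where "\<Delta>1 = z\<^sub>1 t - z\<^sub>1 s"
    define \<Delta>2 where "\<Delta>2 = z\<^sub>2 t - z\<^sub>2 s"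
    define g1 where "g1 = G (z\<^sub>1 s)"
    define g2 where "g2 = G (z\<^sub>2 s)"
    define \<Gamma>1 where "\<Gamma>1 = G (z\<^sub>1 t) - G (z\<^sub>1 s)"
    define \<Gamma>2 where "\<Gamma>2 = G (z\<^sub>2 t) - G (z\<^sub>2 s)"
    define a where "a = z\<^sub>1 s - z\<^sub>2 s"
    have na: "norm a \<le> 2 * R"
      using norm_triangle_ineq4[of "z\<^sub>1 s" "z\<^sub>2 s"] zin[OF sT] by (simp add: a_def)
    have n1: "norm \<Delta>1 \<le> \<mu> / c" and n2: "norm \<Delta>2 \<le> \<mu> / c"
      using evolution_continuity[OF f z(1) st] evolution_continuity[OF f z(2) st]
      by (auto simp: \<Delta>1_def \<Delta>2_def \<mu>_def)
    have \<Delta>V: "\<Delta>1 \<in> V" "\<Delta>2 \<in> V" using zin[OF sT] zin[OF tT] by (auto simp: \<Delta>1_def \<Delta>2_def subspace_diff[OF V])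
    \<comment> \<open>The energy inequality, with the energy increment bounded below by its
      linearization and the work frozen at \<open>z t\<close>.\<close>
    have up: "(G (z s) - \<sigma> s) \<bullet> (z t - z s) + D (z t - z s) \<le> 1 / c * \<mu>\<^sup>2"
      if z: "evolution V f (\<lambda>t. t) z" for z
    proof -
      have "z s \<in> V" "z t \<in> V" using evolution_bounded(4)[OF f z] sT tT by auto
      from conv[OF this] have "f (z s) + G (z s) \<bullet> (z t - z s) \<le> f (z t)"
        using c_pos by (smt (verit) mult_nonneg_nonneg zero_le_power2)
      then show ?thesis
        using evolutionD(7)[OF z st] evolution_reverse_estimate(1)[OF f z st]
        by (simp add: \<mu>_def inner_simps abs_le_iff)
    qed
    \<comment> \<open>A crosswise test: stability of each solution in the direction of the other
      one's increment. In \<open>A\<close> both the loading and the dissipation then cancel.\<close>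
    have low: "0 \<le> (g1 - \<sigma> s) \<bullet> \<Delta>2 + D \<Delta>2" "0 \<le> (g2 - \<sigma> s) \<bullet> \<Delta>1 + D \<Delta>1"
      unfolding g1_def g2_def
      by (rule stable_gradient[OF G evolutionD(5)[OF z(1) sT] \<Delta>V(2)],
          rule stable_gradient[OF G evolutionD(5)[OF z(2) sT] \<Delta>V(1)])
    have A: "(g1 - g2) \<bullet> (\<Delta>1 - \<Delta>2) \<le> 2 / c * \<mu>\<^sup>2"
      using up[OF z(1)] up[OF z(2)] low
      unfolding g1_def[symmetric] g2_def[symmetric] \<Delta>1_def[symmetric] \<Delta>2_def[symmetric]
      by (simp add: inner_simps)
    have sm: "M * ((norm \<Delta>)\<^sup>2 * norm a + norm \<Delta> * (norm a)\<^sup>2) \<le> M * ((\<mu> / c)\<^sup>2 * (2 * R) + \<mu> / c * (norm a)\<^sup>2)"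
      if "norm \<Delta> \<le> \<mu> / c" for \<Delta> :: 'a
      using that na M0 by (intro mult_left_mono add_mono mult_mono power_mono mult_right_mono) auto
    \<comment> \<open>Symmetry of the second derivative exchanges the roles: the increment of
      \<open>G\<close> along one solution, paired with \<open>- a\<close>, becomes
      \<open>g2 - g1\<close> paired with the increment of \<open>z\<close>, which is the quantity
      that \<open>A\<close> controls.\<close>
    have B1: "(g2 - g1) \<bullet> \<Delta>1 - M * ((\<mu> / c)\<^sup>2 * (2 * R) + \<mu> / c * (norm a)\<^sup>2) \<le> \<Gamma>1 \<bullet> (- a)"
      using M(2)[OF zin(1)[OF sT] zin(1)[OF tT] zin(2)[OF sT]] sm[OF n1]
      by (simp add: a_def \<Gamma>1_def \<Delta>1_def g1_def g2_def norm_minus_commute abs_le_iff)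
    have B2: "(g1 - g2) \<bullet> \<Delta>2 - M * ((\<mu> / c)\<^sup>2 * (2 * R) + \<mu> / c * (norm a)\<^sup>2) \<le> \<Gamma>2 \<bullet> a"
      using M(2)[OF zin(2)[OF sT] zin(2)[OF tT] zin(1)[OF sT]] sm[OF n2]
      by (simp add: a_def \<Gamma>2_def \<Delta>2_def g1_def g2_def abs_le_iff)
    have B: "(\<Gamma>1 - \<Gamma>2) \<bullet> a \<le> 2 / c * \<mu>\<^sup>2 + 2 * (M * ((\<mu> / c)\<^sup>2 * (2 * R) + \<mu> / c * (norm a)\<^sup>2))"
      using A B1 B2 by (simp add: inner_simps)
    have "(\<Gamma>1 - \<Gamma>2) \<bullet> (\<Delta>1 - \<Delta>2) \<le> norm (\<Gamma>1 - \<Gamma>2) * norm (\<Delta>1 - \<Delta>2)" by (rule norm_cauchy_schwarz)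
    also have "\<dots> \<le> (2 * M * (\<mu> / c)) * (2 * (\<mu> / c))"
    proof (rule mult_mono)
      have "norm \<Gamma>1 \<le> M * (\<mu> / c)" "norm \<Gamma>2 \<le> M * (\<mu> / c)"
        using M(1)[OF zin(1)[OF sT] zin(1)[OF tT]] M(1)[OF zin(2)[OF sT] zin(2)[OF tT]]
          mult_left_mono[OF n1 M0] mult_left_mono[OF n2 M0]
        by (auto simp: \<Gamma>1_def \<Gamma>2_def \<Delta>1_def \<Delta>2_def)
      then show "norm (\<Gamma>1 - \<Gamma>2) \<le> 2 * M * (\<mu> / c)" using norm_triangle_ineq4[of \<Gamma>1 \<Gamma>2] by simp
      show "norm (\<Delta>1 - \<Delta>2) \<le> 2 * (\<mu> / c)" using norm_triangle_ineq4[of \<Delta>1 \<Delta>2] n1 n2 by simp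
    qed (use M0 \<mu>0 c_pos in auto)
    finally have E: "(\<Gamma>1 - \<Gamma>2) \<bullet> (\<Delta>1 - \<Delta>2) \<le> 4 * M / c\<^sup>2 * \<mu>\<^sup>2" by (simp add: power2_eq_square)
    have "\<gamma> t = \<gamma> s + (g1 - g2) \<bullet> (\<Delta>1 - \<Delta>2) + (\<Gamma>1 - \<Gamma>2) \<bullet> a + (\<Gamma>1 - \<Gamma>2) \<bullet> (\<Delta>1 - \<Delta>2)"
      by (simp add: \<gamma>_def g1_def g2_def \<Gamma>1_def \<Gamma>2_def a_def \<Delta>1_def \<Delta>2_def inner_simps algebra_simps)
    also have "\<dots> \<le> \<gamma> s + 2 / c * \<mu>\<^sup>2 + (2 / c * \<mu>\<^sup>2 + 2 * (M * ((\<mu> / c)\<^sup>2 * (2 * R) + \<mu> / c * (norm a)\<^sup>2))) + 4 * M / c\<^sup>2 * \<mu>\<^sup>2"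
      using A B E by linarith
    also have "\<dots> = \<gamma> s + (4 / c + 4 * M / c\<^sup>2 + 4 * M * R / c\<^sup>2) * \<mu>\<^sup>2 + M / c\<^sup>2 * (2 * c * (norm a)\<^sup>2) * \<mu>"
      using c_pos by (simp add: field_simps power2_eq_square)
    also have "M / c\<^sup>2 * (2 * c * (norm a)\<^sup>2) * \<mu> \<le> C * \<gamma> s * \<mu>"
      using \<gamma>[OF sT] \<gamma>0[OF sT] C0 CM c_pos \<mu>0 by (intro mult_mono mult_right_mono) (auto simp: a_def)
    also have "(4 / c + 4 * M / c\<^sup>2 + 4 * M * R / c\<^sup>2) * \<mu>\<^sup>2 \<le> C * \<mu>\<^sup>2"
      by (intro mult_right_mono CN) simp
    finally show "\<gamma> t \<le> \<gamma> s + C * \<gamma> s * (arc t - arc s) + C * (arc t - arc s)\<^sup>2"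
      by (simp add: \<mu>_def)
  qed auto
  then have "2 * c * (norm (z\<^sub>1 t - z\<^sub>2 t))\<^sup>2 \<le> 0" using \<gamma>[OF t] by simp
  then show ?thesis using c_pos by (simp add: mult_le_0_iff)
qed

text \<open>The convexity of \<open>f - c |.|^2\<close> along the segment from \<open>x\<close> is
  compared with the expansion of \<open>f\<close> at \<open>x + h u\<close> as
  \<open>h \<rightarrow> 0\<close>. Restoring the quadratic part turns the tangent inequality of the
  difference into one for \<open>f\<close> with modulus \<open>c\<close>.\<close>

lemma smooth_energyI:
  assumes f: "admissible_energy V f"
    and exp: "\<And>R. 0 \<le> R \<Longrightarrow> symmetric_expansion_on (cball 0 R) f G"
  shows "smooth_energy f G"
proof -
  have conv: "convex_on V (\<lambda>x. f x - c * (norm x)\<^sup>2)"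
    using f by (auto simp: admissible_energy_def)
  have "f x + G x \<bullet> (y - x) + c * (norm (y - x))\<^sup>2 \<le> f y" if xy: "x \<in> V" "y \<in> V" for x y
  proof -
    define u where "u = y - x"
    have "symmetric_expansion_on (cball 0 (norm x + norm u)) f G" by (intro exp add_nonneg_nonneg norm_ge_zero)
    then obtain M where "expansion_bound M (cball 0 (norm x + norm u)) f G"
      unfolding symmetric_expansion_on_def by blast
    note M = expansion_boundD(2)[OF this]
    let ?X = "f y - c * (norm y)\<^sup>2 - (f x - c * (norm x)\<^sup>2)"
    have "G x \<bullet> u - 2 * c * (x \<bullet> u) - h * ((M + c) * (norm u)\<^sup>2) \<le> ?X" if h: "0 < h" "h < 1" for h :: real
    proof -
      have "norm (h *\<^sub>R u) \<le> norm u" using h by (simp add: mult_left_le_one_le)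
      then have "norm (x + h *\<^sub>R u) \<le> norm x + norm u" using norm_triangle_ineq[of x "h *\<^sub>R u"] by simp
      then have 1: "f x + h * (G x \<bullet> u) - h * h * (M * (norm u)\<^sup>2) \<le> f (x + h *\<^sub>R u)"
        using M[of x "x + h *\<^sub>R u"] h by (simp add: abs_le_iff power_mult_distrib power2_eq_square algebra_simps)
      have "(1 - h) *\<^sub>R x + h *\<^sub>R y = x + h *\<^sub>R u" by (simp add: u_def algebra_simps)
      then have 2: "f (x + h *\<^sub>R u) - c * (norm (x + h *\<^sub>R u))\<^sup>2
          \<le> (1 - h) * (f x - c * (norm x)\<^sup>2) + h * (f y - c * (norm y)\<^sup>2)"
        using convex_onD[OF conv, of h x y] xy h by simp
      have 3: "(norm (x + h *\<^sub>R u))\<^sup>2 = (norm x)\<^sup>2 + 2 * h * (x \<bullet> u) + h * h * (norm u)\<^sup>2"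
        by (simp add: power2_norm_eq_inner inner_simps inner_commute algebra_simps)
      have "h * (G x \<bullet> u - 2 * c * (x \<bullet> u) - h * ((M + c) * (norm u)\<^sup>2)) \<le> h * ?X"
        using 1 2 unfolding 3 by (simp add: algebra_simps)
      then show ?thesis using h by simp
    qed
    then have "\<forall>\<^sub>F h in at_right 0. G x \<bullet> u - 2 * c * (x \<bullet> u) - h * ((M + c) * (norm u)\<^sup>2) \<le> ?X"
      unfolding eventually_at_right_field by (intro exI[of _ 1]) auto
    moreover have "((\<lambda>h. G x \<bullet> u - 2 * c * (x \<bullet> u) - h * ((M + c) * (norm u)\<^sup>2))
        \<longlongrightarrow> G x \<bullet> u - 2 * c * (x \<bullet> u) - 0 * ((M + c) * (norm u)\<^sup>2)) (at_right 0)"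
      by (intro tendsto_intros)
    ultimately have "G x \<bullet> u - 2 * c * (x \<bullet> u) - 0 * ((M + c) * (norm u)\<^sup>2) \<le> ?X"
      by (intro tendsto_upperbound) auto
    moreover have e: "(norm u)\<^sup>2 = (norm y)\<^sup>2 - (norm x)\<^sup>2 - 2 * (x \<bullet> u)"
      by (simp add: u_def power2_norm_eq_inner inner_simps inner_commute)
    have "c * (norm u)\<^sup>2 = c * (norm y)\<^sup>2 - c * (norm x)\<^sup>2 - 2 * c * (x \<bullet> u)"
      unfolding e by (simp add: algebra_simps)
    ultimately show ?thesis by (simp add: u_def)
  qed
  moreover have "symmetric_expansion_on (V \<inter> cball 0 R) f G" for R
    by (rule symmetric_expansion_on_subset[OF exp[of "max R 0"]]) auto
  ultimately show ?thesis unfolding smooth_energy_def by blast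
qed

end

section \<open>First-order expansions with quadratic remainder\<close>

text \<open>A quantitative form of \<open>C^(1,1)\<close> on an arbitrary set: it makes sense at
  endpoints and can be glued over unions. Bounds on the values and slopes are included so that
  products and compositions stay in the class.\<close>

definition taylor_bound :: "real \<Rightarrow> real set \<Rightarrow> (real \<Rightarrow> real) \<Rightarrow> (real \<Rightarrow> real) \<Rightarrow> bool" where
  "taylor_bound M S f f' \<longleftrightarrow> 0 \<le> M \<and> (\<forall>x\<in>S. \<bar>f x\<bar> \<le> M \<and> \<bar>f' x\<bar> \<le> M \<and>
     (\<forall>y\<in>S. \<bar>f y - f x\<bar> \<le> M * \<bar>y - x\<bar> \<and> \<bar>f y - f x - f' x * (y - x)\<bar> \<le> M * (y - x)\<^sup>2))"

definition taylor_on :: "real set \<Rightarrow> (real \<Rightarrow> real) \<Rightarrow> (real \<Rightarrow> real) \<Rightarrow> bool" where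
  "taylor_on S f f' \<longleftrightarrow> (\<exists>M. taylor_bound M S f f')"

lemma taylor_boundD:
  assumes "taylor_bound M S f f'"
  shows "0 \<le> M" "x \<in> S \<Longrightarrow> \<bar>f x\<bar> \<le> M" "x \<in> S \<Longrightarrow> \<bar>f' x\<bar> \<le> M"
    "\<lbrakk>x \<in> S; y \<in> S\<rbrakk> \<Longrightarrow> \<bar>f y - f x\<bar> \<le> M * \<bar>y - x\<bar>"
    "\<lbrakk>x \<in> S; y \<in> S\<rbrakk> \<Longrightarrow> \<bar>f y - f x - f' x * (y - x)\<bar> \<le> M * (y - x)\<^sup>2"
  using assms unfolding taylor_bound_def by blast+

lemma abs_mult_le: "\<lbrakk>\<bar>a\<bar> \<le> p; \<bar>b\<bar> \<le> q\<rbrakk> \<Longrightarrow> \<bar>a * b\<bar> \<le> p * q" for a b p q :: real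
  unfolding abs_mult by (intro mult_mono) auto

lemma taylor_onI:
  assumes "\<And>x. x \<in> S \<Longrightarrow> \<bar>f x\<bar> \<le> A" "\<And>x. x \<in> S \<Longrightarrow> \<bar>f' x\<bar> \<le> B"
    "\<And>x y. \<lbrakk>x \<in> S; y \<in> S\<rbrakk> \<Longrightarrow> \<bar>f y - f x\<bar> \<le> E * \<bar>y - x\<bar>"
    "\<And>x y. \<lbrakk>x \<in> S; y \<in> S\<rbrakk> \<Longrightarrow> \<bar>f y - f x - f' x * (y - x)\<bar> \<le> F * (y - x)\<^sup>2"
  shows "taylor_on S f f'"
  unfolding taylor_on_def taylor_bound_def
proof (intro exI[of _ "\<bar>A\<bar> + \<bar>B\<bar> + \<bar>E\<bar> + \<bar>F\<bar>"] conjI ballI)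
  let ?M = "\<bar>A\<bar> + \<bar>B\<bar> + \<bar>E\<bar> + \<bar>F\<bar>"
  show "0 \<le> ?M" by simp
  fix x assume x: "x \<in> S"
  show "\<bar>f x\<bar> \<le> ?M" "\<bar>f' x\<bar> \<le> ?M" using assms(1,2)[OF x] by linarith+
  fix y assume y: "y \<in> S"
  have "E * \<bar>y - x\<bar> \<le> ?M * \<bar>y - x\<bar>" "F * (y - x)\<^sup>2 \<le> ?M * (y - x)\<^sup>2" by (intro mult_right_mono; simp)+
  then show "\<bar>f y - f x\<bar> \<le> ?M * \<bar>y - x\<bar>" "\<bar>f y - f x - f' x * (y - x)\<bar> \<le> ?M * (y - x)\<^sup>2"
    using assms(3,4)[OF x y] by linarith+
qed

section \<open>Calculus rules for quadratic Taylor bounds\<close>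

lemma taylor_on_subset: "taylor_on S f f' \<Longrightarrow> S' \<subseteq> S \<Longrightarrow> taylor_on S' f f'"
  unfolding taylor_on_def taylor_bound_def by blast

lemma taylor_on_affine: "S \<subseteq> {p..q} \<Longrightarrow> taylor_on S (\<lambda>x. a + b * x) (\<lambda>x. b)"
proof (rule taylor_onI[where A="\<bar>a\<bar> + \<bar>b\<bar> * (\<bar>p\<bar> + \<bar>q\<bar>)" and B="\<bar>b\<bar>" and E="\<bar>b\<bar>" and F=0])
  assume S: "S \<subseteq> {p..q}"
  fix x assume "x \<in> S"
  with S have "p \<le> x" "x \<le> q" by auto
  then have "\<bar>x\<bar> \<le> \<bar>p\<bar> + \<bar>q\<bar>" by linarith
  then have "\<bar>b * x\<bar> \<le> \<bar>b\<bar> * (\<bar>p\<bar> + \<bar>q\<bar>)" by (simp add: abs_mult mult_left_mono)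
  then show "\<bar>a + b * x\<bar> \<le> \<bar>a\<bar> + \<bar>b\<bar> * (\<bar>p\<bar> + \<bar>q\<bar>)" by linarith
  fix y
  have "a + b * y - (a + b * x) = b * (y - x)" by (simp add: algebra_simps)
  then show "\<bar>a + b * y - (a + b * x)\<bar> \<le> \<bar>b\<bar> * \<bar>y - x\<bar>"
      "\<bar>a + b * y - (a + b * x) - b * (y - x)\<bar> \<le> 0 * (y - x)\<^sup>2"
    by (simp_all add: abs_mult)
qed simp

lemma taylor_on_add:
  assumes "taylor_on S f f'" "taylor_on S g g'"
  shows "taylor_on S (\<lambda>x. f x + g x) (\<lambda>x. f' x + g' x)"
proof -
  obtain M where "taylor_bound M S f f'"
    using assms(1) unfolding taylor_on_def by blast
  note M = taylor_boundD[OF this]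
  obtain N where "taylor_bound N S g g'"
    using assms(2) unfolding taylor_on_def by blast
  note N = taylor_boundD[OF this]
  show ?thesis
  proof (rule taylor_onI[where A="M + N" and B="M + N" and E="M + N" and F="M + N"])
    fix x assume x: "x \<in> S"
    show "\<bar>f x + g x\<bar> \<le> M + N" "\<bar>f' x + g' x\<bar> \<le> M + N"
      using M(2,3)[OF x] N(2,3)[OF x] by linarith+
    fix y assume y: "y \<in> S"
    show "\<bar>f y + g y - (f x + g x)\<bar> \<le> (M + N) * \<bar>y - x\<bar>"
      using M(4)[OF x y] N(4)[OF x y] by (simp add: distrib_right)
    show "\<bar>f y + g y - (f x + g x) - (f' x + g' x) * (y - x)\<bar> \<le> (M + N) * (y - x)\<^sup>2"
      using M(5)[OF x y] N(5)[OF x y] by (simp add: distrib_right)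
  qed
qed

lemma taylor_on_mult:
  assumes "taylor_on S f f'" "taylor_on S g g'"
  shows "taylor_on S (\<lambda>x. f x * g x) (\<lambda>x. f' x * g x + f x * g' x)"
proof -
  obtain M where "taylor_bound M S f f'"
    using assms(1) unfolding taylor_on_def by blast
  note M = taylor_boundD[OF this]
  obtain N where "taylor_bound N S g g'"
    using assms(2) unfolding taylor_on_def by blast
  note N = taylor_boundD[OF this]
  show ?thesis
  proof (rule taylor_onI[where A="M * N" and B="M * N + M * N" and E="M * N + M * N" and F="M * N + M * N + M * N"])
    fix x assume x: "x \<in> S"
    show "\<bar>f x * g x\<bar> \<le> M * N" by (rule abs_mult_le[OF M(2)[OF x] N(2)[OF x]])
    show "\<bar>f' x * g x + f x * g' x\<bar> \<le> M * N + M * N"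
      by (rule order_trans[OF abs_triangle_ineq add_mono]) (intro abs_mult_le M N x)+
    fix y assume y: "y \<in> S"
    have "f y * g y - f x * g x = (f y - f x) * g y + f x * (g y - g x)" by (simp add: algebra_simps)
    also have "\<bar>\<dots>\<bar> \<le> (M * \<bar>y - x\<bar>) * N + M * (N * \<bar>y - x\<bar>)"
      by (rule order_trans[OF abs_triangle_ineq add_mono]) (intro abs_mult_le M N x y)+
    finally show "\<bar>f y * g y - f x * g x\<bar> \<le> (M * N + M * N) * \<bar>y - x\<bar>" by (simp add: algebra_simps)
    \<comment> \<open>The last summand is of second order because both factors are
      Lipschitz.\<close>
    have "f y * g y - f x * g x - (f' x * g x + f x * g' x) * (y - x)
       = (f y - f x - f' x * (y - x)) * g x + f x * (g y - g x - g' x * (y - x)) + (f y - f x) * (g y - g x)"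
      by (simp add: algebra_simps)
    also have "\<bar>\<dots>\<bar> \<le> (M * (y - x)\<^sup>2) * N + M * (N * (y - x)\<^sup>2) + (M * \<bar>y - x\<bar>) * (N * \<bar>y - x\<bar>)"
      by (rule order_trans[OF abs_triangle_ineq add_mono[OF order_trans[OF abs_triangle_ineq add_mono]]])
         (intro abs_mult_le M N x y)+
    also have "(M * \<bar>y - x\<bar>) * (N * \<bar>y - x\<bar>) = M * N * (y - x)\<^sup>2"
      by (simp add: power2_eq_square)
    also have "(M * (y - x)\<^sup>2) * N + M * (N * (y - x)\<^sup>2) + M * N * (y - x)\<^sup>2 = (M * N + M * N + M * N) * (y - x)\<^sup>2"
      by (simp add: distrib_right mult.commute mult.left_commute)
    finally show "\<bar>f y * g y - f x * g x - (f' x * g x + f x * g' x) * (y - x)\<bar> \<le> (M * N + M * N + M * N) * (y - x)\<^sup>2" .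
  qed
qed

lemma taylor_on_cmult:
  "taylor_on S f f' \<Longrightarrow> taylor_on S (\<lambda>x. k * f x) (\<lambda>x. k * f' x)"
proof -
  assume f: "taylor_on S f f'"
  have "taylor_on S (\<lambda>x. k) (\<lambda>x. 0)" by (rule taylor_onI[of _ _ "\<bar>k\<bar>" _ 0 0 0]) auto
  from taylor_on_mult[OF this f] show ?thesis by simp
qed

lemma taylor_on_compose:
  assumes "taylor_on U f f'" "taylor_on S h h'" "h ` S \<subseteq> U"
  shows "taylor_on S (\<lambda>x. f (h x)) (\<lambda>x. f' (h x) * h' x)"
proof -
  obtain M where "taylor_bound M U f f'"
    using assms(1) unfolding taylor_on_def by blast
  note M = taylor_boundD[OF this]
  obtain N where "taylor_bound N S h h'"
    using assms(2) unfolding taylor_on_def by blast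
  note N = taylor_boundD[OF this]
  have U: "h x \<in> U" if "x \<in> S" for x using assms(3) that by auto
  show ?thesis
  proof (rule taylor_onI[where A="M" and B="M * N" and E="M * N" and F="M * N\<^sup>2 + M * N"])
    fix x assume x: "x \<in> S"
    show "\<bar>f (h x)\<bar> \<le> M" by (rule M(2)[OF U[OF x]])
    show "\<bar>f' (h x) * h' x\<bar> \<le> M * N" by (intro abs_mult_le M(3) U N(3) x)
    fix y assume y: "y \<in> S"
    have "\<bar>f (h y) - f (h x)\<bar> \<le> M * \<bar>h y - h x\<bar>" by (intro M(4) U x y)
    also have "\<dots> \<le> M * (N * \<bar>y - x\<bar>)" by (intro mult_left_mono N(4) M(1) x y)
    finally show "\<bar>f (h y) - f (h x)\<bar> \<le> M * N * \<bar>y - x\<bar>" by (simp add: mult.assoc)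
    have "(h y - h x)\<^sup>2 = \<bar>h y - h x\<bar>\<^sup>2" by simp
    also have "\<dots> \<le> (N * \<bar>y - x\<bar>)\<^sup>2" by (intro power_mono N(4) x y) auto
    finally have "(h y - h x)\<^sup>2 \<le> N\<^sup>2 * (y - x)\<^sup>2" by (simp add: power_mult_distrib)
    then have "\<bar>f (h y) - f (h x) - f' (h x) * (h y - h x)\<bar> \<le> M * (N\<^sup>2 * (y - x)\<^sup>2)"
      by (rule order_trans[OF M(5)[OF U[OF x] U[OF y]] mult_left_mono[OF _ M(1)]])
    moreover have "\<bar>f' (h x) * (h y - h x - h' x * (y - x))\<bar> \<le> M * (N * (y - x)\<^sup>2)"
      by (intro abs_mult_le M(3) U N(5) x y)
    moreover have "f (h y) - f (h x) - f' (h x) * h' x * (y - x)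
      = (f (h y) - f (h x) - f' (h x) * (h y - h x)) + f' (h x) * (h y - h x - h' x * (y - x))"
      by (simp add: algebra_simps)
    ultimately show "\<bar>f (h y) - f (h x) - f' (h x) * h' x * (y - x)\<bar> \<le> (M * N\<^sup>2 + M * N) * (y - x)\<^sup>2"
      by (simp only: distrib_right mult.assoc)
  qed
qed

lemma taylor_on_inverse:
  assumes "0 < d"
  shows "taylor_on {d..} inverse (\<lambda>x. - (inverse x)\<^sup>2)"
proof -
  have inv: "\<bar>inverse x\<bar> \<le> inverse d" if "x \<in> {d..}" for x
    using that assms by (auto simp: le_imp_inverse_le)
  show ?thesis
  proof (rule taylor_onI[where A="inverse d" and B="(inverse d)\<^sup>2" and E="inverse d * inverse d" and F="inverse d * inverse d * inverse d"])
    fix x assume x: "x \<in> {d..}"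
    show "\<bar>inverse x\<bar> \<le> inverse d" by (rule inv[OF x])
    show "\<bar>- (inverse x)\<^sup>2\<bar> \<le> (inverse d)\<^sup>2"
      using abs_mult_le[OF inv[OF x] inv[OF x]] by (simp add: power2_eq_square)
    fix y assume y: "y \<in> {d..}"
    have nz: "x \<noteq> 0" "y \<noteq> 0" using x y assms by auto
    have "inverse y - inverse x = - (inverse x * inverse y) * (y - x)" using nz by (simp add: field_simps)
    also have "\<bar>\<dots>\<bar> \<le> inverse d * inverse d * \<bar>y - x\<bar>"
      using abs_mult_le[OF abs_mult_le[OF inv[OF x] inv[OF y]], of "y - x" "\<bar>y - x\<bar>"] by simp
    finally show "\<bar>inverse y - inverse x\<bar> \<le> inverse d * inverse d * \<bar>y - x\<bar>" .
    have "inverse y - inverse x - - (inverse x)\<^sup>2 * (y - x) = inverse x * inverse x * inverse y * (y - x)\<^sup>2"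
      using nz by (simp add: field_simps power2_eq_square)
    also have "\<bar>\<dots>\<bar> \<le> inverse d * inverse d * inverse d * (y - x)\<^sup>2"
      using inv[OF x] inv[OF y] by (intro abs_mult_le) auto
    finally show "\<bar>inverse y - inverse x - - (inverse x)\<^sup>2 * (y - x)\<bar> \<le> inverse d * inverse d * inverse d * (y - x)\<^sup>2" .
  qed
qed

text \<open>With \<open>p = sqrt x\<close> and \<open>q = sqrt y\<close> the remainder is
  \<open>-(q - p)^2 / (2 p)\<close>, where \<open>q - p = (y - x) / (p + q)\<close>.\<close>

lemma taylor_on_sqrt:
  assumes "0 < d"
  shows "taylor_on {d..b} sqrt (\<lambda>x. inverse (sqrt x) / 2)"
proof -
  have inv: "\<bar>inverse (sqrt x)\<bar> \<le> inverse (sqrt d)" if "x \<in> {d..b}" for x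
    using that assms by (auto simp: le_imp_inverse_le)
  show ?thesis
  proof (rule taylor_onI[where A="sqrt b" and B="inverse (sqrt d) / 2" and E="inverse (sqrt d)" and
        F="(inverse (sqrt d))\<^sup>2 * inverse (sqrt d)"])
    fix x assume x: "x \<in> {d..b}"
    show "\<bar>sqrt x\<bar> \<le> sqrt b" using x assms by auto
    show "\<bar>inverse (sqrt x) / 2\<bar> \<le> inverse (sqrt d) / 2" using inv[OF x] by simp
    fix y assume y: "y \<in> {d..b}"
    have pos: "0 < sqrt x" "0 < sqrt y" "0 \<le> x" "0 \<le> y" using x y assms by auto
    define p where "p = sqrt x"
    define q where "q = sqrt y"
    have xy: "x = p\<^sup>2" "y = q\<^sup>2" using pos by (auto simp: p_def q_def)
    have pq: "0 < p" "0 < q" using pos by (auto simp: p_def q_def)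
    have ip: "\<bar>inverse p\<bar> \<le> inverse (sqrt d)" using inv[OF x] by (simp add: p_def)
    have "0 < inverse p" using pq by simp
    then have ip2: "\<bar>inverse p / 2\<bar> \<le> inverse (sqrt d)" using ip by linarith
    have "\<bar>inverse (p + q)\<bar> \<le> inverse p" using pq by (simp add: le_imp_inverse_le)
    then have ipq: "\<bar>inverse (p + q)\<bar> \<le> inverse (sqrt d)" using ip by linarith
    have nz: "p \<noteq> 0" "p + q \<noteq> 0" using pq by auto
    have diff: "q - p = inverse (p + q) * (y - x)"
      using nz unfolding xy by (simp add: field_simps power2_eq_square)
    then have "\<bar>q - p\<bar> \<le> inverse (sqrt d) * \<bar>y - x\<bar>" using abs_mult_le[OF ipq order_refl, of "y - x"] by simp
    then show "\<bar>sqrt y - sqrt x\<bar> \<le> inverse (sqrt d) * \<bar>y - x\<bar>" by (simp add: p_def q_def)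
    have "q - p - inverse p / 2 * (y - x) = - (((q - p) * (q - p)) * (inverse p / 2))"
      using nz unfolding xy by (simp add: field_simps power2_eq_square)
    also have "\<bar>\<dots>\<bar> \<le> (inverse (sqrt d) * \<bar>y - x\<bar> * (inverse (sqrt d) * \<bar>y - x\<bar>)) * inverse (sqrt d)"
      unfolding abs_minus_cancel
      using \<open>\<bar>q - p\<bar> \<le> inverse (sqrt d) * \<bar>y - x\<bar>\<close> ip2 by (intro abs_mult_le)
    also have "(inverse (sqrt d) * \<bar>y - x\<bar>) * (inverse (sqrt d) * \<bar>y - x\<bar>) = (inverse (sqrt d))\<^sup>2 * (y - x)\<^sup>2"
      by (simp add: power2_eq_square)
    also have "(inverse (sqrt d))\<^sup>2 * (y - x)\<^sup>2 * inverse (sqrt d) = (inverse (sqrt d))\<^sup>2 * inverse (sqrt d) * (y - x)\<^sup>2"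
      by (simp only: mult_ac)
    finally show "\<bar>sqrt y - sqrt x - inverse (sqrt x) / 2 * (y - x)\<bar> \<le> (inverse (sqrt d))\<^sup>2 * inverse (sqrt d) * (y - x)\<^sup>2"
      by (simp add: p_def q_def)
  qed
qed

text \<open>Two points that lie in no common set are at least \<open>d\<close> apart. For them crude
  bounds on values and slopes suffice, because \<open>|y - x| / d\<close> is at least 1 and may be
  inserted as a factor.\<close>

lemma taylor_on_Un:
  assumes "taylor_on S f f'" "taylor_on U f f'" and d: "0 < d"
    and sep: "\<And>x y. \<lbrakk>x \<in> S - U; y \<in> U - S\<rbrakk> \<Longrightarrow> d \<le> \<bar>y - x\<bar>"
  shows "taylor_on (S \<union> U) f f'"
proof -
  obtain M where "taylor_bound M S f f'"
    using assms(1) unfolding taylor_on_def by blast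
  note M = taylor_boundD[OF this]
  obtain N where "taylor_bound N U f f'"
    using assms(2) unfolding taylor_on_def by blast
  note N = taylor_boundD[OF this]
  define K where "K = M + N"
  have K0: "0 \<le> K" using M(1) N(1) by (simp add: K_def)
  have bd: "\<bar>f x\<bar> \<le> K" "\<bar>f' x\<bar> \<le> K" if "x \<in> S \<union> U" for x
    using that M(1-3) N(1-3) unfolding K_def by (auto intro: add_increasing2 add_increasing)
  have cases: "(x \<in> S \<and> y \<in> S) \<or> (x \<in> U \<and> y \<in> U) \<or> d \<le> \<bar>y - x\<bar>" if "x \<in> S \<union> U" "y \<in> S \<union> U" for x y
    using that sep[of x y] sep[of y x] by (auto simp: abs_minus_commute)
  show ?thesis
  proof (rule taylor_onI[where A=K and B=K and E="2 * K / d + K" and F="2 * K / d\<^sup>2 + K / d + K"])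
    fix x assume x: "x \<in> S \<union> U"
    show "\<bar>f x\<bar> \<le> K" "\<bar>f' x\<bar> \<le> K" by (intro bd x)+
    fix y assume y: "y \<in> S \<union> U"
    have "\<bar>f y - f x\<bar> \<le> (2 * K / d + K) * \<bar>y - x\<bar> \<and>
      \<bar>f y - f x - f' x * (y - x)\<bar> \<le> (2 * K / d\<^sup>2 + K / d + K) * (y - x)\<^sup>2"
    proof -
      have le: "0 \<le> 2 * K / d" "0 \<le> 2 * K / d\<^sup>2" "0 \<le> K / d" "M \<le> K" "N \<le> K"
        using K0 d M(1) N(1) by (auto simp: K_def)
      consider "x \<in> S \<and> y \<in> S" | "x \<in> U \<and> y \<in> U" | "d \<le> \<bar>y - x\<bar>" using cases[OF x y] by blast
      then show ?thesis
      proof cases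
        case 1
        have "M * \<bar>y - x\<bar> \<le> (2 * K / d + K) * \<bar>y - x\<bar>" "M * (y - x)\<^sup>2 \<le> (2 * K / d\<^sup>2 + K / d + K) * (y - x)\<^sup>2"
          using le by (intro mult_right_mono zero_le_power2 abs_ge_zero; linarith)+
        then show ?thesis using M(4,5)[of x y] 1 by (meson order_trans)
      next
        case 2
        have "N * \<bar>y - x\<bar> \<le> (2 * K / d + K) * \<bar>y - x\<bar>" "N * (y - x)\<^sup>2 \<le> (2 * K / d\<^sup>2 + K / d + K) * (y - x)\<^sup>2"
          using le by (intro mult_right_mono zero_le_power2 abs_ge_zero; linarith)+
        then show ?thesis using N(4,5)[of x y] 2 by (meson order_trans)
      next
        case 3
        have q: "1 \<le> \<bar>y - x\<bar> / d" using 3 d by simp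
        have df: "\<bar>f y - f x\<bar> \<le> 2 * K" using bd(1)[OF x] bd(1)[OF y] by linarith
        also have "\<dots> \<le> 2 * K * (\<bar>y - x\<bar> / d)" using mult_left_mono[OF q, of "2 * K"] K0 by simp
        finally have 1: "\<bar>f y - f x\<bar> \<le> 2 * K / d * \<bar>y - x\<bar>" by simp
        have 4: "\<bar>y - x\<bar> \<le> (y - x)\<^sup>2 / d"
          using mult_right_mono[OF q, of "\<bar>y - x\<bar>"] by (simp add: power2_eq_square)
        have "\<bar>f' x * (y - x)\<bar> \<le> K * \<bar>y - x\<bar>" unfolding abs_mult by (intro mult_right_mono bd x) auto
        also have "\<dots> \<le> K * ((y - x)\<^sup>2 / d)" using 4 K0 by (intro mult_left_mono)
        finally have 5: "\<bar>f' x * (y - x)\<bar> \<le> K / d * (y - x)\<^sup>2" by simp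
        have "2 * K / d * \<bar>y - x\<bar> \<le> 2 * K / d * ((y - x)\<^sup>2 / d)" using 4 K0 d by (intro mult_left_mono) auto
        then have 6: "\<bar>f y - f x\<bar> \<le> 2 * K / d\<^sup>2 * (y - x)\<^sup>2" using 1 by (simp add: power2_eq_square)
        have "0 \<le> K * \<bar>y - x\<bar>" "0 \<le> K * (y - x)\<^sup>2" using K0 by auto
        then show ?thesis using 1 5 6 by (simp only: distrib_right) linarith
      qed
    qed
    then show "\<bar>f y - f x\<bar> \<le> (2 * K / d + K) * \<bar>y - x\<bar>"
      "\<bar>f y - f x - f' x * (y - x)\<bar> \<le> (2 * K / d\<^sup>2 + K / d + K) * (y - x)\<^sup>2" by auto
  qed
qed

text \<open>The mean value theorem gives the slope at an intermediate point, and the Lipschitz bound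
  compares it with the slope at \<open>x\<close>.\<close>

lemma taylor_on_Lipschitz_derivative:
  assumes der: "\<And>x. x \<in> {a..b} \<Longrightarrow> (f has_real_derivative f' x) (at x)"
    and lip: "\<And>x y. \<lbrakk>x \<in> {a..b}; y \<in> {a..b}\<rbrakk> \<Longrightarrow> \<bar>f' y - f' x\<bar> \<le> K * \<bar>y - x\<bar>"
  shows "taylor_on {a..b} f f'"
proof (cases "a \<le> b")
  case False
  then show ?thesis unfolding taylor_on_def taylor_bound_def by (intro exI[of _ 0]) auto
next
  case True
  have K0: "0 \<le> K" if "a < b" using lip[of a b] that by (smt (verit) atLeastAtMost_iff zero_le_mult_iff)
  define B where "B = \<bar>f' a\<bar> + \<bar>K\<bar> * (b - a)"
  have fB: "\<bar>f' x\<bar> \<le> B" if x: "x \<in> {a..b}" for x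
  proof -
    have "\<bar>f' x - f' a\<bar> \<le> K * \<bar>x - a\<bar>" by (rule lip) (use x in auto)
    also have "\<dots> \<le> \<bar>K\<bar> * (b - a)" using x by (intro mult_mono) auto
    finally show ?thesis unfolding B_def by linarith
  qed
  have mvt: "\<exists>z\<in>{a..b}. f y - f x = f' z * (y - x) \<and> \<bar>z - x\<bar> \<le> \<bar>y - x\<bar>" if x: "x \<in> {a..b}" and y: "y \<in> {a..b}" for x y
  proof -
    consider "x < y" | "x = y" | "y < x" by linarith
    then show ?thesis
    proof cases
      case 1
      then obtain z where "x < z" "z < y" "f y - f x = (y - x) * f' z"
        using MVT2[of x y f f'] der x y by auto
      then show ?thesis using x y by (intro bexI[of _ z]) (auto simp: mult.commute)
    next
      case 2
      then show ?thesis using x by auto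
    next
      case 3
      then obtain z where "y < z" "z < x" "f x - f y = (x - y) * f' z"
        using MVT2[of y x f f'] der x y by auto
      then show ?thesis using x y by (intro bexI[of _ z]) (auto simp: algebra_simps)
    qed
  qed
  have L: "\<bar>f y - f x\<bar> \<le> B * \<bar>y - x\<bar>" if "x \<in> {a..b}" "y \<in> {a..b}" for x y
  proof -
    from mvt[OF that] obtain z where "z \<in> {a..b}" "f y - f x = f' z * (y - x)" by blast
    then show ?thesis using fB[of z] by (simp add: abs_mult mult_right_mono)
  qed
  show ?thesis
  proof (rule taylor_onI[where A="\<bar>f a\<bar> + B * (b - a)" and B=B and E=B and F="\<bar>K\<bar>"])
    fix x assume x: "x \<in> {a..b}"
    have "\<bar>f x - f a\<bar> \<le> B * \<bar>x - a\<bar>" using L[of a x] x by auto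
    also have "\<dots> \<le> B * (b - a)" using fB[OF x] x by (intro mult_left_mono) auto
    finally show "\<bar>f x\<bar> \<le> \<bar>f a\<bar> + B * (b - a)" by linarith
    show "\<bar>f' x\<bar> \<le> B" by (rule fB[OF x])
    fix y assume y: "y \<in> {a..b}"
    show "\<bar>f y - f x\<bar> \<le> B * \<bar>y - x\<bar>" by (rule L[OF x y])
    obtain z where z: "z \<in> {a..b}" "f y - f x = f' z * (y - x)" "\<bar>z - x\<bar> \<le> \<bar>y - x\<bar>"
      using mvt[OF x y] by blast
    have "\<bar>f y - f x - f' x * (y - x)\<bar> = \<bar>f' z - f' x\<bar> * \<bar>y - x\<bar>"
      unfolding z(2) left_diff_distrib[symmetric] abs_mult ..
    also have "\<dots> \<le> (\<bar>K\<bar> * \<bar>y - x\<bar>) * \<bar>y - x\<bar>"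
    proof (rule mult_right_mono)
      have "\<bar>f' z - f' x\<bar> \<le> K * \<bar>z - x\<bar>" by (rule lip[OF x z(1)])
      also have "\<dots> \<le> \<bar>K\<bar> * \<bar>y - x\<bar>" using z(3) by (intro mult_mono) auto
      finally show "\<bar>f' z - f' x\<bar> \<le> \<bar>K\<bar> * \<bar>y - x\<bar>" .
    qed simp
    finally show "\<bar>f y - f x - f' x * (y - x)\<bar> \<le> \<bar>K\<bar> * (y - x)\<^sup>2"
      by (simp add: power2_eq_square mult.assoc)
  qed
qed

section \<open>The regularized hardening energy\<close>

text \<open>The variable \<open>s = |x|^2 / 2\<close> is smooth at the origin, with
  \<open>s y - s x = x \<bullet> (y - x) + |y - x|^2 / 2\<close>. The formal second derivative maps
  \<open>(u, v)\<close> to \<open>\<psi>' * (x \<bullet> u) * (x \<bullet> v) + \<psi> * (u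
  \<bullet> v)\<close>; being symmetric, it drops out of the last clause and leaves terms of third
  order.\<close>

lemma symmetric_expansion_on_radial:
  fixes g \<psi> \<psi>' :: "real \<Rightarrow> real"
  assumes g: "taylor_on {0..R\<^sup>2 / 2} g \<psi>" and \<psi>: "taylor_on {0..R\<^sup>2 / 2} \<psi> \<psi>'" and R: "0 \<le> R"
  shows "symmetric_expansion_on (cball (0::'a::real_inner) R)
    (\<lambda>x. g ((norm x)\<^sup>2 / 2)) (\<lambda>x. \<psi> ((norm x)\<^sup>2 / 2) *\<^sub>R x)"
proof -
  define s where "s x = (norm x)\<^sup>2 / 2" for x :: 'a
  obtain A where "taylor_bound A {0..R\<^sup>2 / 2} g \<psi>"
    using g unfolding taylor_on_def by blast
  note A = taylor_boundD[OF this]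
  obtain B where "taylor_bound B {0..R\<^sup>2 / 2} \<psi> \<psi>'"
    using \<psi> unfolding taylor_on_def by blast
  note B = taylor_boundD[OF this]
  have sR: "s x \<in> {0..R\<^sup>2 / 2}" if "x \<in> cball 0 R" for x
    using that R by (auto simp: s_def intro!: power_mono)
  have sd: "s y - s x = x \<bullet> (y - x) + (norm (y - x))\<^sup>2 / 2" for x y
    by (simp add: s_def power2_norm_eq_inner inner_simps inner_commute field_simps)
  have sl: "\<bar>s y - s x\<bar> \<le> R * norm (y - x)" if "x \<in> cball 0 R" "y \<in> cball 0 R" for x y
  proof -
    have "s y - s x = ((1/2) *\<^sub>R (x + y)) \<bullet> (y - x)"
      by (simp add: s_def power2_norm_eq_inner inner_simps inner_commute field_simps)
    also have "\<bar>\<dots>\<bar> \<le> norm ((1/2) *\<^sub>R (x + y)) * norm (y - x)" by (rule Cauchy_Schwarz_ineq2)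
    also have "\<dots> \<le> R * norm (y - x)"
    proof (rule mult_right_mono)
      show "norm ((1/2) *\<^sub>R (x + y)) \<le> R" using norm_triangle_ineq[of x y] that by simp
    qed simp
    finally show ?thesis .
  qed
  have sl2: "(s y - s x)\<^sup>2 \<le> R\<^sup>2 * (norm (y - x))\<^sup>2" if "x \<in> cball 0 R" "y \<in> cball 0 R" for x y
    using power_mono[OF sl[OF that], of 2] by (simp add: power_mult_distrib)
  define N where "N = B * R\<^sup>2 + B / 2"
  have N0: "0 \<le> N" using B by (simp add: N_def)
  have P: "\<bar>\<psi> (s y) - \<psi> (s x) - \<psi>' (s x) * (x \<bullet> (y - x))\<bar> \<le> N * (norm (y - x))\<^sup>2"
    if "x \<in> cball 0 R" "y \<in> cball 0 R" for x y
  proof -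
    have "\<bar>\<psi> (s y) - \<psi> (s x) - \<psi>' (s x) * (s y - s x)\<bar> \<le> B * (s y - s x)\<^sup>2" by (intro B(5) sR that)
    also have "\<dots> \<le> B * (R\<^sup>2 * (norm (y - x))\<^sup>2)" by (intro mult_left_mono sl2 that B(1))
    finally have 1: "\<bar>\<psi> (s y) - \<psi> (s x) - \<psi>' (s x) * (s y - s x)\<bar> \<le> B * R\<^sup>2 * (norm (y - x))\<^sup>2" by simp
    have 2: "\<bar>\<psi>' (s x) * ((norm (y - x))\<^sup>2 / 2)\<bar> \<le> B * ((norm (y - x))\<^sup>2 / 2)"
      by (intro abs_mult_le B(3) sR that) auto
    have "\<psi> (s y) - \<psi> (s x) - \<psi>' (s x) * (x \<bullet> (y - x))
        = (\<psi> (s y) - \<psi> (s x) - \<psi>' (s x) * (s y - s x)) + \<psi>' (s x) * ((norm (y - x))\<^sup>2 / 2)"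
      unfolding sd[of y x] by (simp add: algebra_simps)
    also have "\<bar>\<dots>\<bar> \<le> B * R\<^sup>2 * (norm (y - x))\<^sup>2 + B * ((norm (y - x))\<^sup>2 / 2)"
      by (rule order_trans[OF abs_triangle_ineq add_mono[OF 1 2]])
    finally show ?thesis by (simp add: N_def algebra_simps)
  qed
  \<comment> \<open>One summand for each clause: expansion of the function, Lipschitz bound of the
    gradient, symmetry defect.\<close>
  define M where "M = (A * R\<^sup>2 + B / 2) + (B * R\<^sup>2 + B) + (N * R + B * R)"
  have parts: "A * R\<^sup>2 + B / 2 \<le> M" "B * R\<^sup>2 + B \<le> M" "N * R + B * R \<le> M" "0 \<le> M"
  proof -
    have "0 \<le> A * R\<^sup>2" "0 \<le> B * R\<^sup>2" "0 \<le> N * R" "0 \<le> B * R" using A(1) B(1) N0 R by auto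
    with B(1) show "A * R\<^sup>2 + B / 2 \<le> M" "B * R\<^sup>2 + B \<le> M" "N * R + B * R \<le> M" "0 \<le> M"
      unfolding M_def by linarith+
  qed
  show ?thesis
    unfolding symmetric_expansion_on_def expansion_bound_def s_def[symmetric]
  proof (intro exI[of _ M] conjI ballI parts(4))
    fix x y :: 'a assume x: "x \<in> cball 0 R" and y: "y \<in> cball 0 R"
    have "\<bar>g (s y) - g (s x) - \<psi> (s x) * (s y - s x)\<bar> \<le> A * (s y - s x)\<^sup>2" by (intro A(5) sR x y)
    also have "\<dots> \<le> A * (R\<^sup>2 * (norm (y - x))\<^sup>2)" by (intro mult_left_mono sl2 x y A(1))
    finally have 1: "\<bar>g (s y) - g (s x) - \<psi> (s x) * (s y - s x)\<bar> \<le> A * R\<^sup>2 * (norm (y - x))\<^sup>2" by simp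
    have 2: "\<bar>\<psi> (s x) * ((norm (y - x))\<^sup>2 / 2)\<bar> \<le> B * ((norm (y - x))\<^sup>2 / 2)"
      by (intro abs_mult_le B(2) sR x) auto
    have "g (s y) - g (s x) - (\<psi> (s x) *\<^sub>R x) \<bullet> (y - x)
        = (g (s y) - g (s x) - \<psi> (s x) * (s y - s x)) + \<psi> (s x) * ((norm (y - x))\<^sup>2 / 2)"
      unfolding sd[of y x] by (simp add: algebra_simps)
    also have "\<bar>\<dots>\<bar> \<le> A * R\<^sup>2 * (norm (y - x))\<^sup>2 + B * ((norm (y - x))\<^sup>2 / 2)"
      by (rule order_trans[OF abs_triangle_ineq add_mono[OF 1 2]])
    also have "\<dots> = (A * R\<^sup>2 + B / 2) * (norm (y - x))\<^sup>2" by (simp add: algebra_simps)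
    also have "\<dots> \<le> M * (norm (y - x))\<^sup>2" by (intro mult_right_mono parts) auto
    finally show "\<bar>g (s y) - g (s x) - (\<psi> (s x) *\<^sub>R x) \<bullet> (y - x)\<bar> \<le> M * (norm (y - x))\<^sup>2" .
    have "\<psi> (s y) *\<^sub>R y - \<psi> (s x) *\<^sub>R x = (\<psi> (s y) - \<psi> (s x)) *\<^sub>R y + \<psi> (s x) *\<^sub>R (y - x)"
      by (simp add: algebra_simps)
    also have "norm \<dots> \<le> \<bar>\<psi> (s y) - \<psi> (s x)\<bar> * norm y + \<bar>\<psi> (s x)\<bar> * norm (y - x)"
      by (rule order_trans[OF norm_triangle_ineq]) simp
    also have "\<dots> \<le> (B * (R * norm (y - x))) * R + B * norm (y - x)"
    proof (intro add_mono mult_mono)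
      show "\<bar>\<psi> (s y) - \<psi> (s x)\<bar> \<le> B * (R * norm (y - x))"
        by (rule order_trans[OF B(4)[OF sR[OF x] sR[OF y]] mult_left_mono[OF sl[OF x y] B(1)]])
    qed (use y B sR[OF x] R in auto)
    also have "\<dots> = (B * R\<^sup>2 + B) * norm (y - x)" by (simp add: algebra_simps power2_eq_square)
    also have "\<dots> \<le> M * norm (y - x)" by (intro mult_right_mono parts) auto
    finally show "norm (\<psi> (s y) *\<^sub>R y - \<psi> (s x) *\<^sub>R x) \<le> M * norm (y - x)" .
    fix w :: 'a assume w: "w \<in> cball 0 R"
    define u where "u = y - x"
    define v where "v = w - x"
    define p where "p = \<psi> (s y) - \<psi> (s x)"
    define q where "q = \<psi> (s w) - \<psi> (s x)"
    have nx: "norm x \<le> R" using x by simp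
    have xu: "\<bar>x \<bullet> u\<bar> \<le> R * norm u" "\<bar>x \<bullet> v\<bar> \<le> R * norm v"
      using order_trans[OF Cauchy_Schwarz_ineq2 mult_right_mono[OF nx]] by auto
    have uv: "\<bar>u \<bullet> v\<bar> \<le> norm u * norm v" by (rule Cauchy_Schwarz_ineq2)
    have pB: "\<bar>p\<bar> \<le> B * (R * norm u)" and qB: "\<bar>q\<bar> \<le> B * (R * norm v)"
      unfolding p_def q_def u_def v_def
      by (rule order_trans[OF B(4)[OF sR[OF x] sR[OF y]] mult_left_mono[OF sl[OF x y] B(1)]],
          rule order_trans[OF B(4)[OF sR[OF x] sR[OF w]] mult_left_mono[OF sl[OF x w] B(1)]])
    have yw: "y = x + u" "w = x + v" by (auto simp: u_def v_def)
    \<comment> \<open>The product \<open>\<psi>' (s x) * (x \<bullet> u) * (x \<bullet> v)\<close>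
      is inserted in both terms, where it cancels; this leaves the remainders of
      \<open>\<psi>\<close> that \<open>P\<close> bounds.\<close>
    have "(\<psi> (s y) *\<^sub>R y - \<psi> (s x) *\<^sub>R x) \<bullet> v - (\<psi> (s w) *\<^sub>R w - \<psi> (s x) *\<^sub>R x) \<bullet> u
      = (p - \<psi>' (s x) * (x \<bullet> u)) * (x \<bullet> v) - (q - \<psi>' (s x) * (x \<bullet> v)) * (x \<bullet> u) + (p - q) * (u \<bullet> v)"
    proof -
      have "\<psi> (s y) = \<psi> (s x) + p" "\<psi> (s w) = \<psi> (s x) + q" by (auto simp: p_def q_def)
      moreover have "((\<psi> (s x) + p) *\<^sub>R (x + u) - \<psi> (s x) *\<^sub>R x) \<bullet> v - ((\<psi> (s x) + q) *\<^sub>R (x + v) - \<psi> (s x) *\<^sub>R x) \<bullet> u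
        = (p - \<psi>' (s x) * (x \<bullet> u)) * (x \<bullet> v) - (q - \<psi>' (s x) * (x \<bullet> v)) * (x \<bullet> u) + (p - q) * (u \<bullet> v)"
        by (simp add: inner_simps inner_commute[of v u] algebra_simps)
      ultimately show ?thesis using yw by simp
    qed
    also have "\<bar>\<dots>\<bar> \<le> (N * (norm u)\<^sup>2) * (R * norm v) + (N * (norm v)\<^sup>2) * (R * norm u)
        + (B * (R * norm u) + B * (R * norm v)) * (norm u * norm v)"
    proof -
      have 1: "\<bar>(p - \<psi>' (s x) * (x \<bullet> u)) * (x \<bullet> v)\<bar> \<le> (N * (norm u)\<^sup>2) * (R * norm v)"
        using P[OF x y] by (intro abs_mult_le xu) (simp add: p_def u_def)
      have 2: "\<bar>(q - \<psi>' (s x) * (x \<bullet> v)) * (x \<bullet> u)\<bar> \<le> (N * (norm v)\<^sup>2) * (R * norm u)"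
        using P[OF x w] by (intro abs_mult_le xu) (simp add: q_def v_def)
      have 3: "\<bar>(p - q) * (u \<bullet> v)\<bar> \<le> (B * (R * norm u) + B * (R * norm v)) * (norm u * norm v)"
        using pB qB by (intro abs_mult_le uv) linarith
      from 1 2 3 show ?thesis by linarith
    qed
    also have "\<dots> = (N * R + B * R) * ((norm u)\<^sup>2 * norm v + norm u * (norm v)\<^sup>2)"
      by (simp add: algebra_simps power2_eq_square)
    also have "\<dots> \<le> M * ((norm u)\<^sup>2 * norm v + norm u * (norm v)\<^sup>2)"
      by (intro mult_right_mono parts) auto
    finally show "\<bar>(\<psi> (s y) *\<^sub>R y - \<psi> (s x) *\<^sub>R x) \<bullet> (w - x) - (\<psi> (s w) *\<^sub>R w - \<psi> (s x) *\<^sub>R x) \<bullet> (y - x)\<bar>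
           \<le> M * ((norm (y - x))\<^sup>2 * norm (w - x) + norm (y - x) * (norm (w - x))\<^sup>2)"
      unfolding u_def v_def .
  qed
qed

text \<open>For \<open>\<rho> = 0\<close> the convention \<open>x / 0 = 0\<close> removes the penalty term, so this is \<open>F\<^sub>0\<close> without its
  indicator function.\<close>

definition reg_hardening :: "real \<Rightarrow> real \<Rightarrow> (real \<Rightarrow> real) \<Rightarrow> real \<Rightarrow> 'a::real_normed_vector \<Rightarrow> real" where
  "reg_hardening c1 c2 \<phi> \<rho> a = c1 * (sqrt (\<rho>\<^sup>2 + (norm a)\<^sup>2) - \<rho>) + c2 * (norm a)\<^sup>2 + \<phi> (norm a) / \<rho>"

section \<open>Smoothness and convexity of the penalized energy\<close>

context
  fixes c3 :: real and \<phi> :: "real \<Rightarrow> real"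
  assumes pen: "penalty_fun c3 \<phi>" and c3: "0 < c3"
begin

lemma penalty_zero_iff: "\<phi> r = 0 \<longleftrightarrow> r \<le> c3"
  using pen by (simp add: penalty_fun_def)

lemma penalty_nonneg: "0 \<le> \<phi> r"
proof -
  have "mono \<phi>" using pen by (simp add: penalty_fun_def)
  then have "\<phi> (min r c3) \<le> \<phi> r" by (rule monoD) simp
  then show ?thesis using penalty_zero_iff[of "min r c3"] by simp
qed

lemma penalty_has_derivative:
  "(\<phi> has_real_derivative deriv \<phi> x) (at x)" "(deriv \<phi> has_real_derivative deriv (deriv \<phi>) x) (at x)"
  using pen by (auto simp: penalty_fun_def C21_def DERIV_deriv_iff_field_differentiable)

lemma continuous_penalty: "continuous_on S \<phi>"
  using penalty_has_derivative(1) by (meson DERIV_continuous continuous_at_imp_continuous_on)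

lemma deriv_penalty_eq_0:
  assumes "r < c3"
  shows "deriv \<phi> r = 0"
proof -
  have "((\<lambda>_. 0::real) has_real_derivative 0) (at r)" by simp
  then have "(\<phi> has_real_derivative 0) (at r)"
    by (rule has_field_derivative_transform_within_open[where S="{..<c3}"])
       (use assms penalty_zero_iff in \<open>auto simp: less_imp_le\<close>)
  then show ?thesis by (rule DERIV_imp_deriv)
qed

lemma penalty_taylor: "taylor_on {0..b} (deriv \<phi>) (deriv (deriv \<phi>))" "taylor_on {0..b} \<phi> (deriv \<phi>)"
proof -
  have "\<exists>L. L-lipschitz_on {-b..b} (deriv (deriv \<phi>))" using pen by (simp add: penalty_fun_def C21_def)
  then obtain L where L: "L-lipschitz_on {-b..b} (deriv (deriv \<phi>))" by blast
  show 1: "taylor_on {0..b} (deriv \<phi>) (deriv (deriv \<phi>))"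
  proof (rule taylor_on_Lipschitz_derivative[OF penalty_has_derivative(2)])
    fix x y assume "x \<in> {0..b}" "y \<in> {0..b}"
    then show "\<bar>deriv (deriv \<phi>) y - deriv (deriv \<phi>) x\<bar> \<le> L * \<bar>y - x\<bar>"
      using lipschitz_onD[OF L, of y x] by (auto simp: dist_real_def)
  qed
  then obtain M where "taylor_bound M {0..b} (deriv \<phi>) (deriv (deriv \<phi>))"
    unfolding taylor_on_def by blast
  note M = taylor_boundD(4)[OF this]
  show "taylor_on {0..b} \<phi> (deriv \<phi>)"
    by (rule taylor_on_Lipschitz_derivative[OF penalty_has_derivative(1) M])
qed

lemma taylor_sqrt_affine:
  assumes "0 < d" "\<And>s. s \<in> {p..q} \<Longrightarrow> d \<le> a + 2 * s"
  shows "taylor_on {p..q} (\<lambda>s. sqrt (a + 2 * s)) (\<lambda>s. inverse (sqrt (a + 2 * s)))"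
    and "\<exists>h'. taylor_on {p..q} (\<lambda>s. inverse (sqrt (a + 2 * s))) h'"
proof -
  show 1: "taylor_on {p..q} (\<lambda>s. sqrt (a + 2 * s)) (\<lambda>s. inverse (sqrt (a + 2 * s)))"
    using taylor_on_compose[OF taylor_on_sqrt[OF assms(1), of "a + 2 * q"] taylor_on_affine[OF order_refl[of "{p..q}"], of a 2]]
      assms(2) by (auto simp: image_subset_iff)
  show "\<exists>h'. taylor_on {p..q} (\<lambda>s. inverse (sqrt (a + 2 * s))) h'"
    by (rule exI, rule taylor_on_compose[OF taylor_on_inverse[of "sqrt d"] 1])
       (use assms in auto)
qed

text \<open>The root is not Lipschitz at 0, but there the penalty vanishes identically. The interval
  is covered by \<open>?S\<close>, where the root is smooth, and \<open>?U\<close>, where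
  \<open>sqrt (2 * s) < c3\<close>. The thresholds \<open>c3\<^sup>2 / 8\<close> and
  \<open>c3\<^sup>2 / 4\<close> differ by the separation that gluing requires.\<close>

lemma penalty_radial_taylor:
  "taylor_on {0..b} (\<lambda>s. \<phi> (sqrt (2 * s))) (\<lambda>s. deriv \<phi> (sqrt (2 * s)) * inverse (sqrt (2 * s)))"
  "\<exists>k. taylor_on {0..b} (\<lambda>s. deriv \<phi> (sqrt (2 * s)) * inverse (sqrt (2 * s))) k"
proof -
  let ?S = "{c3\<^sup>2 / 8..b}" and ?U = "{0..c3\<^sup>2 / 4}"
  let ?k = "\<lambda>s. deriv \<phi> (sqrt (2 * s)) * inverse (sqrt (2 * s))"
  have d: "0 < c3\<^sup>2 / 8" using c3 by simp
  have sub: "{0..b} \<subseteq> ?S \<union> ?U" using c3 by (auto simp: not_le)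
  have sep: "c3\<^sup>2 / 8 \<le> \<bar>y - x\<bar>" if "x \<in> ?S - ?U" "y \<in> ?U - ?S" for x y
    using that d by auto
  have small: "sqrt (2 * s) < c3" if "s \<in> ?U" for s
  proof (rule real_less_lsqrt)
    have "s \<le> c3\<^sup>2 / 4" using that by simp
    with d show "2 * s < c3\<^sup>2" by linarith
  qed (use c3 in auto)
  have root: "taylor_on ?S (\<lambda>s. sqrt (2 * s)) (\<lambda>s. inverse (sqrt (2 * s)))"
    using taylor_sqrt_affine(1)[of "c3\<^sup>2 / 4" "c3\<^sup>2 / 8" b 0] c3 by simp
  obtain h where iroot: "taylor_on ?S (\<lambda>s. inverse (sqrt (2 * s))) h"
    using taylor_sqrt_affine(2)[of "c3\<^sup>2 / 4" "c3\<^sup>2 / 8" b 0] c3 by auto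
  have im: "(\<lambda>s. sqrt (2 * s)) ` ?S \<subseteq> {0..sqrt (2 * b)}"
  proof clarify
    fix s assume s: "s \<in> ?S"
    then have "c3\<^sup>2 / 8 \<le> s" by simp
    with d have "0 \<le> s" by linarith
    with s show "sqrt (2 * s) \<in> {0..sqrt (2 * b)}" by simp
  qed
  have zero: "taylor_on ?U f f'" if "\<And>s. s \<in> ?U \<Longrightarrow> f s = 0" "\<And>s. s \<in> ?U \<Longrightarrow> f' s = 0" for f f' :: "real \<Rightarrow> real"
    unfolding taylor_on_def taylor_bound_def using that by (intro exI[of _ 0]) auto
  have "taylor_on ?S (\<lambda>s. \<phi> (sqrt (2 * s))) ?k"
    by (rule taylor_on_compose[OF penalty_taylor(2) root im])
  moreover have "taylor_on ?U (\<lambda>s. \<phi> (sqrt (2 * s))) ?k"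
    by (rule zero) (use small penalty_zero_iff deriv_penalty_eq_0 in \<open>auto simp: less_imp_le\<close>)
  ultimately have "taylor_on (?S \<union> ?U) (\<lambda>s. \<phi> (sqrt (2 * s))) ?k"
    using d sep by (rule taylor_on_Un)
  then show "taylor_on {0..b} (\<lambda>s. \<phi> (sqrt (2 * s))) ?k" using sub by (rule taylor_on_subset)
  have "deriv (deriv \<phi>) (sqrt (2 * s)) = 0" if s: "s \<in> ?U" for s
  proof -
    have "((\<lambda>_. 0::real) has_real_derivative 0) (at (sqrt (2 * s)))" by simp
    then have "(deriv \<phi> has_real_derivative 0) (at (sqrt (2 * s)))"
      by (rule has_field_derivative_transform_within_open[where S="{..<c3}"])
         (use small[OF s] deriv_penalty_eq_0 in auto)
    then show ?thesis by (rule DERIV_imp_deriv)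
  qed
  \<comment> \<open>On \<open>?U\<close> the inverse root, which is 0 at \<open>s = 0\<close> by
    convention, is always multiplied by a vanishing derivative of the penalty.\<close>
  then have z: "deriv (deriv \<phi>) (sqrt (2 * s)) * inverse (sqrt (2 * s)) * inverse (sqrt (2 * s)) + deriv \<phi> (sqrt (2 * s)) * h s = 0"
    if "s \<in> ?U" for s using that small[OF that] deriv_penalty_eq_0 by simp
  let ?k' = "\<lambda>s. deriv (deriv \<phi>) (sqrt (2 * s)) * inverse (sqrt (2 * s)) * inverse (sqrt (2 * s)) + deriv \<phi> (sqrt (2 * s)) * h s"
  have "taylor_on ?S ?k ?k'"
    by (rule taylor_on_mult[OF taylor_on_compose[OF penalty_taylor(1) root im] iroot])
  moreover have "taylor_on ?U ?k ?k'"
    by (rule zero) (use small z deriv_penalty_eq_0 in auto)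
  ultimately have "taylor_on (?S \<union> ?U) ?k ?k'"
    using d sep by (rule taylor_on_Un)
  then show "\<exists>k. taylor_on {0..b} ?k k" using sub taylor_on_subset by blast
qed

text \<open>With \<open>s = |x|^2 / 2\<close> the energy becomes \<open>g s\<close>;
  \<open>\<rho> > 0\<close> keeps the argument of the first root above
  \<open>\<rho>\<^sup>2\<close>. The gradient is \<open>\<psi> s\<close> times \<open>x\<close>,
  where \<open>\<psi>\<close> is the derivative of \<open>g\<close>.\<close>

lemma reg_hardening_smooth:
  assumes \<rho>: "0 < \<rho>"
  obtains G where "\<And>R. 0 \<le> R \<Longrightarrow> symmetric_expansion_on (cball (0::'a::real_inner) R) (reg_hardening c1 c2 \<phi> \<rho>) G"
proof -
  define g where "g s = (- c1 * \<rho> + 2 * c2 * s) + c1 * sqrt (\<rho>\<^sup>2 + 2 * s) + 1 / \<rho> * \<phi> (sqrt (2 * s))" for s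
  define \<psi> where "\<psi> s = 2 * c2 + c1 * inverse (sqrt (\<rho>\<^sup>2 + 2 * s))
      + 1 / \<rho> * (deriv \<phi> (sqrt (2 * s)) * inverse (sqrt (2 * s)))" for s
  have g: "reg_hardening c1 c2 \<phi> \<rho> = (\<lambda>x :: 'a. g ((norm x)\<^sup>2 / 2))"
    by (rule ext) (simp add: reg_hardening_def g_def algebra_simps)
  have T: "taylor_on {0..b} g \<psi>" "\<exists>\<psi>'. taylor_on {0..b} \<psi> \<psi>'" for b
  proof -
    have \<rho>2: "0 < \<rho>\<^sup>2" using \<rho> by simp
    have ge: "\<rho>\<^sup>2 \<le> \<rho>\<^sup>2 + 2 * s" if "s \<in> {0..b}" for s using that by simp
    show "taylor_on {0..b} g \<psi>"
      unfolding g_def[abs_def] \<psi>_def[abs_def]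
      by (intro taylor_on_add taylor_on_cmult taylor_on_affine[OF order_refl] taylor_sqrt_affine(1)[OF \<rho>2 ge] penalty_radial_taylor(1))
    obtain h where h: "taylor_on {0..b} (\<lambda>s. inverse (sqrt (\<rho>\<^sup>2 + 2 * s))) h"
      using taylor_sqrt_affine(2)[OF \<rho>2 ge] by blast
    obtain k where k: "taylor_on {0..b} (\<lambda>s. deriv \<phi> (sqrt (2 * s)) * inverse (sqrt (2 * s))) k"
      using penalty_radial_taylor(2) by blast
    have c: "taylor_on {0..b} (\<lambda>s. 2 * c2) (\<lambda>s. 0)"
      using taylor_on_affine[OF order_refl, of 0 b "2 * c2" 0] by simp
    show "\<exists>\<psi>'. taylor_on {0..b} \<psi> \<psi>'"
      unfolding \<psi>_def[abs_def]
      by (rule exI, rule taylor_on_add[OF taylor_on_add[OF c taylor_on_cmult[OF h]] taylor_on_cmult[OF k]])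
  qed
  show ?thesis
  proof (rule that[of "\<lambda>x. \<psi> ((norm x)\<^sup>2 / 2) *\<^sub>R x"])
    fix R :: real assume R: "0 \<le> R"
    obtain \<psi>' where \<psi>': "taylor_on {0..R\<^sup>2 / 2} \<psi> \<psi>'" using T(2) by blast
    show "symmetric_expansion_on (cball (0::'a) R) (reg_hardening c1 c2 \<phi> \<rho>) (\<lambda>x. \<psi> ((norm x)\<^sup>2 / 2) *\<^sub>R x)"
      unfolding g by (rule symmetric_expansion_on_radial[OF T(1) \<psi>' R])
  qed
qed

lemma continuous_reg_hardening: "continuous_on S (reg_hardening c1 c2 \<phi> \<rho> :: 'a::real_normed_vector \<Rightarrow> real)"
  unfolding reg_hardening_def[abs_def] divide_inverse
  by (intro continuous_intros continuous_on_compose2[OF continuous_penalty[of UNIV]]) auto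

text \<open>The root \<open>sqrt (\<rho>\<^sup>2 + |x|^2)\<close> is the norm of the pair
  \<open>(\<rho>, x)\<close>, hence convex in \<open>x\<close>; the penalty is a non-decreasing
  convex function of a norm.\<close>

lemma reg_hardening_minus_quadratic_convex:
  fixes K :: "'a::real_inner set"
  assumes "0 \<le> c1" "0 \<le> \<rho>" "convex K"
  shows "convex_on K (\<lambda>x. reg_hardening c1 c2 \<phi> \<rho> x - c2 * (norm x)\<^sup>2)"
proof -
  have "convex_on K (\<lambda>x. c1 * norm (\<rho>, x) + inverse \<rho> * \<phi> (norm x) + - (c1 * \<rho>))"
  proof (intro convex_on_add convex_on_cmul convex_on_const[THEN iffD2])
    show "convex_on K (\<lambda>x. norm (\<rho>, x))"
    proof (rule convex_onI)
      fix h :: real and x y :: 'a assume h: "0 < h" "h < 1"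
      have "(\<rho>, (1 - h) *\<^sub>R x + h *\<^sub>R y) = (1 - h) *\<^sub>R (\<rho>, x) + h *\<^sub>R (\<rho>, y)"
        by (simp add: algebra_simps)
      also have "norm \<dots> \<le> (1 - h) * norm (\<rho>, x) + h * norm (\<rho>, y)"
        using norm_triangle_ineq[of "(1 - h) *\<^sub>R (\<rho>, x)" "h *\<^sub>R (\<rho>, y)"] h unfolding norm_scaleR by simp
      finally show "norm (\<rho>, (1 - h) *\<^sub>R x + h *\<^sub>R y) \<le> (1 - h) * norm (\<rho>, x) + h * norm (\<rho>, y)" .
    qed (rule assms)
    show "convex_on K (\<lambda>x. \<phi> (norm x))"
    proof (rule convex_onI)
      fix h :: real and x y :: 'a assume h: "0 < h" "h < 1"
      have "mono \<phi>" and conv: "convex_on UNIV \<phi>" using pen by (auto simp: penalty_fun_def)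
      have "norm ((1 - h) *\<^sub>R x + h *\<^sub>R y) \<le> (1 - h) * norm x + h * norm y"
        using h by (intro order_trans[OF norm_triangle_ineq]) simp
      then have "\<phi> (norm ((1 - h) *\<^sub>R x + h *\<^sub>R y)) \<le> \<phi> ((1 - h) * norm x + h * norm y)"
        using \<open>mono \<phi>\<close> by (rule monoD[rotated])
      also have "\<dots> \<le> (1 - h) * \<phi> (norm x) + h * \<phi> (norm y)"
        using convex_onD[OF conv, of h "norm x" "norm y"] h by simp
      finally show "\<phi> (norm ((1 - h) *\<^sub>R x + h *\<^sub>R y)) \<le> (1 - h) * \<phi> (norm x) + h * \<phi> (norm y)" .
    qed (rule assms)
  qed (use assms in auto)
  then show ?thesis
    by (simp add: reg_hardening_def norm_Pair algebra_simps divide_inverse)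
qed

end

section \<open>Incremental minimization\<close>

text \<open>Used where compactness gives limits of subsequences and uniqueness identifies
  them.\<close>

lemma LIMSEQ_by_subsequences:
  fixes X :: "nat \<Rightarrow> 'a::metric_space"
  assumes "\<And>r. strict_mono (r :: nat \<Rightarrow> nat) \<Longrightarrow> \<exists>r'. strict_mono (r' :: nat \<Rightarrow> nat) \<and> (\<lambda>k. X (r (r' k))) \<longlonglongrightarrow> l"
  shows "X \<longlonglongrightarrow> l"
proof (rule ccontr)
  assume "\<not> X \<longlonglongrightarrow> l"
  then obtain e where e: "e > 0" "\<And>n. \<exists>k\<ge>n. e \<le> dist (X k) l"
    unfolding lim_sequentially by (meson not_le)
  then have "infinite {k. e \<le> dist (X k) l}" unfolding infinite_nat_iff_unbounded_le by blast
  from infinite_enumerate[OF this] obtain r :: "nat \<Rightarrow> nat" where r: "strict_mono r" "\<And>k. e \<le> dist (X (r k)) l"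
    by auto
  from assms[OF r(1)] obtain r' :: "nat \<Rightarrow> nat" where "(\<lambda>k. X (r (r' k))) \<longlonglongrightarrow> l" by blast
  then obtain n where "\<And>k. k \<ge> n \<Longrightarrow> dist (X (r (r' k))) l < e" using e(1) unfolding lim_sequentially by blast
  then show False using r(2)[of "r' n"] by fastforce
qed

text \<open>Coordinates in an orthonormal basis are at most the norm, and each basis vector
  contributes through \<open>D b\<close> or \<open>D (- b)\<close> according to the sign, since
  \<open>D\<close> need not be even.\<close>

lemma sublinear_le_norm:
  fixes D :: "'a::euclidean_space \<Rightarrow> real"
  assumes V: "subspace V" and D0: "\<And>a. a \<in> V \<Longrightarrow> 0 \<le> D a"
    and scale: "\<And>r a. \<lbrakk>0 \<le> r; a \<in> V\<rbrakk> \<Longrightarrow> D (r *\<^sub>R a) = r * D a"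
    and tri: "\<And>a b. \<lbrakk>a \<in> V; b \<in> V\<rbrakk> \<Longrightarrow> D (a + b) \<le> D a + D b"
  obtains L where "0 \<le> L" "\<And>a. a \<in> V \<Longrightarrow> D a \<le> L * norm a"
proof -
  obtain B where B: "B \<subseteq> V" "pairwise orthogonal B" "\<And>x. x \<in> B \<Longrightarrow> norm x = 1" "independent B" "span B = V"
    using orthonormal_basis_subspace[OF V] by metis
  have fin: "finite B" using B(4) by (rule independent_imp_finite)
  have D_0: "D 0 = 0" using scale[of 0 0] subspace_0[OF V] by simp
  have neg: "- b \<in> V" if "b \<in> B" for b using that B(1) subspace_neg[OF V] by blast
  show ?thesis
  proof (rule that[of "\<Sum>b\<in>B. D b + D (- b)"])
    show "0 \<le> (\<Sum>b\<in>B. D b + D (- b))" using B(1) neg by (intro sum_nonneg add_nonneg_nonneg D0) auto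
    fix a assume "a \<in> V"
    then obtain u where u: "a = (\<Sum>b\<in>B. u b *\<^sub>R b)" using B(5) span_finite[OF fin] by auto
    have un: "\<bar>u b\<bar> \<le> norm a" if b: "b \<in> B" for b
    proof -
      have "a \<bullet> b = (\<Sum>b'\<in>B. u b' * (b' \<bullet> b))" unfolding u by (simp add: inner_sum_left)
      also have "\<dots> = (\<Sum>b'\<in>B. if b' = b then u b else 0)"
        using B(2) b B(3)[OF b] by (intro sum.cong refl) (auto simp: pairwise_def orthogonal_def norm_eq_1)
      also have "\<dots> = u b" using fin b by simp
      finally have "u b = a \<bullet> b" by simp
      then show ?thesis using Cauchy_Schwarz_ineq2[of a b] B(3)[OF b] by simp
    qed
    have DS: "D (\<Sum>b\<in>F. v b) \<le> (\<Sum>b\<in>F. D (v b))" if "finite F" "\<And>b. b \<in> F \<Longrightarrow> v b \<in> V" for F and v :: "'a \<Rightarrow> 'a"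
      using that
    proof (induction F rule: finite_induct)
      case empty
      then show ?case by (simp add: D_0)
    next
      case (insert x F)
      have "D (v x + (\<Sum>b\<in>F. v b)) \<le> D (v x) + D (\<Sum>b\<in>F. v b)"
        using insert by (intro tri subspace_sum[OF V]) auto
      then show ?case using insert by fastforce
    qed
    have term_le: "D (u b *\<^sub>R b) \<le> norm a * (D b + D (- b))" if b: "b \<in> B" for b
    proof -
      have bV: "b \<in> V" using b B(1) by blast
      have "D (u b *\<^sub>R b) \<le> \<bar>u b\<bar> * (D b + D (- b))"
      proof (cases "0 \<le> u b")
        case True
        then show ?thesis using scale[OF True bV] D0[OF neg[OF b]] by (simp add: mult_left_mono)
      next
        case False
        have "D (u b *\<^sub>R b) = D ((- u b) *\<^sub>R (- b))" by simp
        also have "\<dots> = - u b * D (- b)" using False neg[OF b] by (intro scale) auto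
        finally show ?thesis using False D0[OF bV] by (simp add: mult_left_mono_neg)
      qed
      also have "\<dots> \<le> norm a * (D b + D (- b))"
        using un[OF b] D0[OF bV] D0[OF neg[OF b]] by (intro mult_right_mono) auto
      finally show ?thesis .
    qed
    have "D a \<le> (\<Sum>b\<in>B. D (u b *\<^sub>R b))"
      unfolding u using B(1) by (intro DS fin subspace_scale[OF V]) auto
    also have "\<dots> \<le> (\<Sum>b\<in>B. norm a * (D b + D (- b)))" by (intro sum_mono term_le)
    also have "\<dots> = (\<Sum>b\<in>B. D b + D (- b)) * norm a"
      by (simp add: sum_distrib_left mult.commute)
    finally show "D a \<le> (\<Sum>b\<in>B. D b + D (- b)) * norm a" .
  qed
qed

definition hardening_domain :: "'a::real_normed_vector set \<Rightarrow> real \<Rightarrow> real \<Rightarrow> 'a set" where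
  "hardening_domain V c3 \<rho> = {a \<in> V. \<rho> = 0 \<longrightarrow> norm a \<le> c3}"

lemma hardening_domain_pos [simp]: "\<rho> \<noteq> 0 \<Longrightarrow> hardening_domain V c3 \<rho> = V"
  and hardening_domain_0: "hardening_domain V c3 0 = V \<inter> cball 0 c3"
  by (auto simp: hardening_domain_def)

lemma closed_hardening_domain:
  fixes V :: "'a::euclidean_space set"
  assumes "subspace V"
  shows "closed (hardening_domain V c3 \<rho>)"
  using closed_subspace[OF assms] by (cases "\<rho> = 0") (auto simp: hardening_domain_0)

context rate_independent begin

section \<open>Incremental solutions as evolutions\<close>

lemma partition_index:
  assumes p: "partition_on_interval 0 T n p"
  obtains idx where "\<And>t. t \<in> {0..T} \<Longrightarrow> idx t \<le> n" "\<And>t. t \<in> {0..T} \<Longrightarrow> p (idx t) \<le> t"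
    "\<And>t. \<lbrakk>t \<in> {0..T}; idx t < n\<rbrakk> \<Longrightarrow> t < p (Suc (idx t))"
proof -
  have "\<exists>i\<le>n. p i \<le> t \<and> (i < n \<longrightarrow> t < p (Suc i))" if t: "t \<in> {0..T}" for t
  proof -
    define i where "i = (GREATEST i. i \<le> n \<and> p i \<le> t)"
    have ex: "(0::nat) \<le> n \<and> p 0 \<le> t" using p t by (simp add: partition_on_interval_def)
    have 1: "i \<le> n \<and> p i \<le> t" unfolding i_def by (rule GreatestI_nat[where k=0 and b=n]) (use ex in auto)
    have "\<not> (Suc i \<le> n \<and> p (Suc i) \<le> t)"
    proof
      assume *: "Suc i \<le> n \<and> p (Suc i) \<le> t"
      have "Suc i \<le> i" unfolding i_def by (rule Greatest_le_nat[where b=n]) (use * in \<open>auto simp: i_def\<close>)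
      then show False by simp
    qed
    with 1 show ?thesis by (intro exI[of _ i]) auto
  qed
  then obtain idx where "\<forall>t\<in>{0..T}. idx t \<le> n \<and> p (idx t) \<le> t \<and> (idx t < n \<longrightarrow> t < p (Suc (idx t)))" by metis
  then show ?thesis by (intro that[of idx]) auto
qed

text \<open>Minimality and the triangle inequality give stability at the nodes. Testing a step with
  the old state gives the energy inequality over that step, in which the work is exact because the
  interpolant is constant; the steps then add up.\<close>

lemma incremental_evolution:
  assumes f: "admissible_energy K f" and p: "partition_on_interval 0 T n p"
    and init: "stable K f (\<sigma> 0) (\<zeta> 0)"
    and mem: "\<And>i. i < n \<Longrightarrow> \<zeta> (Suc i) \<in> K"
    and min: "\<And>i y. \<lbrakk>i < n; y \<in> K\<rbrakk> \<Longrightarrow> f (\<zeta> (Suc i)) - \<sigma> (p (Suc i)) \<bullet> \<zeta> (Suc i) + D (\<zeta> (Suc i) - \<zeta> i)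
      \<le> f y - \<sigma> (p (Suc i)) \<bullet> y + D (y - \<zeta> i)"
    and z: "\<And>i t. \<lbrakk>i < n; t \<in> {p i..<p (Suc i)}\<rbrakk> \<Longrightarrow> z t = \<zeta> i" "z (p n) = \<zeta> n"
  obtains \<theta> where "evolution K f \<theta> z" "\<And>t. t \<in> {0..T} \<Longrightarrow> \<exists>i\<le>n. \<theta> t = p i \<and> z t = \<zeta> i \<and> (i < n \<longrightarrow> t < p (Suc i))"
proof -
  have KV: "K \<subseteq> V" using f by (simp add: admissible_energy_def)
  have p0: "p 0 = 0" and pn: "p n = T" and pS: "\<And>i. i < n \<Longrightarrow> p i < p (Suc i)"
    using p by (auto simp: partition_on_interval_def)
  note rng = partition_on_interval_range[OF p]
  note pmono = partition_on_interval_mono[OF p]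
  obtain idx where idx: "\<And>t. t \<in> {0..T} \<Longrightarrow> idx t \<le> n" "\<And>t. t \<in> {0..T} \<Longrightarrow> p (idx t) \<le> t"
    "\<And>t. \<lbrakk>t \<in> {0..T}; idx t < n\<rbrakk> \<Longrightarrow> t < p (Suc (idx t))"
    using partition_index[OF p] by blast
  have idx_mono: "idx s \<le> idx t" if "s \<in> {0..T}" "t \<in> {0..T}" "s \<le> t" for s t
  proof (rule ccontr)
    assume "\<not> idx s \<le> idx t"
    then have "Suc (idx t) \<le> idx s" by simp
    then have "p (Suc (idx t)) \<le> p (idx s)" using idx(1)[OF that(1)] by (intro pmono)
    moreover have "t < p (Suc (idx t))" using idx(1)[OF that(1)] \<open>Suc (idx t) \<le> idx s\<close> by (intro idx(3) that) auto
    ultimately show False using idx(2)[OF that(1)] that(3) by simp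
  qed
  have zidx: "z t = \<zeta> (idx t)" if t: "t \<in> {0..T}" for t
  proof (cases "idx t < n")
    case True
    then show ?thesis using idx(2,3)[OF t] by (intro z(1)) auto
  next
    case False
    then have "idx t = n" using idx(1)[OF t] by simp
    then have "t = p n" using idx(2)[OF t] pn t by simp
    then show ?thesis using z(2) \<open>idx t = n\<close> by simp
  qed
  \<comment> \<open>Every node is its own last node, which makes \<open>\<theta>\<close>
    idempotent.\<close>
  have idx_p: "idx (p i) = i" if "i \<le> n" for i
  proof (rule antisym)
    have pi: "p i \<in> {0..T}" using rng[OF that] by simp
    show "i \<le> idx (p i)"
    proof (rule ccontr)
      assume "\<not> i \<le> idx (p i)"
      then have "p (Suc (idx (p i))) \<le> p i" "idx (p i) < n" using that by (auto intro: pmono)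
      then show False using idx(3)[OF pi] by simp
    qed
    show "idx (p i) \<le> i"
    proof (rule ccontr)
      assume "\<not> idx (p i) \<le> i"
      then have "i < n" "p (Suc i) \<le> p (idx (p i))" using idx(1)[OF pi] by (auto intro: pmono)
      then show False using idx(2)[OF pi] pS[of i] by simp
    qed
  qed
  have memK: "\<zeta> i \<in> K" if "i \<le> n" for i
    using that init mem by (cases i) (auto simp: stable_def)
  have memV: "\<zeta> i \<in> V" if "i \<le> n" for i using memK[OF that] KV by blast
  have st: "stable K f (\<sigma> (p i)) (\<zeta> i)" if "i \<le> n" for i
  proof (cases i)
    case 0
    then show ?thesis using init p0 by simp
  next
    case (Suc j)
    then have j: "j < n" using that by simp
    show ?thesis unfolding stable_def
    proof (intro conjI ballI memK that)
      fix y assume y: "y \<in> K"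
      have "D (y - \<zeta> j) \<le> D (y - \<zeta> i) + D (\<zeta> i - \<zeta> j)"
        using D_triangle[of "y - \<zeta> i" "\<zeta> i - \<zeta> j"] y KV memV[of i] memV[of j] that Suc
        by (auto simp: subspace_diff[OF V] subset_iff)
      then show "f (\<zeta> i) - \<sigma> (p i) \<bullet> \<zeta> i \<le> f y - \<sigma> (p i) \<bullet> y + D (y - \<zeta> i)"
        using min[OF j y] Suc by simp
    qed
  qed
  have chain: "\<exists>I. ((\<lambda>r. \<sigma>' r \<bullet> z r) has_integral I) {p i..p j} \<and>
      f (\<zeta> j) - \<sigma> (p j) \<bullet> \<zeta> j + D (\<zeta> j - \<zeta> i) + I \<le> f (\<zeta> i) - \<sigma> (p i) \<bullet> \<zeta> i"
    if "i \<le> j" "j \<le> n" for i j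
    using that
  proof (induction j rule: dec_induct)
    case base
    show ?case by (intro exI[of _ 0]) auto
  next
    case (step j)
    then obtain I where I: "((\<lambda>r. \<sigma>' r \<bullet> z r) has_integral I) {p i..p j}"
      "f (\<zeta> j) - \<sigma> (p j) \<bullet> \<zeta> j + D (\<zeta> j - \<zeta> i) + I \<le> f (\<zeta> i) - \<sigma> (p i) \<bullet> \<zeta> i" by auto
    have j: "j < n" "p j < p (Suc j)" "0 \<le> p j" "p (Suc j) \<le> T"
      using step pS rng(1)[of j] rng(2)[of "Suc j"] by auto
    let ?J = "(\<sigma> (p (Suc j)) - \<sigma> (p j)) \<bullet> \<zeta> j"
    have "((\<lambda>r. \<sigma>' r \<bullet> \<zeta> j) has_integral ?J) {p j..p (Suc j)}"
      using has_integral_linear[OF increment[of "p j" "p (Suc j)"] bounded_linear_inner_left[of "\<zeta> j"]] j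
      by (simp add: o_def)
    \<comment> \<open>At the right end of the step the interpolant already has its next value; a
      single point does not affect the integral.\<close>
    then have J: "((\<lambda>r. \<sigma>' r \<bullet> z r) has_integral ?J) {p j..p (Suc j)}"
      by (rule has_integral_spike_finite[of "{p (Suc j)}", rotated 2]) (use z(1)[OF j(1)] in auto)
    have "((\<lambda>r. \<sigma>' r \<bullet> z r) has_integral I + ?J) {p i..p (Suc j)}"
      using I(1) J by (rule has_integral_combine[rotated 2]) (use step j in \<open>auto intro: pmono\<close>)
    moreover have "f (\<zeta> (Suc j)) - \<sigma> (p (Suc j)) \<bullet> \<zeta> (Suc j) + D (\<zeta> (Suc j) - \<zeta> j) \<le> f (\<zeta> j) - \<sigma> (p (Suc j)) \<bullet> \<zeta> j"
      using min[OF j(1) memK[of j]] j by simp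
    moreover have "D (\<zeta> (Suc j) - \<zeta> i) \<le> D (\<zeta> (Suc j) - \<zeta> j) + D (\<zeta> j - \<zeta> i)"
      using D_triangle[of "\<zeta> (Suc j) - \<zeta> j" "\<zeta> j - \<zeta> i"] memV step by (auto simp: subspace_diff[OF V])
    ultimately show ?case using I(2) by (intro exI[of _ "I + ?J"]) (auto simp: inner_diff_left)
  qed
  have ev: "evolution K f (\<lambda>t. p (idx t)) z"
    unfolding evolution_def
  proof (intro conjI ballI allI impI)
    fix t assume t: "t \<in> {0..T}"
    show "0 \<le> p (idx t)" "p (idx t) \<le> t" "p (idx (p (idx t))) = p (idx t)"
      using rng(1)[OF idx(1)[OF t]] idx(2)[OF t] idx_p[OF idx(1)[OF t]] by auto
    show "stable K f (\<sigma> (p (idx t))) (z t)" using st[OF idx(1)[OF t]] zidx[OF t] by simp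
  next
    show "mono_on {0..T} (\<lambda>t. p (idx t))" using idx_mono idx(1) by (auto simp: mono_on_def intro!: pmono)
    show "(\<lambda>r. \<sigma>' r \<bullet> z r) integrable_on {0..T}" using chain[of 0 n] p0 pn by auto
  next
    fix s t assume st': "0 \<le> s" "s \<le> t" "t \<le> T"
    then have s: "s \<in> {0..T}" and t: "t \<in> {0..T}" by auto
    from chain[OF idx_mono[OF s t st'(2)] idx(1)[OF t]]
    show "f (z t) - \<sigma> (p (idx t)) \<bullet> z t + D (z t - z s) + integral {p (idx s)..p (idx t)} (\<lambda>r. \<sigma>' r \<bullet> z r)
          \<le> f (z s) - \<sigma> (p (idx s)) \<bullet> z s"
      unfolding zidx[OF s] zidx[OF t] using integral_unique by blast
  qed
  show ?thesis
  proof (rule that[OF ev])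
    fix t assume "t \<in> {0..T}"
    then show "\<exists>i\<le>n. p (idx t) = p i \<and> z t = \<zeta> i \<and> (i < n \<longrightarrow> t < p (Suc i))"
      using idx zidx by blast
  qed
qed

section \<open>Existence, uniqueness and convergence of incremental minimizers\<close>

lemma minimizer_unique:
  assumes f: "admissible_energy K f" and z0: "z0 \<in> V" and y: "y \<in> K" "y' \<in> K"
    and min: "\<And>x. x \<in> K \<Longrightarrow> f y - s \<bullet> y + D (y - z0) \<le> f x - s \<bullet> x + D (x - z0)"
    and min': "f y' - s \<bullet> y' + D (y' - z0) \<le> f y - s \<bullet> y + D (y - z0)"
  shows "y' = y"
proof -
  have "c * (norm (y' - y))\<^sup>2 \<le> 0"
    using quadratic_growth[OF f y z0 min] min' by simp
  then show ?thesis using c_pos by (simp add: mult_le_0_iff)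
qed

text \<open>Formulated for a compact domain because it serves \<open>\<rho> = 0\<close>, where the
  domain is a ball in \<open>V\<close>.\<close>

lemma minimizer_exists:
  assumes K: "compact K" "0 \<in> K" "K \<subseteq> V" and f: "continuous_on K f" and z0: "z0 \<in> V"
  obtains y where "y \<in> K" "\<And>x. x \<in> K \<Longrightarrow> f y - s \<bullet> y + D (y - z0) \<le> f x - s \<bullet> x + D (x - z0)"
proof -
  have "L-lipschitz_on K (\<lambda>x. D (x - z0))"
  proof (rule lipschitz_onI)
    fix x y assume xy: "x \<in> K" "y \<in> K"
    then have *: "x - z0 \<in> V" "y - z0 \<in> V" using K z0 subspace_diff[OF V] by blast+
    show "dist (D (x - z0)) (D (y - z0)) \<le> L * dist x y"
      using D_perturb[OF *] D_perturb[OF *(2,1)] by (simp add: dist_real_def dist_norm norm_minus_commute abs_le_iff)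
  qed (rule L_nonneg)
  then have "continuous_on K (\<lambda>x. f x - s \<bullet> x + D (x - z0))"
    by (intro continuous_intros f lipschitz_on_continuous_on)
  then obtain y where "y \<in> K" "\<forall>x\<in>K. f y - s \<bullet> y + D (y - z0) \<le> f x - s \<bullet> x + D (x - z0)"
    using continuous_attains_inf[OF K(1)] K(2) by blast
  then show ?thesis using that by blast
qed

lemma gamma_converges_liminf:
  assumes "gamma_converges Ks fs K f" "strict_mono r"
    and "\<And>k. xs k \<in> Ks (r k)" "\<And>k. fs (r k) (xs k) \<le> B" "xs \<longlonglongrightarrow> x"
  shows "x \<in> K" "0 < e \<Longrightarrow> \<forall>\<^sub>F k in sequentially. f x - e \<le> fs (r k) (xs k)"
proof -
  have "x \<in> K \<and> (\<forall>e>0. \<forall>\<^sub>F k in sequentially. f x - e \<le> fs (r k) (xs k))"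
    using assms unfolding gamma_converges_def by (metis (no_types, lifting))
  then show "x \<in> K" "0 < e \<Longrightarrow> \<forall>\<^sub>F k in sequentially. f x - e \<le> fs (r k) (xs k)" by auto
qed

text \<open>Quadratic growth bounds the minimizers, Gamma-convergence makes every limit point a
  minimizer of the limit problem, and uniform convexity leaves only \<open>y\<close>. The previous
  states \<open>xs k\<close> vary as well, as the induction over the time steps requires.\<close>

lemma minimizer_limit:
  assumes fs: "\<And>k. admissible_energy (Ks k) (fs k)" and f: "admissible_energy K f"
    and G: "gamma_converges Ks fs K f"
    and xs: "\<And>k. xs k \<in> V" "x \<in> V" "xs \<longlonglongrightarrow> x"
    and ys: "\<And>k. ys k \<in> Ks k" "\<And>k y. y \<in> Ks k \<Longrightarrow> fs k (ys k) - s \<bullet> ys k + D (ys k - xs k) \<le> fs k y - s \<bullet> y + D (y - xs k)"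
    and y: "y \<in> K" "\<And>w. w \<in> K \<Longrightarrow> f y - s \<bullet> y + D (y - x) \<le> f w - s \<bullet> w + D (w - x)"
  shows "ys \<longlonglongrightarrow> y"
proof -
  have KV: "K \<subseteq> V" "\<And>k. Ks k \<subseteq> V" using f fs by (auto simp: admissible_energy_def)
  have ysV: "ys k \<in> V" for k using ys(1) KV by blast
  obtain X where X: "\<And>k. norm (xs k) \<le> X"
    using convergent_imp_bounded[OF xs(3)] by (auto simp: bounded_iff)
  define Q where "Q = norm s + L * X"
  have X0: "0 \<le> X" using order_trans[OF norm_ge_zero X] .
  have Q0: "0 \<le> Q" using L_nonneg X0 by (simp add: Q_def)
  have main: "fs k (ys k) + c * (norm (ys k))\<^sup>2 \<le> norm s * norm (ys k) + L * X" for k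
  proof -
    have 0: "0 \<in> Ks k" "fs k 0 = 0" using fs[of k] by (auto simp: admissible_energy_def)
    have "fs k (ys k) - s \<bullet> ys k + D (ys k - xs k) + c * (norm (0 - ys k))\<^sup>2 \<le> fs k 0 - s \<bullet> 0 + D (0 - xs k)"
      by (rule quadratic_growth[OF fs ys(1) 0(1) xs(1) ys(2)])
    moreover have "D (0 - xs k) \<le> L * X"
    proof -
      have "D (- xs k) \<le> L * norm (- xs k)" using xs(1) subspace_neg[OF V] by (intro D_le) blast
      also have "\<dots> \<le> L * X" using X L_nonneg by (simp add: mult_left_mono)
      finally show ?thesis by simp
    qed
    moreover have "0 \<le> D (ys k - xs k)" using ysV xs(1) subspace_diff[OF V] by (intro D_nonneg) blast
    moreover have "s \<bullet> ys k \<le> norm s * norm (ys k)" by (rule norm_cauchy_schwarz)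
    ultimately show ?thesis using 0 by simp
  qed
  have fs0: "0 \<le> fs k (ys k)" for k using fs[of k] ys(1) by (auto simp: admissible_energy_def)
  \<comment> \<open>Where \<open>norm (ys k) > 1\<close> the constant \<open>L * X\<close> may be
    multiplied by \<open>norm (ys k)\<close>, after which one factor cancels.\<close>
  have bound: "norm (ys k) \<le> 1 + Q / c" for k
  proof (cases "norm (ys k) \<le> 1")
    case True
    then show ?thesis using Q0 c_pos by (simp add: add_increasing2)
  next
    case False
    have "L * X * 1 \<le> L * X * norm (ys k)" using False L_nonneg X0 by (intro mult_left_mono) auto
    then have "c * (norm (ys k))\<^sup>2 \<le> Q * norm (ys k)"
      unfolding Q_def distrib_right using main[of k] fs0[of k] by linarith
    then have "c * norm (ys k) * norm (ys k) \<le> Q * norm (ys k)"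
      by (simp add: power2_eq_square mult.assoc)
    moreover have "0 < norm (ys k)" using False by linarith
    ultimately have "c * norm (ys k) \<le> Q" by (rule mult_right_le_imp_le)
    then have "norm (ys k) \<le> Q / c" using c_pos by (simp add: field_simps)
    then show ?thesis by simp
  qed
  have fbound: "fs k (ys k) \<le> norm s * (1 + Q / c) + L * X" for k
  proof -
    have "0 \<le> c * (norm (ys k))\<^sup>2" using c_pos by simp
    moreover have "norm s * norm (ys k) \<le> norm s * (1 + Q / c)" using bound by (intro mult_left_mono) auto
    ultimately show ?thesis using main[of k] by linarith
  qed
  show ?thesis
  proof (rule LIMSEQ_by_subsequences)
    fix r :: "nat \<Rightarrow> nat" assume r: "strict_mono r"
    have "bounded (range (\<lambda>k. ys (r k)))" using bound by (auto simp: bounded_iff)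
    then obtain y' r' where r': "strict_mono r'" and lim: "(\<lambda>k. ys (r (r' k))) \<longlonglongrightarrow> y'"
      using bounded_imp_convergent_subsequence[of "\<lambda>k. ys (r k)"] by (auto simp: o_def)
    define q where "q k = r (r' k)" for k
    have q: "strict_mono q" using r r' by (simp add: q_def strict_mono_def)
    have lim: "(\<lambda>k. ys (q k)) \<longlonglongrightarrow> y'" using lim by (simp add: q_def)
    have xlim: "(\<lambda>k. xs (q k)) \<longlonglongrightarrow> x" using LIMSEQ_subseq_LIMSEQ[OF xs(3) q] by (simp add: o_def)
    have liminf: "y' \<in> K" "\<And>e. e > 0 \<Longrightarrow> \<forall>\<^sub>F k in sequentially. f y' - e \<le> fs (q k) (ys (q k))"
      using gamma_converges_liminf[OF G q _ _ lim] ys(1) fbound by blast+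
    have flim: "(\<lambda>k. fs (q k) y) \<longlonglongrightarrow> f y"
      using G y(1) LIMSEQ_subseq_LIMSEQ[OF _ q] unfolding gamma_converges_def by (force simp: o_def)
    let ?u = "\<lambda>k. fs (q k) y + s \<bullet> (ys (q k) - y) + (D (y - x) + L * norm (x - xs (q k)))
        - (D (y' - x) - L * norm ((y' - x) - (ys (q k) - xs (q k))))"
    have "?u \<longlonglongrightarrow> f y + s \<bullet> (y' - y) + (D (y - x) + L * norm (x - x)) - (D (y' - x) - L * norm ((y' - x) - (y' - x)))"
      by (intro tendsto_intros flim lim xlim)
    then have ulim: "?u \<longlonglongrightarrow> f y + s \<bullet> (y' - y) + D (y - x) - D (y' - x)" by simp
    have upper: "fs (q k) (ys (q k)) \<le> ?u k" for k
    proof -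
      have "y \<in> Ks (q k)" using G y(1) by (auto simp: gamma_converges_def)
      from ys(2)[OF this] have "fs (q k) (ys (q k)) \<le> fs (q k) y + s \<bullet> (ys (q k) - y) + D (y - xs (q k)) - D (ys (q k) - xs (q k))"
        by (simp add: inner_diff_right)
      moreover have "D (y - xs (q k)) \<le> D (y - x) + L * norm ((y - xs (q k)) - (y - x))"
        using y(1) KV xs(1,2) by (intro D_perturb subspace_diff[OF V]) auto
      moreover have "D (y' - x) \<le> D (ys (q k) - xs (q k)) + L * norm ((y' - x) - (ys (q k) - xs (q k)))"
        using liminf(1) KV xs(1,2) ysV by (intro D_perturb subspace_diff[OF V]) auto
      ultimately show ?thesis by simp
    qed
    have "f y' \<le> f y + s \<bullet> (y' - y) + D (y - x) - D (y' - x)"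
    proof (rule field_le_epsilon)
      fix e :: real assume "0 < e"
      from liminf(2)[OF this] have "\<forall>\<^sub>F k in sequentially. f y' - e \<le> ?u k"
        by eventually_elim (use upper order_trans in blast)
      from tendsto_lowerbound[OF ulim this]
      show "f y' \<le> f y + s \<bullet> (y' - y) + D (y - x) - D (y' - x) + e" by simp
    qed
    then have "y' = y"
      using y liminf(1) by (intro minimizer_unique[OF f xs(2) y(1) _ y(2)]) (auto simp: inner_diff_right)
    then show "\<exists>r'. strict_mono r' \<and> (\<lambda>k. ys (r (r' k))) \<longlonglongrightarrow> y" using r' lim by (auto simp: q_def)
  qed
qed

section \<open>The hardening energies and their Gamma-limits\<close>

lemma hardening_admissible:
  assumes pen: "penalty_fun c3 \<phi>" and c3: "0 < c3" and c1: "0 \<le> c1" and \<rho>: "0 \<le> \<rho>"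
  shows "admissible_energy (hardening_domain V c3 \<rho>) (reg_hardening c1 c \<phi> \<rho>)"
  unfolding admissible_energy_def
proof (intro conjI ballI)
  show "hardening_domain V c3 \<rho> \<subseteq> V" by (auto simp: hardening_domain_def)
  show "0 \<in> hardening_domain V c3 \<rho>" using c3 subspace_0[OF V] by (simp add: hardening_domain_def)
  show "reg_hardening c1 c \<phi> \<rho> (0::'a) = 0"
    using \<rho> penalty_zero_iff[OF pen c3, of 0] c3 by (simp add: reg_hardening_def)
  show "0 \<le> reg_hardening c1 c \<phi> \<rho> x" for x :: 'a
  proof -
    have "\<rho> \<le> sqrt (\<rho>\<^sup>2 + (norm x)\<^sup>2)" by (rule real_le_rsqrt) simp
    then show ?thesis
      unfolding reg_hardening_def using c1 c_pos \<rho> penalty_nonneg[OF pen c3, of "norm x"]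
      by (intro add_nonneg_nonneg mult_nonneg_nonneg divide_nonneg_nonneg) auto
  qed
  have "convex (hardening_domain V c3 \<rho>)"
    using subspace_imp_convex[OF V] by (cases "\<rho> = 0") (auto simp: hardening_domain_0 intro: convex_Int)
  then show "convex_on (hardening_domain V c3 \<rho>) (\<lambda>x. reg_hardening c1 c \<phi> \<rho> x - c * (norm x)\<^sup>2)"
    by (rule reg_hardening_minus_quadratic_convex[OF pen c3 c1 \<rho>])
qed

lemma hardening_gamma_constant:
  assumes pen: "penalty_fun c3 \<phi>" and c3: "0 < c3"
  shows "gamma_converges (\<lambda>_. hardening_domain V c3 \<rho>) (\<lambda>_. reg_hardening c1 c \<phi> \<rho>)
    (hardening_domain V c3 \<rho>) (reg_hardening c1 c \<phi> \<rho>)"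
  unfolding gamma_converges_def
proof (intro conjI allI impI ballI)
  let ?K = "hardening_domain V c3 \<rho>" and ?f = "reg_hardening c1 c \<phi> \<rho> :: 'a \<Rightarrow> real"
  fix r :: "nat \<Rightarrow> nat" and xs x B
  assume xs: "\<forall>k. xs k \<in> ?K \<and> ?f (xs k) \<le> B" "xs \<longlonglongrightarrow> x"
  show "x \<in> ?K" using closed_sequentially[OF closed_hardening_domain[OF V]] xs by blast
  fix e :: real assume e: "0 < e"
  have "(\<lambda>k. ?f (xs k)) \<longlonglongrightarrow> ?f x"
    by (rule continuous_on_tendsto_compose[OF continuous_reg_hardening[OF pen c3, of UNIV] xs(2)]) auto
  then have "\<forall>\<^sub>F k in sequentially. ?f x - e < ?f (xs k)" using e by (intro order_tendstoD) auto
  then show "\<forall>\<^sub>F k in sequentially. ?f x - e \<le> ?f (xs k)" by eventually_elim simp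
qed auto

text \<open>Points of the ball have zero penalty for every \<open>\<rho>\<close>, so they recover
  themselves. Conversely an energy bound \<open>B\<close> forces
  \<open>\<phi> (norm (xs k)) <= B * \<rho>\<close>, so the limit lies in the zero set of the
  penalty. The lower bound follows by dropping the nonnegative penalty.\<close>

lemma hardening_gamma_vanishing:
  assumes pen: "penalty_fun c3 \<phi>" and c3: "0 < c3" and c1: "0 \<le> c1" and \<rho>s: "\<And>k. 0 \<le> \<rho>s k" "\<rho>s \<longlonglongrightarrow> 0"
  shows "gamma_converges (\<lambda>k. hardening_domain V c3 (\<rho>s k)) (\<lambda>k. reg_hardening c1 c \<phi> (\<rho>s k))
    (hardening_domain V c3 0) (reg_hardening c1 c \<phi> 0)"
  unfolding gamma_converges_def
proof (intro conjI allI impI ballI)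
  fix x :: 'a assume x: "x \<in> hardening_domain V c3 0"
  then have nx: "norm x \<le> c3" by (simp add: hardening_domain_def)
  show "x \<in> hardening_domain V c3 (\<rho>s k)" for k using x by (auto simp: hardening_domain_def)
  have eq: "reg_hardening c1 c \<phi> (\<rho>s k) x = c1 * (sqrt ((\<rho>s k)\<^sup>2 + (norm x)\<^sup>2) - \<rho>s k) + c * (norm x)\<^sup>2" for k
    using penalty_zero_iff[OF pen c3, of "norm x"] nx by (simp add: reg_hardening_def)
  have "(\<lambda>k. c1 * (sqrt ((\<rho>s k)\<^sup>2 + (norm x)\<^sup>2) - \<rho>s k) + c * (norm x)\<^sup>2)
      \<longlonglongrightarrow> c1 * (sqrt (0\<^sup>2 + (norm x)\<^sup>2) - 0) + c * (norm x)\<^sup>2"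
    by (intro tendsto_intros \<rho>s)
  then show "(\<lambda>k. reg_hardening c1 c \<phi> (\<rho>s k) x) \<longlonglongrightarrow> reg_hardening c1 c \<phi> 0 x"
    unfolding eq by (simp add: reg_hardening_def)
next
  fix r :: "nat \<Rightarrow> nat" and xs :: "nat \<Rightarrow> 'a" and x B
  assume r: "strict_mono r"
    and xs: "\<forall>k. xs k \<in> hardening_domain V c3 (\<rho>s (r k)) \<and> reg_hardening c1 c \<phi> (\<rho>s (r k)) (xs k) \<le> B" "xs \<longlonglongrightarrow> x"
  have \<rho>r: "(\<lambda>k. \<rho>s (r k)) \<longlonglongrightarrow> 0" using LIMSEQ_subseq_LIMSEQ[OF \<rho>s(2) r] by (simp add: o_def)
  let ?l = "\<lambda>k. c1 * (sqrt ((\<rho>s (r k))\<^sup>2 + (norm (xs k))\<^sup>2) - \<rho>s (r k)) + c * (norm (xs k))\<^sup>2"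
  have l0: "0 \<le> ?l k" for k
  proof -
    have "\<rho>s (r k) \<le> sqrt ((\<rho>s (r k))\<^sup>2 + (norm (xs k))\<^sup>2)" by (rule real_le_rsqrt) simp
    then show ?thesis using c1 c_pos by simp
  qed
  have lf: "?l k + \<phi> (norm (xs k)) / \<rho>s (r k) = reg_hardening c1 c \<phi> (\<rho>s (r k)) (xs k)" for k
    by (simp add: reg_hardening_def)
  \<comment> \<open>A null sequence of parameters may contain zeros; there the penalty is controlled
    by the domain and not by the energy.\<close>
  have \<phi>B: "\<phi> (norm (xs k)) \<le> B * \<rho>s (r k)" for k
  proof (cases "\<rho>s (r k) = 0")
    case True
    then have "norm (xs k) \<le> c3" using xs(1) by (auto simp: hardening_domain_def)
    then show ?thesis using True penalty_zero_iff[OF pen c3, of "norm (xs k)"] by simp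
  next
    case False
    then have pos: "0 < \<rho>s (r k)" using \<rho>s(1)[of "r k"] by simp
    have "\<phi> (norm (xs k)) / \<rho>s (r k) \<le> B" using l0[of k] lf[of k] xs(1) by (smt (verit))
    then show ?thesis using pos by (simp add: divide_le_eq)
  qed
  have xsV: "xs k \<in> V" for k using xs(1) by (auto simp: hardening_domain_def)
  have xV: "x \<in> V" using closed_sequentially[OF closed_subspace[OF V] xsV xs(2)] .
  have "(\<lambda>k. \<phi> (norm (xs k))) \<longlonglongrightarrow> \<phi> (norm x)"
    by (rule continuous_on_tendsto_compose[OF continuous_penalty[OF pen c3, of UNIV] tendsto_norm[OF xs(2)]]) auto
  moreover have "(\<lambda>k. B * \<rho>s (r k)) \<longlonglongrightarrow> B * 0" by (intro tendsto_intros \<rho>r)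
  ultimately have "\<phi> (norm x) \<le> B * 0" using \<phi>B by (intro LIMSEQ_le) auto
  then have "\<phi> (norm x) = 0" using penalty_nonneg[OF pen c3, of "norm x"] by simp
  then have "norm x \<le> c3" using penalty_zero_iff[OF pen c3] by blast
  then show "x \<in> hardening_domain V c3 0" using xV by (simp add: hardening_domain_def)
  fix e :: real assume e: "0 < e"
  have "?l \<longlonglongrightarrow> c1 * (sqrt (0\<^sup>2 + (norm x)\<^sup>2) - 0) + c * (norm x)\<^sup>2"
    by (intro tendsto_intros \<rho>r xs(2))
  then have "\<forall>\<^sub>F k in sequentially. reg_hardening c1 c \<phi> 0 x - e < ?l k"
    using e by (intro order_tendstoD) (auto simp: reg_hardening_def)
  then show "\<forall>\<^sub>F k in sequentially. reg_hardening c1 c \<phi> 0 x - e \<le> reg_hardening c1 c \<phi> (\<rho>s (r k)) (xs k)"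
  proof eventually_elim
    case (elim k)
    have "0 \<le> \<phi> (norm (xs k)) / \<rho>s (r k)" using penalty_nonneg[OF pen c3] \<rho>s(1) by simp
    then show ?case using elim lf[of k] by linarith
  qed
qed

end

section \<open>Elimination of the strain\<close>

lemma subspace_Sym3: "subspace Sym3"
  unfolding subspace_def Sym3_def by (auto simp: transpose_def vec_eq_iff)

lemma subspace_Dev3: "subspace Dev3"
  using subspace_Sym3 unfolding subspace_def Dev3_def
  by (auto simp: trace_def sum.distrib scaleR_right.sum[symmetric] simp flip: sum_distrib_left)

lemma Dev3_subset_Sym3: "Dev3 \<subseteq> Sym3"
  by (auto simp: Dev3_def)

lemma elastic_tensorD:
  assumes "elastic_tensor C"
  shows "a \<in> Sym3 \<Longrightarrow> C a \<in> Sym3" "\<lbrakk>a \<in> Sym3; b \<in> Sym3\<rbrakk> \<Longrightarrow> C (a + b) = C a + C b"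
    "a \<in> Sym3 \<Longrightarrow> C (r *\<^sub>R a) = r *\<^sub>R C a" "\<lbrakk>a \<in> Sym3; b \<in> Sym3\<rbrakk> \<Longrightarrow> C a \<bullet> b = a \<bullet> C b"
    "\<lbrakk>a \<in> Sym3; a \<noteq> 0\<rbrakk> \<Longrightarrow> 0 < C a \<bullet> a"
  using assms unfolding elastic_tensor_def by auto

text \<open>As \<open>C\<close> is given on \<open>Sym3\<close> only, it is extended by the identity
  on the skew part. The extension \<open>E\<close> is linear and injective on all matrices, hence
  invertible, and \<open>A\<close> is its inverse.\<close>

lemma compliance_exists:
  assumes "elastic_tensor C"
  obtains A where "bounded_linear A" "\<And>s. s \<in> Sym3 \<Longrightarrow> A s \<in> Sym3" "\<And>s. s \<in> Sym3 \<Longrightarrow> C (A s) = s"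
    "\<And>s t. \<lbrakk>s \<in> Sym3; t \<in> Sym3\<rbrakk> \<Longrightarrow> A s \<bullet> t = s \<bullet> A t"
proof -
  note C = elastic_tensorD[OF assms]
  define S :: "mat3 \<Rightarrow> mat3" where "S x = (1/2) *\<^sub>R (x + transpose x)" for x
  have tr: "transpose (x + y) = transpose x + transpose y" "transpose (r *\<^sub>R x) = r *\<^sub>R transpose x" for x y :: mat3 and r
    by (auto simp: transpose_def vec_eq_iff)
  have S_in: "S x \<in> Sym3" for x by (simp add: S_def Sym3_def tr add.commute)
  have S_add: "S (x + y) = S x + S y" and S_scale: "S (r *\<^sub>R x) = r *\<^sub>R S x" for x y r
    by (auto simp: S_def tr algebra_simps)
  have S_id: "S x = x" if "x \<in> Sym3" for x
    using that by (simp add: S_def Sym3_def)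
  define E where "E x = C (S x) + (x - S x)" for x
  have lin: "linear E"
    by (rule linearI) (auto simp: E_def S_add S_scale C(2)[OF S_in S_in] C(3)[OF S_in] algebra_simps)
  have SE: "S (E x) = C (S x)" for x
  proof -
    have "S (x - S x) = S (x + (-1) *\<^sub>R S x)" by simp
    also have "\<dots> = 0" unfolding S_add S_scale S_id[OF S_in] by simp
    finally show ?thesis using S_add S_id[OF C(1)[OF S_in]] by (simp add: E_def)
  qed
  have "inj E"
    unfolding linear_injective_0[OF lin]
  proof (intro allI impI)
    fix x assume x: "E x = 0"
    have "C (S x) = S 0" using SE[of x] x by simp
    also have "S 0 = 0" using S_scale[of 0 0] by simp
    finally have "S x = 0" using C(5)[OF S_in, of x] by fastforce
    then show "x = 0" using x \<open>C (S x) = S 0\<close> \<open>S 0 = 0\<close> by (simp add: E_def)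
  qed
  then obtain A where A: "linear A" "\<And>x. A (E x) = x" "\<And>x. E (A x) = x"
    using linear_injective_isomorphism[OF lin] by metis
  have Asym: "A s \<in> Sym3" and CA: "C (A s) = s" if s: "s \<in> Sym3" for s
  proof -
    have "S (E (A s)) = C (S (A s))" by (rule SE)
    then have 1: "C (S (A s)) = s" using A(3) S_id[OF s] by simp
    have "E (A s) = s" by (rule A(3))
    then have "A s = S (A s)" using 1 by (simp add: E_def)
    then show "A s \<in> Sym3" "C (A s) = s" using S_in[of "A s"] 1 by auto
  qed
  show ?thesis
  proof (rule that[of A])
    show "bounded_linear A" using A(1) by (simp add: linear_conv_bounded_linear)
    fix s t assume st: "s \<in> Sym3" "t \<in> Sym3"
    show "A s \<bullet> t = s \<bullet> A t" using C(4)[OF Asym[OF st(1)] Asym[OF st(2)]] CA st by simp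
  qed (use Asym CA in auto)
qed

text \<open>Any partition of \<open>[0, s]\<close> is extended by the node \<open>t\<close>. This
  half of additivity extracts the two-point inequality from two energy balances that both start at
  0.\<close>

lemma total_dissipation_append:
  assumes "s < t"
  shows "total_dissipation D z 0 s + ereal (D (z t - z s)) \<le> total_dissipation D z 0 t"
proof -
  have "total_dissipation D z 0 s \<le> total_dissipation D z 0 t - ereal (D (z t - z s))"
    unfolding total_dissipation_def[of D z 0 s]
  proof (rule SUP_least, clarify)
    fix n p assume p: "partition_on_interval 0 s n p"
    define q where "q i = (if i \<le> n then p i else t)" for i
    have q: "partition_on_interval 0 t (Suc n) q"
      using p assms by (auto simp: partition_on_interval_def q_def less_Suc_eq)
    have "(\<Sum>i<Suc n. D (z (q (Suc i)) - z (q i))) = (\<Sum>i<n. D (z (p (Suc i)) - z (p i))) + D (z t - z s)"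
      using p by (simp add: q_def partition_on_interval_def)
    moreover have "ereal (\<Sum>i<Suc n. D (z (q (Suc i)) - z (q i))) \<le> total_dissipation D z 0 t"
      unfolding total_dissipation_def using q by (intro SUP_upper2[of "(Suc n, q)"]) auto
    ultimately have "ereal (\<Sum>i<n. D (z (p (Suc i)) - z (p i))) + ereal (D (z t - z s)) \<le> total_dissipation D z 0 t"
      by simp
    then show "ereal (\<Sum>i<n. D (z (p (Suc i)) - z (p i))) \<le> total_dissipation D z 0 t - ereal (D (z t - z s))"
      by (simp add: ereal_le_minus_iff)
  qed
  then show ?thesis by (simp add: ereal_le_minus_iff)
qed

locale elastoplastic =
  rate_independent T \<sigma> \<sigma>' Dev3 D L c
  for T :: real and \<sigma> \<sigma>' :: "real \<Rightarrow> mat3" and D :: "mat3 \<Rightarrow> real" and L c :: real +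
  fixes C A :: "mat3 \<Rightarrow> mat3" and c1 c3 :: real and \<phi> :: "real \<Rightarrow> real"
  assumes elastic: "elastic_tensor C" and loading_sym: "t \<in> {0..T} \<Longrightarrow> \<sigma> t \<in> Sym3"
    and A_linear: "bounded_linear A" and A_sym: "s \<in> Sym3 \<Longrightarrow> A s \<in> Sym3" and C_A: "s \<in> Sym3 \<Longrightarrow> C (A s) = s"
    and A_selfadjoint: "\<lbrakk>s \<in> Sym3; s' \<in> Sym3\<rbrakk> \<Longrightarrow> A s \<bullet> s' = s \<bullet> A s'"
    and c1: "0 \<le> c1" and c3: "0 < c3" and pen: "penalty_fun c3 \<phi>"
begin

abbreviation W :: "real \<Rightarrow> mat3 \<Rightarrow> mat3 \<Rightarrow> ereal" where "W \<equiv> stored_energy C c1 c c3 \<phi>"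
abbreviation Z :: "real \<Rightarrow> mat3 set" where "Z \<equiv> hardening_domain Dev3 c3"
abbreviation F :: "real \<Rightarrow> mat3 \<Rightarrow> real" where "F \<equiv> reg_hardening c1 c \<phi>"

lemma C_quadratic_nonneg: "e \<in> Sym3 \<Longrightarrow> 0 \<le> C e \<bullet> e"
  and C_quadratic_eq_0: "\<lbrakk>e \<in> Sym3; C e \<bullet> e \<le> 0\<rbrakk> \<Longrightarrow> e = 0"
proof -
  have C0: "C 0 = 0"
    using elastic_tensorD(3)[OF elastic subspace_0[OF subspace_Sym3], of 0] by simp
  note pos = elastic_tensorD(5)[OF elastic]
  show "e \<in> Sym3 \<Longrightarrow> 0 \<le> C e \<bullet> e" using pos[of e] C0 by (cases "e = 0") auto
  show "\<lbrakk>e \<in> Sym3; C e \<bullet> e \<le> 0\<rbrakk> \<Longrightarrow> e = 0" using pos[of e] by fastforce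
qed

text \<open>The square vanishes at the optimal elastic strain \<open>A s\<close>; what it leaves
  behind depends on the stress alone.\<close>

lemma elastic_energy_complete_square:
  assumes e: "e \<in> Sym3" and s: "s \<in> Sym3"
  shows "1 / 2 * (C e \<bullet> e) - s \<bullet> e = 1 / 2 * (C (e - A s) \<bullet> (e - A s)) - 1 / 2 * (s \<bullet> A s)"
proof -
  have As: "A s \<in> Sym3" by (rule A_sym[OF s])
  have "C (e + (-1) *\<^sub>R A s) = C e + C ((-1) *\<^sub>R A s)" "C ((-1) *\<^sub>R A s) = (-1) *\<^sub>R C (A s)"
    by (rule elastic_tensorD(2)[OF elastic e subspace_scale[OF subspace_Sym3 As]],
        rule elastic_tensorD(3)[OF elastic As])
  then have eq: "C (e - A s) = C e - s" using C_A[OF s] by simp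
  have CA: "C e \<bullet> A s = e \<bullet> s"
    using elastic_tensorD(4)[OF elastic e As] C_A[OF s] by simp
  show ?thesis unfolding eq by (simp add: inner_simps CA inner_commute[of e s] field_simps)
qed

lemma stored_energy_eq:
  assumes "\<epsilon> \<in> Sym3" "z \<in> Dev3" "s \<in> Sym3"
  shows "W \<rho> \<epsilon> z - ereal (s \<bullet> \<epsilon>) =
    (if z \<in> Z \<rho> then ereal (1 / 2 * (C (\<epsilon> - z - A s) \<bullet> (\<epsilon> - z - A s)) - 1 / 2 * (s \<bullet> A s) + (F \<rho> z - s \<bullet> z)) else \<infinity>)"
proof (cases "z \<in> Z \<rho>")
  case True
  have h: "hardening c1 c c3 \<phi> \<rho> z = ereal (F \<rho> z)"
    using True by (auto simp: hardening_def reg_hardening_def hardening_domain_def)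
  have e: "\<epsilon> - z \<in> Sym3" using assms Dev3_subset_Sym3 subspace_diff[OF subspace_Sym3] by blast
  have "s \<bullet> \<epsilon> = s \<bullet> (\<epsilon> - z) + s \<bullet> z" by (simp add: inner_diff_right)
  then show ?thesis
    using True elastic_energy_complete_square[OF e assms(3)] by (simp add: stored_energy_def h)
next
  case False
  then have "\<rho> = 0" "\<not> norm z \<le> c3" using assms by (auto simp: hardening_domain_def)
  then show ?thesis using False by (simp add: stored_energy_def hardening_def)
qed

text \<open>For a fixed plastic strain \<open>z'\<close> the choice \<open>z' + A s\<close> of the
  total strain removes the nonnegative square. The function \<open>g\<close> is arbitrary so that
  one reduction serves stability and the incremental steps.\<close>

lemma minimizes_iff:
  assumes mem: "\<epsilon> \<in> Sym3" "z \<in> Dev3" "s \<in> Sym3"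
  shows "(\<forall>\<epsilon>'\<in>Sym3. \<forall>z'\<in>Dev3. W \<rho> \<epsilon> z - ereal (s \<bullet> \<epsilon>) + ereal (g z) \<le> W \<rho> \<epsilon>' z' - ereal (s \<bullet> \<epsilon>') + ereal (g z'))
    \<longleftrightarrow> \<epsilon> = z + A s \<and> z \<in> Z \<rho> \<and> (\<forall>z'\<in>Z \<rho>. F \<rho> z - s \<bullet> z + g z \<le> F \<rho> z' - s \<bullet> z' + g z')"
    (is "?L \<longleftrightarrow> ?R")
proof
  have zA: "z' + A s \<in> Sym3" if "z' \<in> Dev3" for z'
    using that A_sym[OF mem(3)] Dev3_subset_Sym3 subspace_add[OF subspace_Sym3] by blast
  {
    assume L: ?L
    have 0: "0 \<in> Dev3" "0 \<in> Z \<rho>" "0 \<in> Sym3"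
      using subspace_0[OF subspace_Dev3] subspace_0[OF subspace_Sym3] c3 by (auto simp: hardening_domain_def)
    \<comment> \<open>Comparison with the zero state, whose energy is finite, excludes an infinite
      value.\<close>
    have z: "z \<in> Z \<rho>"
    proof (rule ccontr)
      assume "z \<notin> Z \<rho>"
      then show False using L[rule_format, OF 0(3,1)] stored_energy_eq[OF mem, of \<rho>] stored_energy_eq[OF 0(3,1) mem(3), of \<rho>] 0(2)
        by simp
    qed
    have e: "\<epsilon> - z - A s \<in> Sym3"
      using mem A_sym[OF mem(3)] Dev3_subset_Sym3 subspace_diff[OF subspace_Sym3] by blast
    have "C (\<epsilon> - z - A s) \<bullet> (\<epsilon> - z - A s) \<le> 0"
      using L[rule_format, OF zA[OF mem(2)] mem(2)] stored_energy_eq[OF mem, of \<rho>] stored_energy_eq[OF zA[OF mem(2)] mem(2,3), of \<rho>] z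
      by simp
    then have eq: "\<epsilon> - z - A s = 0" by (rule C_quadratic_eq_0[OF e])
    have "F \<rho> z - s \<bullet> z + g z \<le> F \<rho> z' - s \<bullet> z' + g z'" if z': "z' \<in> Z \<rho>" for z'
    proof -
      have z'D: "z' \<in> Dev3" using z' by (simp add: hardening_domain_def)
      show ?thesis
        using L[rule_format, OF zA[OF z'D] z'D] stored_energy_eq[OF mem, of \<rho>] stored_energy_eq[OF zA[OF z'D] z'D mem(3), of \<rho>] z z'
        unfolding eq by simp
    qed
    then show ?R using z eq by (simp add: algebra_simps)
  }
  assume R: ?R
  show ?L
  proof (intro ballI)
    fix \<epsilon>' z' assume e': "\<epsilon>' \<in> Sym3" and z': "z' \<in> Dev3"
    have e: "\<epsilon>' - z' - A s \<in> Sym3"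
      using e' z' A_sym[OF mem(3)] Dev3_subset_Sym3 subspace_diff[OF subspace_Sym3] by blast
    have "\<epsilon> - z - A s = 0" "z \<in> Z \<rho>" using R by auto
    then show "W \<rho> \<epsilon> z - ereal (s \<bullet> \<epsilon>) + ereal (g z) \<le> W \<rho> \<epsilon>' z' - ereal (s \<bullet> \<epsilon>') + ereal (g z')"
      using R stored_energy_eq[OF mem, of \<rho>] stored_energy_eq[OF e' z' mem(3), of \<rho>] C_quadratic_nonneg[OF e]
      by (cases "z' \<in> Z \<rho>") (auto simp: algebra_simps add_increasing2 intro: add_increasing)
  qed
qed

lemma stable_states_iff:
  assumes s: "s \<in> Sym3"
  shows "(\<epsilon>, z) \<in> stable_states (W \<rho>) D s \<longleftrightarrow> \<epsilon> = z + A s \<and> stable (Z \<rho>) (F \<rho>) s z"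
proof -
  have "z \<in> Dev3 \<Longrightarrow> z + A s \<in> Sym3"
    using A_sym[OF s] Dev3_subset_Sym3 subspace_add[OF subspace_Sym3] by blast
  moreover have "stable (Z \<rho>) (F \<rho>) s z \<Longrightarrow> z \<in> Dev3" by (simp add: stable_def hardening_domain_def)
  moreover have "(\<epsilon>, z) \<in> stable_states (W \<rho>) D s \<longleftrightarrow> \<epsilon> = z + A s \<and> stable (Z \<rho>) (F \<rho>) s z"
    if "\<epsilon> \<in> Sym3" "z \<in> Dev3"
    using minimizes_iff[OF that s, of \<rho> "\<lambda>z'. D (z' - z)"] that
    by (simp add: stable_states_def stable_def)
  ultimately show ?thesis by (auto simp: stable_states_def)
qed

lemma incremental_step_iff:
  assumes s: "s \<in> Sym3"
  shows "is_arg_min (\<lambda>(\<epsilon>', z'). W \<rho> \<epsilon>' z' - ereal (s \<bullet> \<epsilon>') + ereal (D (z' - z0))) (\<lambda>(\<epsilon>', z'). \<epsilon>' \<in> Sym3 \<and> z' \<in> Dev3) (\<epsilon>, z)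
    \<longleftrightarrow> \<epsilon> = z + A s \<and> z \<in> Z \<rho> \<and> (\<forall>z'\<in>Z \<rho>. F \<rho> z - s \<bullet> z + D (z - z0) \<le> F \<rho> z' - s \<bullet> z' + D (z' - z0))"
proof -
  have a: "z \<in> Dev3 \<Longrightarrow> z + A s \<in> Sym3"
    using A_sym[OF s] Dev3_subset_Sym3 subspace_add[OF subspace_Sym3] by blast
  have b: "z \<in> Z \<rho> \<Longrightarrow> z \<in> Dev3" by (simp add: hardening_domain_def)
  have L: "is_arg_min (\<lambda>(\<epsilon>', z'). W \<rho> \<epsilon>' z' - ereal (s \<bullet> \<epsilon>') + ereal (D (z' - z0))) (\<lambda>(\<epsilon>', z'). \<epsilon>' \<in> Sym3 \<and> z' \<in> Dev3) (\<epsilon>, z)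
    \<longleftrightarrow> (\<epsilon> \<in> Sym3 \<and> z \<in> Dev3) \<and> (\<forall>\<epsilon>'\<in>Sym3. \<forall>z'\<in>Dev3. W \<rho> \<epsilon> z - ereal (s \<bullet> \<epsilon>) + ereal (D (z - z0))
        \<le> W \<rho> \<epsilon>' z' - ereal (s \<bullet> \<epsilon>') + ereal (D (z' - z0)))"
    unfolding is_arg_min_linorder split_paired_All prod.case by blast
  show ?thesis
  proof (cases "\<epsilon> \<in> Sym3 \<and> z \<in> Dev3")
    case True
    then have m: "\<epsilon> \<in> Sym3" "z \<in> Dev3" by auto
    show ?thesis unfolding L minimizes_iff[OF m s, of \<rho> "\<lambda>z'. D (z' - z0)"] using m by blast
  next
    case False
    then show ?thesis unfolding L using a b by blast
  qed
qed

lemma admissible: "0 \<le> \<rho> \<Longrightarrow> admissible_energy (Z \<rho>) (F \<rho>)"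
  by (rule hardening_admissible[OF pen c3 c1])

text \<open>The work of the elastic strain is the increment of
  \<open>\<sigma> \<bullet> A \<sigma> / 2\<close>, which in the energy balance cancels the constant
  split off by completing the square.\<close>

lemma elastic_work:
  assumes int: "(\<lambda>r. \<sigma>' r \<bullet> z r) integrable_on {0..T}" and \<epsilon>: "\<And>t. t \<in> {0..T} \<Longrightarrow> \<epsilon> t = z t + A (\<sigma> t)" and t: "t \<in> {0..T}"
  shows "integral {0..t} (\<lambda>r. \<sigma>' r \<bullet> \<epsilon> r) = integral {0..t} (\<lambda>r. \<sigma>' r \<bullet> z r) + (\<sigma> t \<bullet> A (\<sigma> t) - \<sigma> 0 \<bullet> A (\<sigma> 0)) / 2"
proof -
  interpret A: bounded_linear A by (rule A_linear)
  have A: "(\<lambda>r. \<sigma>' r \<bullet> A (\<sigma> r)) integrable_on {0..T}"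
    using integral_product_bounded[OF A.continuous_on[OF continuous_loading]] by (simp add: absolutely_integrable_on_def)
  have sub: "{0..t} \<subseteq> {0..T}" using t by auto
  have "integral {0..t} (\<lambda>r. \<sigma>' r \<bullet> \<epsilon> r) = integral {0..t} (\<lambda>r. \<sigma>' r \<bullet> z r + \<sigma>' r \<bullet> A (\<sigma> r))"
    using \<epsilon> t by (intro integral_cong) (auto simp: inner_add_right)
  also have "\<dots> = integral {0..t} (\<lambda>r. \<sigma>' r \<bullet> z r) + integral {0..t} (\<lambda>r. \<sigma>' r \<bullet> A (\<sigma> r))"
    by (intro Henstock_Kurzweil_Integration.integral_add integrable_subinterval_real[OF int sub] integrable_subinterval_real[OF A sub])
  also have "integral {0..t} (\<lambda>r. \<sigma>' r \<bullet> A (\<sigma> r)) = (\<sigma> t \<bullet> A (\<sigma> t) - \<sigma> 0 \<bullet> A (\<sigma> 0)) / 2"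
    using A_selfadjoint loading_sym by (intro integral_quadratic[OF A_linear _ t]) auto
  finally show ?thesis .
qed

lemma energy_balance_iff:
  assumes int: "(\<lambda>r. \<sigma>' r \<bullet> z r) integrable_on {0..T}" and \<epsilon>: "\<And>t. t \<in> {0..T} \<Longrightarrow> \<epsilon> t = z t + A (\<sigma> t)"
    and z: "\<And>t. t \<in> {0..T} \<Longrightarrow> z t \<in> Z \<rho>" and t: "t \<in> {0..T}"
  shows "W \<rho> (\<epsilon> t) (z t) - ereal (\<sigma> t \<bullet> \<epsilon> t) + total_dissipation D z 0 t
      = W \<rho> (\<epsilon> 0) (z 0) - ereal (\<sigma> 0 \<bullet> \<epsilon> 0) - ereal (integral {0..t} (\<lambda>s. \<sigma>' s \<bullet> \<epsilon> s))
    \<longleftrightarrow> total_dissipation D z 0 t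
      = ereal (F \<rho> (z 0) - \<sigma> 0 \<bullet> z 0 - (F \<rho> (z t) - \<sigma> t \<bullet> z t) - integral {0..t} (\<lambda>r. \<sigma>' r \<bullet> z r))"
proof -
  have W: "W \<rho> (\<epsilon> u) (z u) - ereal (\<sigma> u \<bullet> \<epsilon> u) = ereal (F \<rho> (z u) - \<sigma> u \<bullet> z u - 1 / 2 * (\<sigma> u \<bullet> A (\<sigma> u)))"
    if u: "u \<in> {0..T}" for u
  proof -
    have D: "z u \<in> Dev3" using z[OF u] by (simp add: hardening_domain_def)
    have "\<epsilon> u \<in> Sym3" unfolding \<epsilon>[OF u]
      using D A_sym[OF loading_sym[OF u]] Dev3_subset_Sym3 subspace_add[OF subspace_Sym3] by blast
    from stored_energy_eq[OF this D loading_sym[OF u], of \<rho>] show ?thesis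
      using z[OF u] \<epsilon>[OF u] by simp
  qed
  have 0: "0 \<in> {0..T}" using T_pos by simp
  have work: "integral {0..t} (\<lambda>s. \<sigma>' s \<bullet> \<epsilon> s)
      = integral {0..t} (\<lambda>s. \<sigma>' s \<bullet> z s) + (\<sigma> t \<bullet> A (\<sigma> t) - \<sigma> 0 \<bullet> A (\<sigma> 0)) / 2"
    by (rule elastic_work[of z \<epsilon> t, OF int \<epsilon> t])
  \<comment> \<open>The dissipation is extended real, so finite and infinite values are rearranged
    separately.\<close>
  show ?thesis unfolding W[OF t] W[OF 0] work
    by (cases "total_dissipation D z 0 t") (auto simp: field_simps)
qed

lemma evolution_abs_integrable:
  assumes \<rho>: "0 \<le> \<rho>" and ev: "evolution (Z \<rho>) (F \<rho>) \<theta> z" and \<epsilon>: "\<And>t. t \<in> {0..T} \<Longrightarrow> \<epsilon> t = z t + A (\<sigma> t)"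
  shows "(\<lambda>s. \<sigma>' s \<bullet> \<epsilon> s) absolutely_integrable_on {0..T}"
proof -
  interpret A: bounded_linear A by (rule A_linear)
  have "(\<lambda>r. \<sigma>' r \<bullet> z r) absolutely_integrable_on {0..T}"
  proof (rule absolutely_integrable_integrable_bound[OF _ evolutionD(6)[OF ev]])
    show "(\<lambda>r. norm (\<sigma>' r) * state_bound) integrable_on {0..T}"
      by (intro integrable_on_mult_left norm_int) auto
    fix r assume r: "r \<in> {0..T}"
    have "norm (\<sigma>' r \<bullet> z r) \<le> norm (\<sigma>' r) * norm (z r)" by (simp add: Cauchy_Schwarz_ineq2)
    also have "\<dots> \<le> norm (\<sigma>' r) * state_bound"
      by (intro mult_left_mono evolution_bounded(1)[OF admissible[OF \<rho>] ev r]) auto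
    finally show "norm (\<sigma>' r \<bullet> z r) \<le> norm (\<sigma>' r) * state_bound" .
  qed
  from set_integral_add(1)[OF this integral_product_bounded[OF A.continuous_on[OF continuous_loading]]]
  show ?thesis
    by (rule absolutely_integrable_spike[of _ _ "{}"]) (use \<epsilon> in \<open>auto simp: inner_add_right\<close>)
qed

text \<open>Forwards, the difference of two balances with \<open>total_dissipation_append\<close>
  gives the two-point inequality. Backwards, \<open>evolution_dissipation\<close> recovers the
  balance.\<close>

lemma energetic_solution_iff:
  assumes \<rho>: "0 \<le> \<rho>"
  shows "energetic_solution (W \<rho>) D T \<sigma> \<sigma>' \<epsilon>0 z0 \<epsilon> z \<longleftrightarrow>
    \<epsilon> 0 = \<epsilon>0 \<and> z 0 = z0 \<and> (\<forall>t\<in>{0..T}. \<epsilon> t = z t + A (\<sigma> t)) \<and> evolution (Z \<rho>) (F \<rho>) (\<lambda>t. t) z"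
    (is "?L \<longleftrightarrow> ?R")
proof
  interpret A: bounded_linear A by (rule A_linear)
  assume L: ?L
  then have init: "\<epsilon> 0 = \<epsilon>0" "z 0 = z0"
    and ai: "(\<lambda>s. \<sigma>' s \<bullet> \<epsilon> s) absolutely_integrable_on {0..T}"
    and st: "\<And>t. t \<in> {0..T} \<Longrightarrow> (\<epsilon> t, z t) \<in> stable_states (W \<rho>) D (\<sigma> t)"
    and bal: "\<And>t. t \<in> {0..T} \<Longrightarrow> W \<rho> (\<epsilon> t) (z t) - ereal (\<sigma> t \<bullet> \<epsilon> t) + total_dissipation D z 0 t
      = W \<rho> \<epsilon>0 z0 - ereal (\<sigma> 0 \<bullet> \<epsilon>0) - ereal (integral {0..t} (\<lambda>s. \<sigma>' s \<bullet> \<epsilon> s))"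
    unfolding energetic_solution_def by auto
  have \<epsilon>: "\<epsilon> t = z t + A (\<sigma> t)" and stz: "stable (Z \<rho>) (F \<rho>) (\<sigma> t) (z t)" if "t \<in> {0..T}" for t
    using st[OF that] stable_states_iff[OF loading_sym[OF that]] by auto
  have zd: "z t \<in> Z \<rho>" if "t \<in> {0..T}" for t using stz[OF that] by (simp add: stable_def)
  have "(\<lambda>r. \<sigma>' r \<bullet> \<epsilon> r - \<sigma>' r \<bullet> A (\<sigma> r)) integrable_on {0..T}"
    using ai integral_product_bounded[OF A.continuous_on[OF continuous_loading]]
    by (intro integrable_diff) (auto simp: absolutely_integrable_on_def)
  then have int: "(\<lambda>r. \<sigma>' r \<bullet> z r) integrable_on {0..T}"
    by (rule integrable_eq) (simp add: \<epsilon> inner_add_right)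
  have TD: "total_dissipation D z 0 t
      = ereal (F \<rho> (z 0) - \<sigma> 0 \<bullet> z 0 - (F \<rho> (z t) - \<sigma> t \<bullet> z t) - integral {0..t} (\<lambda>r. \<sigma>' r \<bullet> z r))"
    if "t \<in> {0..T}" for t
    using energy_balance_iff[OF int \<epsilon> zd that] bal[OF that] init by simp
  have two: "F \<rho> (z t) - \<sigma> t \<bullet> z t + D (z t - z s) + integral {s..t} (\<lambda>r. \<sigma>' r \<bullet> z r) \<le> F \<rho> (z s) - \<sigma> s \<bullet> z s"
    if st': "0 \<le> s" "s \<le> t" "t \<le> T" for s t
  proof (cases "s = t")
    case True
    then show ?thesis by simp
  next
    case False
    then have "s < t" using st' by simp
    from total_dissipation_append[OF this, of D z] show ?thesis
      using TD[of s] TD[of t] integral_split[OF int st'] st' by simp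
  qed
  have "evolution (Z \<rho>) (F \<rho>) (\<lambda>t. t) z"
    unfolding evolution_def using stz int two by (auto simp: mono_on_def)
  with init \<epsilon> show ?R by simp
next
  assume R: ?R
  then have init: "\<epsilon> 0 = \<epsilon>0" "z 0 = z0" and \<epsilon>: "\<And>t. t \<in> {0..T} \<Longrightarrow> \<epsilon> t = z t + A (\<sigma> t)"
    and ev: "evolution (Z \<rho>) (F \<rho>) (\<lambda>t. t) z" by auto
  have zd: "z t \<in> Z \<rho>" if "t \<in> {0..T}" for t by (rule evolution_bounded(3)[OF admissible[OF \<rho>] ev that])
  have TD: "total_dissipation D z 0 t
      = ereal (F \<rho> (z 0) - \<sigma> 0 \<bullet> z 0 - (F \<rho> (z t) - \<sigma> t \<bullet> z t) - integral {0..t} (\<lambda>r. \<sigma>' r \<bullet> z r))"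
    if "t \<in> {0..T}" for t
    unfolding total_dissipation_def by (rule evolution_dissipation[OF admissible[OF \<rho>] ev that])
  show ?L
    unfolding energetic_solution_def
  proof (intro conjI ballI init evolution_abs_integrable[OF \<rho> ev \<epsilon>])
    fix t assume t: "t \<in> {0..T}"
    show "(\<epsilon> t, z t) \<in> stable_states (W \<rho>) D (\<sigma> t)"
      using stable_states_iff[OF loading_sym[OF t]] evolutionD(5)[OF ev t] \<epsilon>[OF t] by simp
    show "W \<rho> (\<epsilon> t) (z t) - ereal (\<sigma> t \<bullet> \<epsilon> t) + total_dissipation D z 0 t
      = W \<rho> \<epsilon>0 z0 - ereal (\<sigma> 0 \<bullet> \<epsilon>0) - ereal (integral {0..t} (\<lambda>s. \<sigma>' s \<bullet> \<epsilon> s))"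
      using energy_balance_iff[OF evolutionD(6)[OF ev] \<epsilon> zd t] TD[OF t] init by simp
  qed
qed

end

section \<open>Convergence of solutions\<close>

context elastoplastic begin

text \<open>Index 0 is left free: the initial pair is prescribed, and in general it satisfies
  neither minimality nor the strain formula.\<close>

definition discrete_solution :: "real \<Rightarrow> nat \<Rightarrow> (nat \<Rightarrow> real) \<Rightarrow> (nat \<Rightarrow> mat3) \<Rightarrow> (nat \<Rightarrow> mat3) \<Rightarrow> bool" where
  "discrete_solution \<rho> n p e \<zeta> \<longleftrightarrow> (\<forall>i<n. e (Suc i) = \<zeta> (Suc i) + A (\<sigma> (p (Suc i))) \<and> \<zeta> (Suc i) \<in> Z \<rho> \<and>
     (\<forall>y\<in>Z \<rho>. F \<rho> (\<zeta> (Suc i)) - \<sigma> (p (Suc i)) \<bullet> \<zeta> (Suc i) + D (\<zeta> (Suc i) - \<zeta> i)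
      \<le> F \<rho> y - \<sigma> (p (Suc i)) \<bullet> y + D (y - \<zeta> i)))"

lemma discrete_solutionD:
  assumes "discrete_solution \<rho> n p e \<zeta>" "i < n"
  shows "e (Suc i) = \<zeta> (Suc i) + A (\<sigma> (p (Suc i)))" "\<zeta> (Suc i) \<in> Z \<rho>"
    "y \<in> Z \<rho> \<Longrightarrow> F \<rho> (\<zeta> (Suc i)) - \<sigma> (p (Suc i)) \<bullet> \<zeta> (Suc i) + D (\<zeta> (Suc i) - \<zeta> i)
      \<le> F \<rho> y - \<sigma> (p (Suc i)) \<bullet> y + D (y - \<zeta> i)"
  using assms unfolding discrete_solution_def by blast+

lemma incremental_solution_iff:
  assumes part: "partition_on_interval 0 T n p"
  shows "incremental_solution (W \<rho>) D \<sigma> \<epsilon>0 z0 n p \<epsilon> z \<longleftrightarrow>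
    (\<exists>e \<zeta>. e 0 = \<epsilon>0 \<and> \<zeta> 0 = z0 \<and> discrete_solution \<rho> n p e \<zeta> \<and>
      (\<forall>i<n. \<forall>t\<in>{p i..<p (Suc i)}. \<epsilon> t = e i \<and> z t = \<zeta> i) \<and> \<epsilon> (p n) = e n \<and> z (p n) = \<zeta> n)"
proof -
  have "\<sigma> (p (Suc i)) \<in> Sym3" if "i < n" for i
    using partition_on_interval_range[OF part, of "Suc i"] that by (intro loading_sym) auto
  note step = incremental_step_iff[OF this]
  have "(\<forall>i<n. is_arg_min
           (\<lambda>(\<epsilon>', z'). W \<rho> \<epsilon>' z' - ereal (\<sigma> (p (Suc i)) \<bullet> \<epsilon>') + ereal (D (z' - \<zeta> i)))
           (\<lambda>(\<epsilon>', z'). \<epsilon>' \<in> Sym3 \<and> z' \<in> Dev3) (e (Suc i), \<zeta> (Suc i))) \<longleftrightarrow> discrete_solution \<rho> n p e \<zeta>" for e \<zeta>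
    unfolding discrete_solution_def by (intro all_cong1 imp_cong refl step)
  then show ?thesis unfolding incremental_solution_def by (simp only:)
qed

text \<open>The initial state results from no minimization, so its stability is assumed; this also
  yields the strain formula on the first interval.\<close>

lemma incremental_solution_evolution:
  assumes \<rho>: "0 \<le> \<rho>" and \<tau>: "0 < \<tau>" and part: "partition_of_diameter T \<tau> n p"
    and sol: "incremental_solution (W \<rho>) D \<sigma> \<epsilon>0 z0 n p \<epsilon> z"
    and stab: "(\<epsilon>0, z0) \<in> stable_states (W \<rho>) D (\<sigma> 0)"
  obtains \<theta> where "evolution (Z \<rho>) (F \<rho>) \<theta> z" "\<And>t. t \<in> {0..T} \<Longrightarrow> \<epsilon> t = z t + A (\<sigma> (\<theta> t))"
    "\<And>t. t \<in> {0..T} \<Longrightarrow> t - \<tau> \<le> \<theta> t" "z 0 = z0"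
proof -
  have p: "partition_on_interval 0 T n p" and mx: "Max ((\<lambda>i. p (Suc i) - p i) ` {..<n}) = \<tau>"
    using part by (auto simp: partition_of_diameter_def)
  have p0: "p 0 = 0" and pn: "p n = T" and pS: "\<And>i. i < n \<Longrightarrow> p i < p (Suc i)"
    using p by (auto simp: partition_on_interval_def)
  obtain e \<zeta> where init: "e 0 = \<epsilon>0" "\<zeta> 0 = z0" and disc: "discrete_solution \<rho> n p e \<zeta>"
    and vals: "\<forall>i<n. \<forall>t\<in>{p i..<p (Suc i)}. \<epsilon> t = e i \<and> z t = \<zeta> i" "\<epsilon> (p n) = e n" "z (p n) = \<zeta> n"
    using sol unfolding incremental_solution_iff[OF p] by blast
  note steps = discrete_solutionD[OF disc]
  have 0: "0 \<in> {0..T}" using T_pos by simp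
  have st0: "\<epsilon>0 = z0 + A (\<sigma> 0)" "stable (Z \<rho>) (F \<rho>) (\<sigma> 0) (\<zeta> 0)"
    using stab stable_states_iff[OF loading_sym[OF 0]] init by auto
  have e\<zeta>: "e i = \<zeta> i + A (\<sigma> (p i))" if "i \<le> n" for i
    using that st0 init p0 steps(1) by (cases i) auto
  have zv: "z t = \<zeta> i" if "i < n" "t \<in> {p i..<p (Suc i)}" for i t using vals(1) that by blast
  obtain \<theta> where ev: "evolution (Z \<rho>) (F \<rho>) \<theta> z"
    and \<theta>: "\<And>t. t \<in> {0..T} \<Longrightarrow> \<exists>i\<le>n. \<theta> t = p i \<and> z t = \<zeta> i \<and> (i < n \<longrightarrow> t < p (Suc i))"
    using incremental_evolution[where K="Z \<rho>" and f="F \<rho>" and n=n and p=p and \<zeta>=\<zeta> and z=z, OF admissible[OF \<rho>] p st0(2) steps(2,3) zv vals(3)] by blast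
  show ?thesis
  proof (rule that[OF ev])
    have "n \<noteq> 0" using p0 pn T_pos by (intro notI) simp
    then show "z 0 = z0" using zv[of 0 0] pS[of 0] p0 init by simp
    fix t assume t: "t \<in> {0..T}"
    obtain i where i: "i \<le> n" "\<theta> t = p i" "z t = \<zeta> i" "i < n \<Longrightarrow> t < p (Suc i)" using \<theta>[OF t] by blast
    have le: "p i \<le> t" using evolutionD(2)[OF ev t] i(2) by simp
    have "\<epsilon> t = e i"
    proof (cases "i < n")
      case True
      then show ?thesis using vals(1) i(4) le by simp
    next
      case False
      then have "i = n" using i by simp
      moreover have "t = p n" using le pn t \<open>i = n\<close> by simp
      ultimately show ?thesis using vals(2) by simp
    qed
    then show "\<epsilon> t = z t + A (\<sigma> (\<theta> t))" using e\<zeta>[OF i(1)] i by simp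
    show "t - \<tau> \<le> \<theta> t"
    proof (cases "i < n")
      case True
      then have "p (Suc i) - p i \<le> \<tau>" unfolding mx[symmetric] by (intro Max_ge) auto
      then show ?thesis using i(2) i(4)[OF True] by simp
    next
      case False
      then have "i = n" using i by simp
      then show ?thesis using i(2) pn t \<tau> by simp
    qed
  qed
qed

lemma energies_gamma_converge:
  assumes "\<And>k. 0 \<le> \<rho>s k" "(\<forall>k. \<rho>s k = \<rho>) \<or> (\<rho>s \<longlonglongrightarrow> 0 \<and> \<rho> = 0)"
  shows "gamma_converges (\<lambda>k. Z (\<rho>s k)) (\<lambda>k. F (\<rho>s k)) (Z \<rho>) (F \<rho>)"
  using assms(2)
proof
  assume "\<forall>k. \<rho>s k = \<rho>"
  then show ?thesis using hardening_gamma_constant[OF pen c3, of \<rho> c1] by simp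
next
  assume "\<rho>s \<longlonglongrightarrow> 0 \<and> \<rho> = 0"
  then show ?thesis using hardening_gamma_vanishing[OF pen c3 c1 assms(1)] by simp
qed

text \<open>The steps \<open>\<tau>s k\<close> may vanish for some indices and not for others; both
  kinds of solutions are evolutions, with \<open>\<theta> = id\<close> for vanishing steps. The
  bounds \<open>t - \<tau>s k \<le> \<theta>s k t \<le> t\<close> give the convergence that
  compactness asks for.\<close>

lemma solutions_compact:
  assumes \<rho>: "0 \<le> \<rho>" and \<rho>s: "\<And>k. 0 \<le> \<rho>s k" "(\<forall>k. \<rho>s k = \<rho>) \<or> (\<rho>s \<longlonglongrightarrow> 0 \<and> \<rho> = 0)"
    and \<tau>s: "\<And>k. 0 \<le> \<tau>s k" "\<tau>s \<longlonglongrightarrow> 0"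
    and part: "\<And>k. \<tau>s k > 0 \<Longrightarrow> partition_of_diameter T (\<tau>s k) (N (\<tau>s k)) (p (\<tau>s k))"
    and stab: "\<And>k. (\<epsilon>0, z0) \<in> stable_states (W (\<rho>s k)) D (\<sigma> 0)"
    and sol: "\<And>k. solution W D T \<sigma> \<sigma>' \<epsilon>0 z0 N p (\<rho>s k) (\<tau>s k) (\<epsilon>s k) (zs k)"
  obtains r \<epsilon> z where "strict_mono (r :: nat \<Rightarrow> nat)" "energetic_solution (W \<rho>) D T \<sigma> \<sigma>' \<epsilon>0 z0 \<epsilon> z"
    "pointwise_limit_on {0..T} (\<epsilon>s \<circ> r) \<epsilon>" "pointwise_limit_on {0..T} (zs \<circ> r) z"
proof -
  interpret A: bounded_linear A by (rule A_linear)
  have 0: "0 \<in> {0..T}" using T_pos by simp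
  have "\<exists>\<theta>. evolution (Z (\<rho>s k)) (F (\<rho>s k)) \<theta> (zs k) \<and> (\<forall>t\<in>{0..T}. \<epsilon>s k t = zs k t + A (\<sigma> (\<theta> t))) \<and>
      (\<forall>t\<in>{0..T}. t - \<tau>s k \<le> \<theta> t) \<and> zs k 0 = z0" for k
  proof (cases "\<tau>s k > 0")
    case True
    then have "incremental_solution (W (\<rho>s k)) D \<sigma> \<epsilon>0 z0 (N (\<tau>s k)) (p (\<tau>s k)) (\<epsilon>s k) (zs k)"
      using sol[of k] by (simp add: solution_def)
    from incremental_solution_evolution[OF \<rho>s(1) True part[OF True] this stab] show ?thesis by metis
  next
    case False
    then have "energetic_solution (W (\<rho>s k)) D T \<sigma> \<sigma>' \<epsilon>0 z0 (\<epsilon>s k) (zs k)"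
      using sol[of k] by (simp add: solution_def)
    then show ?thesis
      unfolding energetic_solution_iff[OF \<rho>s(1)] using \<tau>s(1)[of k] by (intro exI[of _ "\<lambda>t. t"]) auto
  qed
  then obtain \<theta>s where ev: "\<And>k. evolution (Z (\<rho>s k)) (F (\<rho>s k)) (\<theta>s k) (zs k)"
    and \<epsilon>s: "\<And>k t. t \<in> {0..T} \<Longrightarrow> \<epsilon>s k t = zs k t + A (\<sigma> (\<theta>s k t))"
    and \<theta>s: "\<And>k t. t \<in> {0..T} \<Longrightarrow> t - \<tau>s k \<le> \<theta>s k t" and init: "\<And>k. zs k 0 = z0"
    by metis
  have \<theta>lim: "(\<lambda>k. \<theta>s k t) \<longlonglongrightarrow> t" if t: "t \<in> {0..T}" for t
  proof (rule real_tendsto_sandwich)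
    show "(\<lambda>k. t - \<tau>s k) \<longlonglongrightarrow> t" using tendsto_diff[OF tendsto_const \<tau>s(2), of t] by simp
    show "(\<lambda>_. t) \<longlonglongrightarrow> t" by (rule tendsto_const)
  qed (use \<theta>s[OF t] evolutionD(2)[OF ev t] in auto)
  obtain r z where r: "strict_mono (r :: nat \<Rightarrow> nat)" and z: "\<And>t. t \<in> {0..T} \<Longrightarrow> (\<lambda>k. zs (r k) t) \<longlonglongrightarrow> z t"
    using evolution_compactness[OF admissible[OF \<rho>s(1)] ev \<theta>lim] by blast
  have evz: "evolution (Z \<rho>) (F \<rho>) (\<lambda>t. t) z"
    by (rule evolution_limit[OF admissible[OF \<rho>s(1)] admissible[OF \<rho>] energies_gamma_converge[OF \<rho>s] r ev \<theta>lim z])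
  have z0: "z 0 = z0" using LIMSEQ_unique[OF z[OF 0]] init by simp
  have \<epsilon>0: "\<epsilon>0 = z0 + A (\<sigma> 0)" using stab[of 0] stable_states_iff[OF loading_sym[OF 0]] by simp
  show ?thesis
  proof (rule that[OF r])
    show "energetic_solution (W \<rho>) D T \<sigma> \<sigma>' \<epsilon>0 z0 (\<lambda>t. z t + A (\<sigma> t)) z"
      unfolding energetic_solution_iff[OF \<rho>] using evz z0 \<epsilon>0 by simp
    show "pointwise_limit_on {0..T} (zs \<circ> r) z" using z by (simp add: pointwise_limit_on_def)
    show "pointwise_limit_on {0..T} (\<epsilon>s \<circ> r) (\<lambda>t. z t + A (\<sigma> t))"
      unfolding pointwise_limit_on_def o_def
    proof
      fix t assume t: "t \<in> {0..T}"
      have "(\<lambda>k. \<sigma> (\<theta>s (r k) t)) \<longlonglongrightarrow> \<sigma> t"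
      proof (rule continuous_on_tendsto_compose[OF continuous_loading _ t])
        show "(\<lambda>k. \<theta>s (r k) t) \<longlonglongrightarrow> t" using LIMSEQ_subseq_LIMSEQ[OF \<theta>lim[OF t] r] by (simp add: o_def)
        have "\<theta>s (r k) t \<in> {0..T}" for k using evolutionD(1,2)[OF ev[of "r k"] t] t by simp
        then show "\<forall>\<^sub>F k in sequentially. \<theta>s (r k) t \<in> {0..T}" by simp
      qed
      then have "(\<lambda>k. zs (r k) t + A (\<sigma> (\<theta>s (r k) t))) \<longlonglongrightarrow> z t + A (\<sigma> t)"
        by (intro tendsto_add z t A.tendsto)
      then show "(\<lambda>k. \<epsilon>s (r k) t) \<longlonglongrightarrow> z t + A (\<sigma> t)" unfolding \<epsilon>s[OF t] .
    qed
  qed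
qed

lemma energetic_solution_unique:
  assumes \<rho>: "0 < \<rho>" and sol: "energetic_solution (W \<rho>) D T \<sigma> \<sigma>' \<epsilon>0 z0 \<epsilon> z" "energetic_solution (W \<rho>) D T \<sigma> \<sigma>' \<epsilon>0 z0 \<epsilon>' z'"
    and t: "t \<in> {0..T}"
  shows "\<epsilon> t = \<epsilon>' t" "z t = z' t"
proof -
  have \<rho>0: "0 \<le> \<rho>" using \<rho> by simp
  have Z: "Z \<rho> = Dev3" using \<rho> by simp
  note sol' = sol[unfolded energetic_solution_iff[OF \<rho>0] Z]
  have adm: "admissible_energy Dev3 (F \<rho>)" using admissible[OF \<rho>0] by (simp only: Z)
  obtain G where "smooth_energy (F \<rho>) G"
    using reg_hardening_smooth[OF pen c3 \<rho>, of c1 c] smooth_energyI[OF adm] by metis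
  then show "z t = z' t" using evolution_unique[OF adm] sol' t by metis
  then show "\<epsilon> t = \<epsilon>' t" using sol' t by simp
qed

text \<open>The partition is fixed, so finitely many minimization problems pass to the limit one
  after the other, each with convergent data from the step before. The strains follow because they
  differ from the plastic strains by a term independent of \<open>k\<close>.\<close>

lemma incremental_solution_limit:
  assumes \<rho>: "0 \<le> \<rho>" and \<rho>s: "\<And>k. 0 \<le> \<rho>s k" "(\<forall>k. \<rho>s k = \<rho>) \<or> (\<rho>s \<longlonglongrightarrow> 0 \<and> \<rho> = 0)"
    and p: "partition_on_interval 0 T n p" and z0: "z0 \<in> Dev3"
    and sols: "\<And>k. incremental_solution (W (\<rho>s k)) D \<sigma> \<epsilon>0 z0 n p (\<epsilon>s k) (zs k)"
    and sol: "incremental_solution (W \<rho>) D \<sigma> \<epsilon>0 z0 n p \<epsilon> z"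
  shows "pointwise_limit_on {0..T} \<epsilon>s \<epsilon>" "pointwise_limit_on {0..T} zs z"
proof -
  obtain e \<zeta> where init: "e 0 = \<epsilon>0" "\<zeta> 0 = z0" and disc: "discrete_solution \<rho> n p e \<zeta>"
    and vals: "\<forall>i<n. \<forall>t\<in>{p i..<p (Suc i)}. \<epsilon> t = e i \<and> z t = \<zeta> i" "\<epsilon> (p n) = e n" "z (p n) = \<zeta> n"
    using sol unfolding incremental_solution_iff[OF p] by blast
  note steps = discrete_solutionD[OF disc]
  have "\<exists>e \<zeta>. e 0 = \<epsilon>0 \<and> \<zeta> 0 = z0 \<and> discrete_solution (\<rho>s k) n p e \<zeta> \<and>
      (\<forall>i<n. \<forall>t\<in>{p i..<p (Suc i)}. \<epsilon>s k t = e i \<and> zs k t = \<zeta> i) \<and> \<epsilon>s k (p n) = e n \<and> zs k (p n) = \<zeta> n" for k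
    using sols[of k] unfolding incremental_solution_iff[OF p] .
  then obtain es \<zeta>s where sols': "\<And>k. es k 0 = \<epsilon>0 \<and> \<zeta>s k 0 = z0 \<and> discrete_solution (\<rho>s k) n p (es k) (\<zeta>s k) \<and>
      (\<forall>i<n. \<forall>t\<in>{p i..<p (Suc i)}. \<epsilon>s k t = es k i \<and> zs k t = \<zeta>s k i) \<and> \<epsilon>s k (p n) = es k n \<and> zs k (p n) = \<zeta>s k n"
    by metis
  have inits: "es k 0 = \<epsilon>0" "\<zeta>s k 0 = z0" and discs: "discrete_solution (\<rho>s k) n p (es k) (\<zeta>s k)"
    and valss: "\<forall>i<n. \<forall>t\<in>{p i..<p (Suc i)}. \<epsilon>s k t = es k i \<and> zs k t = \<zeta>s k i" "\<epsilon>s k (p n) = es k n" "zs k (p n) = \<zeta>s k n" for k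
    using sols'[of k] by blast+
  note stepss = discrete_solutionD[OF discs]
  have memV: "\<zeta> i \<in> Dev3" "\<zeta>s k i \<in> Dev3" if "i \<le> n" for i k
    using that init inits z0 steps(2) stepss(2) by (cases i; force simp: hardening_domain_def)+
  have lim: "(\<lambda>k. \<zeta>s k i) \<longlonglongrightarrow> \<zeta> i \<and> (\<lambda>k. es k i) \<longlonglongrightarrow> e i" if "i \<le> n" for i
    using that
  proof (induction i)
    case 0
    then show ?case using init inits by simp
  next
    case (Suc i)
    then have i: "i < n" by simp
    have 1: "(\<lambda>k. \<zeta>s k (Suc i)) \<longlonglongrightarrow> \<zeta> (Suc i)"
    proof (rule minimizer_limit[OF admissible[OF \<rho>s(1)] admissible[OF \<rho>] energies_gamma_converge[OF \<rho>s]])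
      show "\<zeta>s k i \<in> Dev3" "\<zeta> i \<in> Dev3" for k using memV[where i=i] i by auto
      show "(\<lambda>k. \<zeta>s k i) \<longlonglongrightarrow> \<zeta> i" using Suc i by simp
      show "\<zeta>s k (Suc i) \<in> Z (\<rho>s k)" "\<zeta> (Suc i) \<in> Z \<rho>" for k
        by (rule stepss(2)[OF i], rule steps(2)[OF i])
      show "F (\<rho>s k) (\<zeta>s k (Suc i)) - \<sigma> (p (Suc i)) \<bullet> \<zeta>s k (Suc i) + D (\<zeta>s k (Suc i) - \<zeta>s k i)
        \<le> F (\<rho>s k) y - \<sigma> (p (Suc i)) \<bullet> y + D (y - \<zeta>s k i)" if "y \<in> Z (\<rho>s k)" for k y
        by (rule stepss(3)[OF i that])
      show "F \<rho> (\<zeta> (Suc i)) - \<sigma> (p (Suc i)) \<bullet> \<zeta> (Suc i) + D (\<zeta> (Suc i) - \<zeta> i)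
        \<le> F \<rho> y - \<sigma> (p (Suc i)) \<bullet> y + D (y - \<zeta> i)" if "y \<in> Z \<rho>" for y
        by (rule steps(3)[OF i that])
    qed
    then have "(\<lambda>k. es k (Suc i)) \<longlonglongrightarrow> e (Suc i)"
      unfolding stepss(1)[OF i] steps(1)[OF i] by (intro tendsto_intros)
    with 1 show ?case by simp
  qed
  have "(\<lambda>k. \<epsilon>s k t) \<longlonglongrightarrow> \<epsilon> t \<and> (\<lambda>k. zs k t) \<longlonglongrightarrow> z t" if t: "t \<in> {0..T}" for t
  proof -
    obtain i where i: "i \<le> n" "p i \<le> t" "i < n \<Longrightarrow> t < p (Suc i)"
      using partition_index[OF p] t by metis
    show ?thesis
    proof (cases "i < n")
      case True
      then show ?thesis using lim[of i] vals(1) valss(1) i by simp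
    next
      case False
      then have "i = n" using i by simp
      moreover have "t = p n" using i t p \<open>i = n\<close> by (simp add: partition_on_interval_def)
      ultimately show ?thesis using lim[of n] vals(2,3) valss(2,3) by simp
    qed
  qed
  then show "pointwise_limit_on {0..T} \<epsilon>s \<epsilon>" "pointwise_limit_on {0..T} zs z"
    by (auto simp: pointwise_limit_on_def)
qed

text \<open>Stated for \<open>\<rho> = 0\<close>; when the parameters are constant, the given
  solutions already solve the limit problem.\<close>

lemma incremental_solution_exists:
  assumes p: "partition_on_interval 0 T n p" and z0: "z0 \<in> Dev3"
  obtains \<epsilon> z where "incremental_solution (W 0) D \<sigma> \<epsilon>0 z0 n p \<epsilon> z"
proof -
  have K: "compact (Z 0)" "0 \<in> Z 0" "Z 0 \<subseteq> Dev3"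
    using closed_subspace[OF V] subspace_0[OF V] c3 by (auto simp: hardening_domain_0 intro: closed_Int_compact)
  define P where "P i x y \<longleftrightarrow> y \<in> Z 0 \<and> (\<forall>w\<in>Z 0. F 0 y - \<sigma> (p (Suc i)) \<bullet> y + D (y - x) \<le> F 0 w - \<sigma> (p (Suc i)) \<bullet> w + D (w - x))" for i x y
  have ex: "\<exists>y. P i x y" if "x \<in> Dev3" for i x
    using minimizer_exists[OF K continuous_reg_hardening[OF pen c3] that] unfolding P_def by metis
  define \<zeta> where "\<zeta> = rec_nat z0 (\<lambda>i x. SOME y. P i x y)"
  have \<zeta>0: "\<zeta> 0 = z0" and \<zeta>S: "\<zeta> (Suc i) = (SOME y. P i (\<zeta> i) y)" for i by (simp_all add: \<zeta>_def)
  have "\<zeta> i \<in> Dev3 \<and> P i (\<zeta> i) (\<zeta> (Suc i))" for i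
  proof (induction i)
    case 0
    then show ?case using someI_ex[OF ex[OF z0, of 0]] z0 by (simp add: \<zeta>0 \<zeta>S)
  next
    case (Suc i)
    then have "\<zeta> (Suc i) \<in> Dev3" using K(3) by (auto simp: P_def)
    then show ?case using someI_ex[OF ex, of "\<zeta> (Suc i)" "Suc i"] by (simp add: \<zeta>S[of "Suc i"])
  qed
  then have \<zeta>: "P i (\<zeta> i) (\<zeta> (Suc i))" for i by blast
  define e where "e i = (if i = 0 then \<epsilon>0 else \<zeta> i + A (\<sigma> (p i)))" for i
  \<comment> \<open>Counting the right endpoints up to \<open>t\<close> gives \<open>i\<close> on
    \<open>[p i, p (Suc i))\<close> and \<open>n\<close> at the final time.\<close>
  define idx where "idx t = card {j. j < n \<and> p (Suc j) \<le> t}" for t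
  have idx: "idx t = i" if "i < n" "t \<in> {p i..<p (Suc i)}" for i t
  proof -
    have "{j. j < n \<and> p (Suc j) \<le> t} = {..<i}"
    proof (intro set_eqI iffI)
      fix j assume j: "j \<in> {j. j < n \<and> p (Suc j) \<le> t}"
      show "j \<in> {..<i}"
      proof (rule ccontr)
        assume "j \<notin> {..<i}"
        then have "p (Suc i) \<le> p (Suc j)" using j by (intro partition_on_interval_mono[OF p]) auto
        then show False using j that by simp
      qed
    next
      fix j assume "j \<in> {..<i}"
      then have "p (Suc j) \<le> p i" "j < n" using that by (auto intro!: partition_on_interval_mono[OF p])
      then show "j \<in> {j. j < n \<and> p (Suc j) \<le> t}" using that by simp
    qed
    then show ?thesis by (simp add: idx_def)
  qed
  have "{j. j < n \<and> p (Suc j) \<le> p n} = {..<n}" by (auto intro!: partition_on_interval_mono[OF p])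
  then have idxn: "idx (p n) = n" by (simp add: idx_def)
  have disc: "discrete_solution 0 n p e \<zeta>"
    unfolding discrete_solution_def using \<zeta> by (simp add: P_def e_def)
  have "incremental_solution (W 0) D \<sigma> \<epsilon>0 z0 n p (\<lambda>t. e (idx t)) (\<lambda>t. \<zeta> (idx t))"
    unfolding incremental_solution_iff[OF p]
    by (intro exI[of _ e] exI[of _ \<zeta>] conjI disc) (simp_all add: idx idxn e_def \<zeta>0)
  then show ?thesis by (rule that)
qed

end

theorem theorem7p3:
  fixes C :: "mat3 \<Rightarrow> mat3"
    and c1 c2 c3 :: real
    and \<phi> :: "real \<Rightarrow> real"
    and D :: "mat3 \<Rightarrow> real"
    and T :: real
    and \<sigma> \<sigma>' :: "real \<Rightarrow> mat3"
    and \<epsilon>0 z0 :: "mat3"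
    and N :: "real \<Rightarrow> nat"
    and p :: "real \<Rightarrow> nat \<Rightarrow> real"
    and \<rho>s \<tau>s :: "nat \<Rightarrow> real"
    and \<rho> \<tau> :: real
    and \<epsilon>s zs :: "nat \<Rightarrow> real \<Rightarrow> mat3"
  assumes "elastic_tensor C"
    and "c1 > 0" "c2 > 0" "c3 > 0"
    and "penalty_fun c3 \<phi>"
    and "dissipation_potential D"
    and "T > 0"
    and "W11_with_derivative T Sym3 \<sigma> \<sigma>'"
    and "\<epsilon>0 \<in> Sym3" "z0 \<in> Dev3"
    and "\<And>k. \<rho>s k \<ge> 0" "\<And>k. \<tau>s k \<ge> 0" "\<rho> \<ge> 0" "\<tau> \<ge> 0"
    and "\<rho>s \<longlonglongrightarrow> \<rho>" "\<tau>s \<longlonglongrightarrow> \<tau>"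
    and "constant_or_null \<rho>s" "constant_or_null \<tau>s"
    and "\<And>k. \<tau>s k > 0 \<Longrightarrow> partition_of_diameter T (\<tau>s k) (N (\<tau>s k)) (p (\<tau>s k))"
    and "\<tau> = 0 \<Longrightarrow>
           (\<forall>k. (\<epsilon>0, z0) \<in> stable_states (stored_energy C c1 c2 c3 \<phi> (\<rho>s k)) D (\<sigma> 0)) \<and>
           (\<epsilon>0, z0) \<in> stable_states (stored_energy C c1 c2 c3 \<phi> \<rho>) D (\<sigma> 0)"
    and "\<And>k. solution (stored_energy C c1 c2 c3 \<phi>) D T \<sigma> \<sigma>' \<epsilon>0 z0 N p (\<rho>s k) (\<tau>s k) (\<epsilon>s k) (zs k)"
  shows "((\<rho>, \<tau>) \<noteq> (0, 0) \<longrightarrow>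
           (\<exists>\<epsilon> z. solution (stored_energy C c1 c2 c3 \<phi>) D T \<sigma> \<sigma>' \<epsilon>0 z0 N p \<rho> \<tau> \<epsilon> z) \<and>
           (\<forall>\<epsilon> z. solution (stored_energy C c1 c2 c3 \<phi>) D T \<sigma> \<sigma>' \<epsilon>0 z0 N p \<rho> \<tau> \<epsilon> z \<longrightarrow>
              pointwise_limit_on {0..T} \<epsilon>s \<epsilon> \<and> pointwise_limit_on {0..T} zs z)) \<and>
         ((\<rho>, \<tau>) = (0, 0) \<longrightarrow>
           (\<exists>r \<epsilon> z. strict_mono r \<and>
              solution (stored_energy C c1 c2 c3 \<phi>) D T \<sigma> \<sigma>' \<epsilon>0 z0 N p 0 0 \<epsilon> z \<and>
              pointwise_limit_on {0..T} (\<epsilon>s \<circ> r) \<epsilon> \<and> pointwise_limit_on {0..T} (zs \<circ> r) z))"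
proof -
  note \<rho>s0 = assms(11) and \<tau>s0 = assms(12) and \<rho>0 = assms(13) and \<tau>0 = assms(14)
  note part = assms(19) and stab = assms(20) and sol = assms(21)
  have D: "\<And>a. a \<in> Dev3 \<Longrightarrow> 0 \<le> D a" "\<And>r a. \<lbrakk>0 \<le> r; a \<in> Dev3\<rbrakk> \<Longrightarrow> D (r *\<^sub>R a) = r * D a"
    "\<And>a b. \<lbrakk>a \<in> Dev3; b \<in> Dev3\<rbrakk> \<Longrightarrow> D (a + b) \<le> D a + D b"
    using assms(6) unfolding dissipation_potential_def by auto
  obtain L where L: "0 \<le> L" "\<And>a. a \<in> Dev3 \<Longrightarrow> D a \<le> L * norm a"
    using sublinear_le_norm[OF subspace_Dev3 D] by blast
  obtain A where A: "bounded_linear A" "\<And>s. s \<in> Sym3 \<Longrightarrow> A s \<in> Sym3" "\<And>s. s \<in> Sym3 \<Longrightarrow> C (A s) = s"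
    "\<And>s t. \<lbrakk>s \<in> Sym3; t \<in> Sym3\<rbrakk> \<Longrightarrow> A s \<bullet> t = s \<bullet> A t"
    using compliance_exists[OF assms(1)] by blast
  interpret elastoplastic T \<sigma> \<sigma>' D L c2 C A c1 c3 \<phi>
  proof (intro elastoplastic.intro rate_independent.intro loading.intro rate_independent_axioms.intro elastoplastic_axioms.intro)
    show "\<sigma>' absolutely_integrable_on {0..T}" "t \<in> {0..T} \<Longrightarrow> \<sigma> t \<in> Sym3" for t
      using assms(8) by (auto simp: W11_with_derivative_def)
    show "(\<sigma>' has_integral \<sigma> t - \<sigma> s) {s..t}" if "0 \<le> s" "s \<le> t" "t \<le> T" for s t
      by (rule W11_increment[OF assms(8,7) that])
  qed (use assms D L A subspace_Dev3 in auto)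
  have \<rho>cases: "(\<forall>k. \<rho>s k = \<rho>) \<or> (\<rho>s \<longlonglongrightarrow> 0 \<and> \<rho> = 0)"
  proof -
    from assms(17) consider c where "\<forall>k. \<rho>s k = c" | "\<rho>s \<longlonglongrightarrow> 0" unfolding constant_or_null_def by blast
    then show ?thesis
    proof cases
      case 1
      then have "\<rho>s \<longlonglongrightarrow> c" by (simp add: tendsto_eventually)
      then show ?thesis using LIMSEQ_unique[OF assms(15)] 1 by blast
    next
      case 2
      then show ?thesis using LIMSEQ_unique[OF assms(15)] by blast
    qed
  qed
  show ?thesis
  proof (cases "\<tau> = 0")
    case False
    then have \<tau>pos: "0 < \<tau>" using \<tau>0 by simp
    \<comment> \<open>A positive limit excludes a null sequence, so all solutions live on one
      partition.\<close>
    have \<tau>s: "\<tau>s k = \<tau>" for k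
    proof -
      have "\<not> \<tau>s \<longlonglongrightarrow> 0" using LIMSEQ_unique[OF assms(16)] False by blast
      then obtain c where c: "\<forall>k. \<tau>s k = c" using assms(18) unfolding constant_or_null_def by blast
      then have "\<tau>s \<longlonglongrightarrow> c" by (simp add: tendsto_eventually)
      then show ?thesis using LIMSEQ_unique[OF assms(16)] c by blast
    qed
    have p: "partition_on_interval 0 T (N \<tau>) (p \<tau>)"
      using part[of 0] \<tau>s \<tau>pos by (simp add: partition_of_diameter_def)
    have sols: "incremental_solution (W (\<rho>s k)) D \<sigma> \<epsilon>0 z0 (N \<tau>) (p \<tau>) (\<epsilon>s k) (zs k)" for k
      using sol[of k] \<tau>s \<tau>pos by (simp add: solution_def)
    have "\<exists>\<epsilon> z. incremental_solution (W \<rho>) D \<sigma> \<epsilon>0 z0 (N \<tau>) (p \<tau>) \<epsilon> z"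
      using \<rho>cases
    proof
      assume "\<forall>k. \<rho>s k = \<rho>"
      then show ?thesis using sols[of 0] by auto
    next
      assume "\<rho>s \<longlonglongrightarrow> 0 \<and> \<rho> = 0"
      then show ?thesis using incremental_solution_exists[OF p assms(10)] by metis
    qed
    moreover have "pointwise_limit_on {0..T} \<epsilon>s \<epsilon> \<and> pointwise_limit_on {0..T} zs z"
      if "incremental_solution (W \<rho>) D \<sigma> \<epsilon>0 z0 (N \<tau>) (p \<tau>) \<epsilon> z" for \<epsilon> z
      using incremental_solution_limit[OF \<rho>0 \<rho>s0 \<rho>cases p assms(10) sols that] by simp
    ultimately show ?thesis using False \<tau>pos by (simp add: solution_def)
  next
    case True
    have \<tau>lim: "\<tau>s \<longlonglongrightarrow> 0" using assms(16) True by simp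
    have stab': "(\<epsilon>0, z0) \<in> stable_states (W (\<rho>s k)) D (\<sigma> 0)" for k using stab[OF True] by blast
    \<comment> \<open>Stated for arbitrary subsequences: the identity gives existence and the case
      \<open>\<rho> = 0\<close>, and for \<open>\<rho> > 0\<close> the general form feeds the
      subsequence principle.\<close>
    have compact: "\<exists>r' \<epsilon> z. strict_mono (r' :: nat \<Rightarrow> nat) \<and> energetic_solution (W \<rho>) D T \<sigma> \<sigma>' \<epsilon>0 z0 \<epsilon> z \<and>
        pointwise_limit_on {0..T} ((\<lambda>k. \<epsilon>s (r k)) \<circ> r') \<epsilon> \<and> pointwise_limit_on {0..T} ((\<lambda>k. zs (r k)) \<circ> r') z"
      if r: "strict_mono r" for r :: "nat \<Rightarrow> nat"
    proof -
      have \<rho>r: "(\<forall>k. \<rho>s (r k) = \<rho>) \<or> ((\<lambda>k. \<rho>s (r k)) \<longlonglongrightarrow> 0 \<and> \<rho> = 0)"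
        using \<rho>cases LIMSEQ_subseq_LIMSEQ[OF _ r, of \<rho>s 0] by (auto simp: o_def)
      have \<tau>r: "(\<lambda>k. \<tau>s (r k)) \<longlonglongrightarrow> 0" using LIMSEQ_subseq_LIMSEQ[OF \<tau>lim r] by (simp add: o_def)
      show ?thesis
        by (rule solutions_compact[OF \<rho>0 \<rho>s0 \<rho>r \<tau>s0 \<tau>r part stab' sol]; (assumption | intro exI conjI)+)
    qed
    show ?thesis
    proof (cases "\<rho> = 0")
      case \<rho>: True
      have "\<exists>r \<epsilon> z. strict_mono (r :: nat \<Rightarrow> nat) \<and> energetic_solution (W \<rho>) D T \<sigma> \<sigma>' \<epsilon>0 z0 \<epsilon> z \<and>
          pointwise_limit_on {0..T} (\<epsilon>s \<circ> r) \<epsilon> \<and> pointwise_limit_on {0..T} (zs \<circ> r) z"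
        using compact[OF strict_mono_id] by (simp only: id_apply)
      then show ?thesis using \<rho> True by (simp add: solution_def)
    next
      case False
      then have \<rho>pos: "0 < \<rho>" using \<rho>0 by simp
      have ex: "\<exists>\<epsilon> z. energetic_solution (W \<rho>) D T \<sigma> \<sigma>' \<epsilon>0 z0 \<epsilon> z" using compact[OF strict_mono_id] by blast
      have "pointwise_limit_on {0..T} \<epsilon>s \<epsilon> \<and> pointwise_limit_on {0..T} zs z"
        if es: "energetic_solution (W \<rho>) D T \<sigma> \<sigma>' \<epsilon>0 z0 \<epsilon> z" for \<epsilon> z
      proof -
        \<comment> \<open>The limit depends a priori on the subsequence; for
          \<open>\<rho> > 0\<close> uniqueness identifies it with the given solution.\<close>
        have sub: "\<exists>r'. strict_mono r' \<and> (\<lambda>k. \<epsilon>s (r (r' k)) t) \<longlonglongrightarrow> \<epsilon> t \<and> (\<lambda>k. zs (r (r' k)) t) \<longlonglongrightarrow> z t"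
          if t: "t \<in> {0..T}" and r: "strict_mono r" for t and r :: "nat \<Rightarrow> nat"
        proof -
          from compact[OF r] obtain r' \<epsilon>' z' where r': "strict_mono r'"
            and es': "energetic_solution (W \<rho>) D T \<sigma> \<sigma>' \<epsilon>0 z0 \<epsilon>' z'"
            and lim: "pointwise_limit_on {0..T} ((\<lambda>k. \<epsilon>s (r k)) \<circ> r') \<epsilon>'" "pointwise_limit_on {0..T} ((\<lambda>k. zs (r k)) \<circ> r') z'"
            by blast
          show ?thesis
            using r' lim t energetic_solution_unique[OF \<rho>pos es es' t]
            by (auto simp: pointwise_limit_on_def o_def)
        qed
        show ?thesis unfolding pointwise_limit_on_def
        proof (intro conjI ballI)
          fix t assume t: "t \<in> {0..T}"
          show "(\<lambda>k. \<epsilon>s k t) \<longlonglongrightarrow> \<epsilon> t" "(\<lambda>k. zs k t) \<longlonglongrightarrow> z t"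
            by (rule LIMSEQ_by_subsequences; use sub[OF t] in blast)+
        qed
      qed
      with ex show ?thesis using False True by (simp add: solution_def)
    qed
  qed
qed

end
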